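(* Let $n,m,k\ge 2$ be pairwise coprime integers with $n<m<k$, let $f:(\mathbb{C}^2,0)\to(\mathbb{C}^3,0)$ be the (finitely determined) map germ $f(x,y)=(x^n,y^m,(x+y)^k)$, and let $F(x,y,t)=(f_t(x,y),t)$ be its $1$-parameter unfolding given by $$f_t(x,y)=(x^n+ty^n,\ y^m,\ (x+y)^k).$$ Then $F$ is topologically trivial, but $F$ is not Whitney equisingular. Moreover, for a generic plane $H\subset\mathbb{C}^3$ through $0$ and $\tilde Y_t=f_t^{-1}(H)$, one has $\mu(\tilde Y_0,0)=(n-1)(m-1)>(n-1)^2=\mu(\tilde Y_t,0)$ for $t\neq0$ small.
   Context: All germs are holomorphic. "Finitely determined" means $\mathcal{A}$-finitely determined ($\mathcal{A}$ = holomorphic coordinate changes in source and target). $\mu$ denotes the Milnor number of a plane curve germ. A $1$-parameter unfolding $F(z,t)=(f_t(z),t)$ of $f=f_0$ is origin preserving: $f_t(0)=0$ for all $t$. It is topologically trivial if there are germs of homeomorphisms $\Phi(z,t)=(\phi_t(z),t)$ of $(\mathbb{C}^2\times\mathbb{C},0)$ and $\Psi(w,t)=(\psi_t(w),t)$ of $(\mathbb{C}^3\times\mathbb{C},0)$ with $\phi_0=\mathrm{id}$, $\psi_0=\mathrm{id}$, $\phi_t(0)=0$, $\psi_t(0)=0$ and $\Psi^{-1}\circ F\circ\Phi=f\times\mathrm{id}$. Whitney equisingularity. Let $T=\{0\}\times\mathbb{C}$ be the parameter axis (in source and in target), and let $D(F)\subset\mathbb{C}^2\times\mathbb{C}$ be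 the double point set of $F$ (the closed set of points at which $F$ is either non-injective or non-immersive). Near the origin, stratify the source by $(\mathbb{C}^2\times\mathbb{C})\setminus D(F)$, $D(F)\setminus T$, $T$, and the target by $(\mathbb{C}^3\times\mathbb{C})\setminus F(\mathbb{C}^2\times\mathbb{C})$, $F(\mathbb{C}^2\times\mathbb{C})\setminus F(D(F))$, $F(D(F))\setminus T$, $T$. $F$ is Whitney equisingular if these stratifications in source and target are Whitney equisingular along $T$, i.e. every stratum satisfies the Whitney conditions along $T$. *)

theory Defs
  imports "HOL-Analysis.Analysis" "HOL-Computational_Algebra.Polynomial"
    "HOL-Library.Extended_Nat"
begin

section \<open>Unfoldings and topological triviality\<close>

type_synonym C2 = "complex \<times> complex"
type_synonym C3 = "complex \<times> complex \<times> complex"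

definition unfolding_of :: "(complex \<Rightarrow> 'a \<Rightarrow> 'b) \<Rightarrow> 'a \<times> complex \<Rightarrow> 'b \<times> complex"
  where "unfolding_of f = (\<lambda>(z, t). (f t z, t))"

text \<open>A level-preserving homeomorphism germ, given by a representative together with its inverse,
  fixing the parameter axis and restricting to the identity over the parameter value 0.\<close>

definition homeo_unfolding ::
    "(complex \<Rightarrow> 'a \<Rightarrow> 'a) \<Rightarrow> (complex \<Rightarrow> 'a \<Rightarrow> 'a::real_normed_vector) \<Rightarrow> bool"
  where "homeo_unfolding \<phi> \<phi>' \<longleftrightarrow>
    (\<exists>U U'. open U \<and> 0 \<in> U \<and> open U' \<and> 0 \<in> U' \<and>
       homeomorphism U U' (unfolding_of \<phi>) (unfolding_of \<phi>') \<and>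
       (\<forall>z. (z, 0) \<in> U \<longrightarrow> \<phi> 0 z = z) \<and>
       (\<forall>t. (0, t) \<in> U \<longrightarrow> \<phi> t 0 = 0))"

definition topologically_trivial ::
    "(complex \<Rightarrow> 'a::real_normed_vector \<Rightarrow> 'b::real_normed_vector) \<Rightarrow> bool"
  where "topologically_trivial f \<longleftrightarrow>
    (\<exists>\<phi> \<phi>' \<psi> \<psi>'. homeo_unfolding \<phi> \<phi>' \<and> homeo_unfolding \<psi> \<psi>' \<and>
       (\<forall>\<^sub>F p in nhds 0.
          (unfolding_of \<psi>' \<circ> unfolding_of f \<circ> unfolding_of \<phi>) p = map_prod (f 0) id p))"


section \<open>Whitney conditions\<close>

text \<open>Velocities of curves in \<open>X\<close> through \<open>p\<close>; for a submanifold \<open>X\<close> this is the usual tangent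
  space.\<close>

definition tangent_space :: "'a::real_normed_vector set \<Rightarrow> 'a \<Rightarrow> 'a set"
  where "tangent_space X p =
    {v. \<exists>\<gamma> :: real \<Rightarrow> 'a. \<gamma> 0 = p \<and> (\<forall>\<^sub>F s in nhds 0. \<gamma> s \<in> X) \<and>
          (\<gamma> has_vector_derivative v) (at 0)}"

text \<open>Convergence in the Grassmannian, as convergence of the orthogonal projections
  (\<open>closest_point S\<close> is the orthogonal projection onto a subspace \<open>S\<close>).\<close>

definition subspace_tendsto :: "(nat \<Rightarrow> 'a::euclidean_space set) \<Rightarrow> 'a set \<Rightarrow> bool"
  where "subspace_tendsto S \<tau> \<longleftrightarrow>
    subspace \<tau> \<and> (\<forall>v. (\<lambda>i. closest_point (S i) v) \<longlonglongrightarrow> closest_point \<tau> v)"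

definition whitney_a :: "'a::euclidean_space set \<Rightarrow> 'a set \<Rightarrow> bool"
  where "whitney_a X Y \<longleftrightarrow>
    (\<forall>x y \<tau>. range x \<subseteq> X \<and> y \<in> Y \<and> x \<longlonglongrightarrow> y \<and>
       subspace_tendsto (\<lambda>i. tangent_space X (x i)) \<tau>
       \<longrightarrow> tangent_space Y y \<subseteq> \<tau>)"

text \<open>Secant lines are represented by their unit vectors. For complex submanifolds the limits of
  tangent spaces are complex subspaces, so real and complex secants give the same condition.\<close>

definition whitney_b :: "'a::euclidean_space set \<Rightarrow> 'a set \<Rightarrow> bool"
  where "whitney_b X Y \<longleftrightarrow>
    (\<forall>x y y\<^sub>0 \<tau> u. range x \<subseteq> X \<and> range y \<subseteq> Y \<and> y\<^sub>0 \<in> Y \<and> x \<longlonglongrightarrow> y\<^sub>0 \<and> y \<longlonglongrightarrow> y\<^sub>0 \<and>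
       subspace_tendsto (\<lambda>i. tangent_space X (x i)) \<tau> \<and>
       (\<lambda>i. sgn (x i - y i)) \<longlonglongrightarrow> u
       \<longrightarrow> u \<in> \<tau>)"

definition whitney_along :: "'a::euclidean_space set \<Rightarrow> 'a set \<Rightarrow> bool"
  where "whitney_along X Y \<longleftrightarrow> whitney_a X Y \<and> whitney_b X Y"


section \<open>Whitney equisingularity of an unfolding\<close>

definition parameter_axis :: "('a::zero \<times> complex) set"
  where "parameter_axis = {0} \<times> UNIV"

text \<open>\<open>frechet_derivative\<close> is the real differential; for holomorphic \<open>F\<close> it is complex linear, so
  its injectivity is the immersion condition.\<close>

definition double_point_set :: "('a::real_normed_vector \<Rightarrow> 'b::real_normed_vector) \<Rightarrow> 'a set \<Rightarrow> 'a set"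
  where "double_point_set F U =
    {z \<in> U. (\<exists>z'\<in>U. z' \<noteq> z \<and> F z' = F z) \<or> \<not> inj (frechet_derivative F (at z))}"

text \<open>A representative \<open>F : U \<rightarrow> V\<close> of a finite germ that is proper with zero fibre \<open>{0}\<close>. For
  such representatives the germs at 0 of \<open>D(F)\<close>, \<open>F(U)\<close> and \<open>F(D(F))\<close> do not depend on \<open>U\<close>
  and \<open>V\<close>.\<close>

definition good_representative ::
    "('a::real_normed_vector \<Rightarrow> 'b::real_normed_vector) \<Rightarrow> 'a set \<Rightarrow> 'b set \<Rightarrow> bool"
  where "good_representative F U V \<longleftrightarrow>
    open U \<and> 0 \<in> U \<and> open V \<and> 0 \<in> V \<and> F ` U \<subseteq> V \<and> {z \<in> U. F z = 0} = {0} \<and>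
    (\<forall>K. compact K \<and> K \<subseteq> V \<longrightarrow> compact {z \<in> U. F z \<in> K})"

definition whitney_equisingular ::
    "('a::euclidean_space \<times> complex \<Rightarrow> 'b::euclidean_space \<times> complex) \<Rightarrow> bool"
  where "whitney_equisingular F \<longleftrightarrow>
    (\<exists>U V. good_representative F U V \<and>
      (let D = double_point_set F U; T = parameter_axis; S = parameter_axis in
         whitney_along (U - D) (U \<inter> T) \<and>
         whitney_along (D - T) (U \<inter> T) \<and>
         whitney_along (V - F ` U) (V \<inter> S) \<and>
         whitney_along (F ` U - F ` D) (V \<inter> S) \<and>
         whitney_along (F ` D - S) (V \<inter> S)))"


section \<open>Milnor numbers of plane curve germs\<close>

definition holomorphic_germ :: "(C2 \<Rightarrow> complex) \<Rightarrow> bool"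
  where "holomorphic_germ g \<longleftrightarrow>
    (\<forall>\<^sub>F z in nhds 0. \<exists>a b. (g has_derivative (\<lambda>(u, v). a * u + b * v)) (at z))"

definition partial_x :: "(C2 \<Rightarrow> complex) \<Rightarrow> C2 \<Rightarrow> complex"
  where "partial_x g = (\<lambda>(x, y). deriv (\<lambda>u. g (u, y)) x)"

definition partial_y :: "(C2 \<Rightarrow> complex) \<Rightarrow> C2 \<Rightarrow> complex"
  where "partial_y g = (\<lambda>(x, y). deriv (\<lambda>v. g (x, v)) y)"

definition jacobian_ideal :: "(C2 \<Rightarrow> complex) \<Rightarrow> (C2 \<Rightarrow> complex) set"
  where "jacobian_ideal g =
    {h. \<exists>p q. holomorphic_germ p \<and> holomorphic_germ q \<and>
          (\<forall>\<^sub>F z in nhds 0. h z = p z * partial_x g z + q z * partial_y g z)}"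

text \<open>The complex dimension of the quotient of the ring of holomorphic germs at 0 by the Jacobian
  ideal, as the supremum of the sizes of finite sets linearly independent modulo the ideal.
  Germs are represented by functions; equality of germs is built into \<open>jacobian_ideal\<close>.\<close>

definition milnor_number :: "(C2 \<Rightarrow> complex) \<Rightarrow> enat"
  where "milnor_number g =
    Sup {enat (card B) | B. finite B \<and> (\<forall>b\<in>B. holomorphic_germ b) \<and>
           (\<forall>c. (\<lambda>z. \<Sum>b\<in>B. c b * b z) \<in> jacobian_ideal g \<longrightarrow> (\<forall>b\<in>B. c b = 0))}"

text \<open>The plane curve germ \<open>(Y, 0)\<close> has Milnor number \<open>N\<close>. Since \<open>N\<close> is finite, the equation
  \<open>g\<close> has at most an isolated singularity at 0 and is therefore reduced, so \<open>N\<close> depends only on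
  the germ of \<open>Y\<close>.\<close>

definition curve_has_milnor_number :: "C2 set \<Rightarrow> nat \<Rightarrow> bool"
  where "curve_has_milnor_number Y N \<longleftrightarrow>
    (\<exists>g. holomorphic_germ g \<and> g 0 = 0 \<and> (\<forall>\<^sub>F z in nhds 0. z \<in> Y \<longleftrightarrow> g z = 0) \<and>
         milnor_number g = enat N)"


section \<open>Generic planes through the origin\<close>

definition plane :: "complex \<Rightarrow> complex \<Rightarrow> complex \<Rightarrow> C3 set"
  where "plane a b c = {(X, Y, Z). a * X + b * Y + c * Z = 0}"

text \<open>Generic: for all planes in a nonempty Zariski open set, the polynomial \<open>p\<close> in three variables
  being encoded as an iterated univariate polynomial.\<close>

definition generic_plane :: "(C3 set \<Rightarrow> bool) \<Rightarrow> bool"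
  where "generic_plane P \<longleftrightarrow>
    (\<exists>p :: complex poly poly poly. p \<noteq> 0 \<and>
       (\<forall>a b c. (a, b, c) \<noteq> 0 \<and> poly (poly (poly p [:[:a:]:]) [:b:]) c \<noteq> 0
          \<longrightarrow> P (plane a b c)))"

end

theory Submission
  imports Defs "HOL-Complex_Analysis.Complex_Analysis"
    "HOL-Computational_Algebra.Fundamental_Theorem_Algebra"
begin

text \<open>Topological triviality. The group \<open>\<mu>\<^sub>n \<times> \<mu>\<^sub>m \<times> \<mu>\<^sub>k\<close> of roots of unity governs the double points:
  those of \<open>f 0\<close> are the lines of slope \<open>x / y = (\<zeta> - \<eta>) / (\<eta> - \<omega>)\<close> with \<open>\<omega>, \<zeta>, \<eta>\<close> pairwise distinct,
  and by coprimality these slopes are distinct, so the double point lines of \<open>f t\<close> move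
  without colliding. A source homeomorphism \<open>(x, y) \<mapsto> (x + y \<tau>\<^sub>t(x / y), y)\<close> moves the lines of \<open>f 0\<close>
  to those of \<open>f t\<close>. The target homeomorphism is a composition of two, the first moving only the third
  coordinate \<open>(x + y) ^ k\<close> over the fibres of \<open>(x ^ n, y ^ m)\<close>, the second only the first
  coordinate over the fibres of the other two. Each is the identity plus a fibrewise
  Lipschitz extension (with constant \<open>O(t)\<close>) of a displacement prescribed on the finite fibres,
  and no integration of vector fields is needed.

  Whitney's condition (b) fails for the stratum of simple points of the image along the points
  \<open>x = 0\<close>, \<open>y = \<epsilon>\<close>, \<open>t = \<epsilon> ^ (m - n)\<close>, where the secants tend to \<open>(1, 1, 0, 0)\<close>, up to a factor, and the
  tangent spaces tend to the hyperplane \<open>X = (n / m) Y\<close>.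

  Milnor numbers. The partial derivatives of the equation of the section have the initial
  forms \<open>x ^ p\<close> and \<open>y ^ q\<close> up to nonzero factors, with \<open>p = n - 1\<close> and \<open>q = m - 1\<close> or \<open>q = n - 1\<close>, and
  their higher order terms have order above \<open>q \<ge> p\<close>, so the monomials \<open>x ^ i y ^ j\<close> with \<open>i < p\<close>
  and \<open>j < q\<close> are a basis of the quotient by the Jacobian ideal.\<close>


section \<open>Fibrewise Lipschitz extension\<close>

text \<open>For fixed \<open>t\<close> every coordinate of \<open>f t\<close> is homogeneous in
  \<open>(x, y)\<close>, so all estimates reduce to the slope \<open>c = x / y\<close>. The obstacle
  is the Lipschitz constant O(t): when the points of a fibre are shifted, the difference of a
  coordinate at two of them must change by at most O(t) times itself, although it vanishes on the
  double point lines. Two features keep the quotient bounded there. The slopes of these lines are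
  simple zeros of the difference, because the roots of unity involved are distinct. And the shift
  \<open>\<tau>\<close> is constant in \<open>c\<close> near each of these slopes, so the change is
  a combination of mixed second differences and vanishes to first order in the distance to the
  slope. For a scalar displacement a Lipschitz constant below 1 already gives injectivity on each
  fibre, which is why the target is moved one coordinate at a time. In the Whitney part the exponent
  \<open>m - n\<close> is dictated by \<open>t * y ^ n = y ^ m\<close>: the values of the first two
  coordinates agree while their \<open>y\<close>-derivatives keep the ratio
  \<open>n / m\<close>.\<close>

lemma homeo_unfolding_of_injective:
  fixes \<phi> :: "complex \<Rightarrow> 'a::euclidean_space \<Rightarrow> 'a"
  assumes "0 < \<epsilon>"
    and cont: "continuous_on (UNIV \<times> ball 0 \<epsilon>) (\<lambda>p. \<phi> (snd p) (fst p))"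
    and inj: "\<And>t. t \<in> ball 0 \<epsilon> \<Longrightarrow> inj (\<phi> t)"
    and id: "\<And>z. \<phi> 0 z = z"
    and fix0: "\<And>t. t \<in> ball 0 \<epsilon> \<Longrightarrow> \<phi> t 0 = 0"
  shows "\<exists>\<phi>'. homeo_unfolding \<phi> \<phi>' \<and> (\<forall>t\<in>ball 0 \<epsilon>. \<forall>z. \<phi>' t (\<phi> t z) = z)"
proof -
  define U :: "('a \<times> complex) set" where "U = UNIV \<times> ball 0 \<epsilon>"
  define P where "P = unfolding_of \<phi>"
  define \<phi>' where "\<phi>' = (\<lambda>t. inv (\<phi> t))"
  have U: "open U" "0 \<in> U"
    using \<open>0 < \<epsilon>\<close> by (auto simp: U_def open_Times zero_prod_def)
  have contP: "continuous_on U P"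
    unfolding P_def unfolding_of_def U_def split_beta
    by (intro continuous_intros cont)
  have injP: "inj_on P U"
  proof (rule inj_onI)
    fix p q assume "p \<in> U" "q \<in> U" "P p = P q"
    then show "p = q"
      using injD[OF inj[of "snd q"], of "fst p" "fst q"]
      by (auto simp: P_def unfolding_of_def U_def split_beta prod_eq_iff)
  qed
  \<comment> \<open>Invariance of domain supplies the continuous inverse on an open image, so joint
    continuity and injectivity on each level suffice.\<close>
  have "homeomorphism U (P ` U) P (unfolding_of \<phi>')"
  proof -
    obtain g where g: "homeomorphism U (P ` U) P g"
      by (rule invariance_of_domain_homeomorphism[OF U(1) contP order.refl injP])
    have "g y = unfolding_of \<phi>' y" if y: "y \<in> P ` U" for y
    proof -
      obtain p where p: "p \<in> U" "y = P p" using y by blast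
      obtain z t where "p = (z, t)" by (cases p)
      with p have z: "y = P (z, t)" "(z, t) \<in> U" by simp_all
      then have "g y = (z, t)" using g by (auto simp: homeomorphism_def)
      moreover have "unfolding_of \<phi>' y = (z, t)"
        using z inj[of t] by (simp add: P_def unfolding_of_def \<phi>'_def U_def)
      ultimately show ?thesis by simp
    qed
    then show ?thesis using homeomorphism_cong[OF g refl refl] by simp
  qed
  moreover have "open (P ` U)"
    using invariance_of_domain[OF contP U(1) injP] .
  moreover have "0 \<in> P ` U"
    using U(2) fix0[of 0] \<open>0 < \<epsilon>\<close>
    by (intro image_eqI[of _ _ 0]) (auto simp: P_def unfolding_of_def zero_prod_def)
  ultimately have "homeo_unfolding \<phi> \<phi>'"
    unfolding homeo_unfolding_def using U id fix0
    by (intro exI[of _ U] exI[of _ "P ` U"]) (auto simp: P_def U_def)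
  moreover have "\<phi>' t (\<phi> t z) = z" if "t \<in> ball 0 \<epsilon>" for t z
    using inj[OF that] by (simp add: \<phi>'_def)
  ultimately show ?thesis by blast
qed

text \<open>Openness of power maps serves to push continuity down along
  \<open>(x, y) \<mapsto> (x ^ i, y ^ j)\<close>: a function on the base is continuous as soon as
  its pullback is.\<close>

lemma open_image_power:
  assumes "open (S :: complex set)" and "0 < j"
  shows "open ((\<lambda>z. z ^ j) ` S)"
proof (rule open_mapping_thm[of "\<lambda>z. z ^ j" UNIV])
  show "\<not> (\<lambda>z::complex. z ^ j) constant_on UNIV"
  proof
    assume "(\<lambda>z::complex. z ^ j) constant_on UNIV"
    then have "(0::complex) ^ j = 1 ^ j" unfolding constant_on_def by (metis UNIV_I)
    then show False using \<open>0 < j\<close> by (simp add: zero_power)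
  qed
qed (auto intro!: holomorphic_intros simp: assms)

lemma open_image_map_prod:
  assumes f: "\<And>S. open S \<Longrightarrow> open (f ` S)" and g: "\<And>S. open S \<Longrightarrow> open (g ` S)"
    and "open S"
  shows "open (map_prod f g ` S)"
proof (rule open_prod_intro)
  fix y assume "y \<in> map_prod f g ` S"
  then obtain a b where ab: "(a, b) \<in> S" "y = (f a, g b)" by auto
  then obtain A B where "open A" "open B" "a \<in> A" "b \<in> B" "A \<times> B \<subseteq> S"
    using open_prod_elim[OF \<open>open S\<close>] by (metis mem_Sigma_iff)
  then show "\<exists>A B. open A \<and> open B \<and> y \<in> A \<times> B \<and> A \<times> B \<subseteq> map_prod f g ` S"
    using ab by (intro exI[of _ "f ` A"] exI[of _ "g ` B"] conjI f g) (auto simp: map_prod_def)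
qed

lemma continuous_on_Min_image:
  fixes f :: "'i \<Rightarrow> 'a::topological_space \<Rightarrow> real"
  assumes "finite R" "R \<noteq> {}" "\<And>g. g \<in> R \<Longrightarrow> continuous_on S (f g)"
  shows "continuous_on S (\<lambda>x. Min ((\<lambda>g. f g x) ` R))"
  using assms
proof (induction R rule: finite_ne_induct)
  case (insert g R)
  have "(\<lambda>x. Min ((\<lambda>g. f g x) ` insert g R)) = (\<lambda>x. min (f g x) (Min ((\<lambda>g. f g x) ` R)))"
    using insert.hyps by simp
  moreover have "continuous_on S (\<lambda>x. min (f g x) (Min ((\<lambda>g. f g x) ` R)))"
    by (rule continuous_on_min[OF insert.prems insert.IH[OF insert.prems]]) simp_all
  ultimately show ?case by metis
qed simp

lemma Min_image_diff_le:
  fixes f h :: "'i \<Rightarrow> real"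
  assumes "finite R" "R \<noteq> {}" and le: "\<And>g. g \<in> R \<Longrightarrow> \<bar>f g - h g\<bar> \<le> L"
  shows "\<bar>Min (f ` R) - Min (h ` R)\<bar> \<le> L"
proof -
  have f: "Min (f ` R) \<le> f g" and h: "Min (h ` R) \<le> h g" if "g \<in> R" for g
    using assms(1) that by simp_all
  have "Min (f ` R) \<in> f ` R" "Min (h ` R) \<in> h ` R" using assms(1,2) by simp_all
  then obtain a b where a: "a \<in> R" "Min (f ` R) = f a" and b: "b \<in> R" "Min (h ` R) = h b"
    by blast
  show ?thesis
    using le[OF a(1)] le[OF b(1)] f[OF b(1)] h[OF a(1)] unfolding a(2) b(2) by linarith
qed

lemma eq_power_imp_root_of_unity:
  fixes x y :: complex
  assumes "x ^ i = y ^ i" "0 < i"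
  obtains \<omega> where "\<omega> ^ i = 1" "y = \<omega> * x"
proof (cases "x = 0")
  case True
  then have "y ^ i = 0" using assms by (metis zero_power)
  then show ?thesis using that[of 1] True by simp
next
  case False
  then have "x ^ i \<noteq> 0" by simp
  then have "(y / x) ^ i = 1" unfolding power_divide assms(1)[symmetric] by simp
  then show ?thesis using that[of "y / x"] False by simp
qed

text \<open>McShane's extension formula over the finite fibres of \<open>(x, y) \<mapsto> (x ^ i, y ^ j)\<close>: the
  displacement \<open>b - a\<close>, prescribed at the points \<open>a t z\<close> of the fibre and Lipschitz there, extends
  to a displacement of the whole line over each point of the base, depending continuously on it.\<close>

lemma fibrewise_lipschitz_extension:
  fixes a b :: "complex \<Rightarrow> C2 \<Rightarrow> complex"
  assumes ij: "0 < i" "0 < j" and "0 < \<epsilon>" "0 \<le> K"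
    and conta: "continuous_on (UNIV \<times> ball 0 \<epsilon>) (\<lambda>p. a (snd p) (fst p))"
    and contb: "continuous_on (UNIV \<times> ball 0 \<epsilon>) (\<lambda>p. b (snd p) (fst p))"
    and est: "\<And>t x y \<omega> \<zeta>. t \<in> ball 0 \<epsilon> \<Longrightarrow> \<omega> ^ i = 1 \<Longrightarrow> \<zeta> ^ j = 1 \<Longrightarrow>
      norm ((b t (\<omega> * x, \<zeta> * y) - b t (x, y)) - (a t (\<omega> * x, \<zeta> * y) - a t (x, y)))
        \<le> K * norm t * norm (a t (\<omega> * x, \<zeta> * y) - a t (x, y))"
    and b0: "b 0 = a 0"
  obtains H where
    "continuous_on ((UNIV \<times> UNIV) \<times> ball 0 \<epsilon>) (\<lambda>p. H (snd p) (fst (fst p)) (snd (fst p)))"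
    "\<And>t x y. t \<in> ball 0 \<epsilon> \<Longrightarrow> H t (a t (x, y)) (x ^ i, y ^ j) = b t (x, y)"
    "\<And>t v v' w. norm ((H t v w - v) - (H t v' w - v')) \<le> 2 * K * norm t * norm (v - v')"
    "\<And>v w. H 0 v w = v"
proof -
  define R where "R = {(\<omega>, \<zeta>). \<omega> ^ i = (1::complex) \<and> \<zeta> ^ j = (1::complex)}"
  have "R = {\<omega>. \<omega> ^ i = 1} \<times> {\<zeta>. \<zeta> ^ j = 1}"
    by (auto simp: R_def)
  moreover have "finite {\<omega>::complex. \<omega> ^ i = 1}" "finite {\<zeta>::complex. \<zeta> ^ j = 1}"
    using ij by (auto intro!: finite_roots_unity)
  moreover have "(1, 1) \<in> R" by (simp add: R_def)
  ultimately have R: "finite R" "(1, 1) \<in> R" "R \<noteq> {}"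
    by (metis finite_cartesian_product, simp, blast)
  define act where "act = (\<lambda>(g :: C2) (z :: C2). (fst g * fst z, snd g * snd z))"
  define pw where "pw = (\<lambda>z :: C2. (fst z ^ i, snd z ^ j))"
  define d where "d = (\<lambda>t z. b t z - a t z)"
  \<comment> \<open>The competing McShane bounds, one for each point \<open>act g z\<close> of the
    fibre. The formula is real valued and is therefore applied to \<open>Re\<close> and
    \<open>Im\<close> separately.\<close>
  define E where "E = (\<lambda>pr :: complex \<Rightarrow> real. \<lambda>t v z g. pr (d t (act g z)) + K * norm t * norm (v - a t (act g z)))"
  define M where "M = (\<lambda>t v z. v + Complex (Min (E Re t v z ` R)) (Min (E Im t v z ` R)))"
  \<comment> \<open>The value may depend on the base point \<open>w\<close> only. The choice of a
    preimage is harmless because the minimum in \<open>M\<close> runs over a full orbit.\<close>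
  define H where "H = (\<lambda>t v w. M t v (SOME z. pw z = w))"
  have pw_eq: "\<exists>h\<in>R. z' = act h z" if "pw z = pw z'" for z z'
  proof -
    from that have "fst z ^ i = fst z' ^ i" "snd z ^ j = snd z' ^ j" by (auto simp: pw_def)
    then obtain \<omega> \<zeta> where "\<omega> ^ i = 1" "fst z' = \<omega> * fst z" "\<zeta> ^ j = 1" "snd z' = \<zeta> * snd z"
      using eq_power_imp_root_of_unity ij by metis
    then show ?thesis by (intro bexI[of _ "(\<omega>, \<zeta>)"]) (auto simp: act_def R_def prod_eq_iff)
  qed
  have reindex: "(\<lambda>g. act g (act h z)) ` R = (\<lambda>g. act g z) ` R" if h: "h \<in> R" for h z
  proof -
    have "(\<lambda>g. act g h) ` R = R"
    proof
      show "(\<lambda>g. act g h) ` R \<subseteq> R" using h by (auto simp: R_def act_def power_mult_distrib)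
      show "R \<subseteq> (\<lambda>g. act g h) ` R"
      proof
        fix g assume g: "g \<in> R"
        have "fst h \<noteq> 0" "snd h \<noteq> 0" using h ij by (auto simp: R_def zero_power)
        then show "g \<in> (\<lambda>g. act g h) ` R" using g h
          by (intro image_eqI[of _ _ "(fst g / fst h, snd g / snd h)"])
             (auto simp: act_def R_def power_divide)
      qed
    qed
    moreover have "(\<lambda>g. act g (act h z)) = (\<lambda>g. act g z) \<circ> (\<lambda>g. act g h)"
      by (auto simp: act_def fun_eq_iff)
    ultimately show ?thesis by (metis image_comp)
  qed
  have M_inv: "M t v (act h z) = M t v z" if "h \<in> R" for t v h z
  proof -
    have "E pr t v z' ` R = (\<lambda>z. pr (d t z) + K * norm t * norm (v - a t z)) ` (\<lambda>g. act g z') ` R" for pr z'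
      by (auto simp: E_def image_image)
    then show ?thesis using reindex[OF that, of z] by (simp add: M_def)
  qed
  have HM: "H t v (pw z) = M t v z" for t v z
  proof -
    have "pw (SOME z'. pw z' = pw z) = pw z" by (rule someI) (rule refl)
    then obtain h where "h \<in> R" "(SOME z'. pw z' = pw z) = act h z" using pw_eq by metis
    then show ?thesis using M_inv[of h t v z] by (simp add: H_def)
  qed
  have pw_surj: "\<exists>z. w = pw z" for w
  proof -
    obtain x y where "x ^ i = fst w" "y ^ j = snd w"
      using ij exists_complex_root by (metis gr_implies_not0)
    then show ?thesis by (intro exI[of _ "(x, y)"]) (auto simp: pw_def)
  qed
  have opw: "open (pw ` S)" if "open S" for S
  proof -
    have "pw = map_prod (\<lambda>z. z ^ i) (\<lambda>z. z ^ j)" by (auto simp: pw_def fun_eq_iff)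
    then show ?thesis using open_image_map_prod open_image_power ij that by metis
  qed
  have contM: "continuous_on ((UNIV \<times> UNIV) \<times> ball 0 \<epsilon>) (\<lambda>p. M (snd p) (fst (fst p)) (snd (fst p)))"
  proof -
    have "continuous_on ((UNIV \<times> UNIV) \<times> ball 0 \<epsilon>) (\<lambda>p. f (snd p) (act g (snd (fst p))))"
      if "continuous_on (UNIV \<times> ball 0 \<epsilon>) (\<lambda>p. f (snd p) (fst p))" for f :: "complex \<Rightarrow> C2 \<Rightarrow> complex" and g
    proof -
      have "continuous_on ((UNIV \<times> UNIV) \<times> ball 0 \<epsilon>) ((\<lambda>p. f (snd p) (fst p)) \<circ> (\<lambda>p. (act g (snd (fst p)), snd p)))"
        by (intro continuous_on_compose continuous_on_subset[OF that])
           (auto simp: act_def intro!: continuous_intros)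
      then show ?thesis by (simp add: o_def)
    qed
    note c = this[OF conta] this[OF contb]
    show ?thesis
      unfolding M_def Complex_eq E_def d_def
      by (intro continuous_intros continuous_on_Min_image R c)
  qed
  have "continuous_on ((UNIV \<times> UNIV) \<times> ball 0 \<epsilon>) (\<lambda>p. H (snd p) (fst (fst p)) (snd (fst p)))"
  proof -
    define Q where "Q = map_prod (map_prod (id :: complex \<Rightarrow> complex) pw) (id :: complex \<Rightarrow> complex)"
    define D where "D = ((UNIV :: (complex \<times> C2) set)) \<times> ball (0::complex) \<epsilon>"
    have oD: "open D" by (auto simp: D_def open_Times)
    have oQ: "open (Q ` S)" if "open S" for S
      unfolding Q_def by (intro open_image_map_prod opw that) simp_all
    define h where "h = (\<lambda>p. H (snd p) (fst (fst p)) (snd (fst p)))"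
    define k where "k = (\<lambda>p. M (snd p) (fst (fst p)) (snd (fst p)))"
    have hQ: "h (Q p) = k p" for p
      by (simp add: h_def k_def Q_def HM)
    have "open (h -` O' \<inter> D)" if "open O'" for O'
    proof -
      \<comment> \<open>The map \<open>Q\<close> is open and surjective, so a preimage under
        \<open>h\<close> is the \<open>Q\<close>-image of the corresponding preimage under
        \<open>k\<close>, which is open.\<close>
      have "h -` O' \<inter> D = Q ` (k -` O' \<inter> D)"
      proof
        show "Q ` (k -` O' \<inter> D) \<subseteq> h -` O' \<inter> D" using hQ by (auto simp: D_def Q_def)
        show "h -` O' \<inter> D \<subseteq> Q ` (k -` O' \<inter> D)"
        proof
          fix p assume p: "p \<in> h -` O' \<inter> D"
          obtain z where "snd (fst p) = pw z" using pw_surj by blast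
          then have "p = Q ((fst (fst p), z), snd p)" by (simp add: Q_def prod_eq_iff)
          moreover define p' where "p' = ((fst (fst p), z), snd p)"
          ultimately have pp: "p = Q p'" by simp
          have "k p' \<in> O'" using p hQ[of p'] by (simp add: pp)
          moreover have "p' \<in> D" using p by (auto simp: D_def p'_def)
          ultimately show "p \<in> Q ` (k -` O' \<inter> D)" unfolding pp by blast
        qed
      qed
      moreover have "open (k -` O' \<inter> D)"
        using contM that oD by (simp add: k_def D_def continuous_on_open_vimage Int_commute)
      ultimately show ?thesis using oQ by simp
    qed
    then have "continuous_on D h" using continuous_on_open_vimage[OF oD] by (auto simp: Int_commute)
    then show ?thesis by (simp add: D_def h_def)
  qed
  moreover have "H t (a t (x, y)) (x ^ i, y ^ j) = b t (x, y)" if t: "t \<in> ball 0 \<epsilon>" for t x y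
  proof -
    \<comment> \<open>At a prescribed point the competitor of that point itself is the smallest;
      this is exactly the Lipschitz hypothesis \<open>est\<close>.\<close>
    have "Min (E pr t (a t (x, y)) (x, y) ` R) = pr (d t (x, y))"
      if pr: "\<And>z. \<bar>pr z\<bar> \<le> norm z" and add: "\<And>z w. pr (z - w) = pr z - pr w" for pr
    proof (rule Min_eqI)
      show "finite (E pr t (a t (x, y)) (x, y) ` R)" using R by simp
      show "pr (d t (x, y)) \<in> E pr t (a t (x, y)) (x, y) ` R"
        using R(2) by (intro image_eqI[of _ _ "(1, 1)"]) (auto simp: E_def act_def)
      fix e assume "e \<in> E pr t (a t (x, y)) (x, y) ` R"
      then obtain \<omega> \<zeta> where g: "\<omega> ^ i = 1" "\<zeta> ^ j = 1"
        "e = pr (d t (\<omega> * x, \<zeta> * y)) + K * norm t * norm (a t (x, y) - a t (\<omega> * x, \<zeta> * y))"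
        by (auto simp: R_def E_def act_def)
      have "pr (d t (x, y)) - pr (d t (\<omega> * x, \<zeta> * y)) \<le> norm (d t (x, y) - d t (\<omega> * x, \<zeta> * y))"
        using pr[of "d t (x, y) - d t (\<omega> * x, \<zeta> * y)"] add by simp
      also have "\<dots> = norm ((b t (\<omega> * x, \<zeta> * y) - b t (x, y)) - (a t (\<omega> * x, \<zeta> * y) - a t (x, y)))"
        by (subst norm_minus_commute) (simp add: d_def algebra_simps)
      also have "\<dots> \<le> K * norm t * norm (a t (\<omega> * x, \<zeta> * y) - a t (x, y))"
        by (rule est[OF t g(1,2)])
      finally show "pr (d t (x, y)) \<le> e" using g(3) by (simp add: norm_minus_commute)
    qed
    from this[of Re] this[of Im] have "M t (a t (x, y)) (x, y) = b t (x, y)"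
      by (simp add: M_def abs_Re_le_cmod abs_Im_le_cmod d_def complex_eq_iff)
    then show ?thesis using HM[of t _ "(x, y)"] by (simp add: pw_def)
  qed
  moreover have "norm ((H t v w - v) - (H t v' w - v')) \<le> 2 * K * norm t * norm (v - v')" for t v v' w
  proof -
    define z where "z = (SOME z. pw z = w)"
    have "\<bar>E pr t v z g - E pr t v' z g\<bar> \<le> K * norm t * norm (v - v')" for pr g
    proof -
      have "E pr t v z g - E pr t v' z g = K * norm t * (norm (v - a t (act g z)) - norm (v' - a t (act g z)))"
        by (simp add: E_def algebra_simps)
      also have "\<bar>\<dots>\<bar> = K * norm t * \<bar>norm (v - a t (act g z)) - norm (v' - a t (act g z))\<bar>"
        using \<open>0 \<le> K\<close> by (simp add: abs_mult)
      also have "\<dots> \<le> K * norm t * norm (v - v')"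
        using \<open>0 \<le> K\<close> norm_triangle_ineq3[of "v - a t (act g z)" "v' - a t (act g z)"]
        by (intro mult_left_mono) auto
      finally show ?thesis .
    qed
    then have *: "\<bar>Min (E pr t v z ` R) - Min (E pr t v' z ` R)\<bar> \<le> K * norm t * norm (v - v')" for pr
      by (intro Min_image_diff_le R)
    \<comment> \<open>Real and imaginary part each contribute \<open>K * norm t\<close>, whence the
      factor 2.\<close>
    have "norm ((H t v w - v) - (H t v' w - v'))
        \<le> \<bar>Min (E Re t v z ` R) - Min (E Re t v' z ` R)\<bar> + \<bar>Min (E Im t v z ` R) - Min (E Im t v' z ` R)\<bar>"
      using cmod_le[of "(H t v w - v) - (H t v' w - v')"] by (simp add: H_def M_def z_def)
    then show ?thesis using *[of Re] *[of Im] by simp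
  qed
  moreover have "H 0 v w = v" for v w
  proof -
    have "E pr 0 v z ` R = {0}" if "pr 0 = 0" for pr z
      using R(2) that by (auto simp: E_def d_def b0)
    from this[of Re] this[of Im] show ?thesis by (simp add: H_def M_def complex_eq_iff)
  qed
  ultimately show ?thesis using that by blast
qed


section \<open>The double point lines\<close>

lemma finite_uniform_lower_bound:
  fixes r :: "'i \<Rightarrow> real"
  assumes "finite T" "\<And>i. i \<in> T \<Longrightarrow> 0 < r i"
  obtains r0 where "0 < r0" "\<And>i. i \<in> T \<Longrightarrow> r0 \<le> r i"
proof
  show "0 < Min (insert 1 (r ` T))" using assms by simp
  show "Min (insert 1 (r ` T)) \<le> r i" if "i \<in> T" for i using assms that by simp
qed

lemma finite_uniform_upper_bound:
  fixes K :: "'i \<Rightarrow> real"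
  assumes "finite T"
  obtains K0 where "0 < K0" "\<And>i. i \<in> T \<Longrightarrow> K i \<le> K0"
proof
  show "0 < Max (insert 1 (K ` T))" using assms by (simp add: Max_gr_iff)
  show "K i \<le> Max (insert 1 (K ` T))" if "i \<in> T" for i using assms that by simp
qed

lemma coprime_roots_of_unity:
  fixes \<omega> :: "'a::comm_monoid_mult"
  assumes "coprime i j" "\<omega> ^ i = 1" "\<omega> ^ j = 1" "i \<noteq> 0"
  shows "\<omega> = 1"
proof -
  obtain x y where xy: "i * x = j * y + gcd i j" using bezout_nat[OF assms(4)] by blast
  have "\<omega> ^ (i * x) = 1" "\<omega> ^ (j * y) = 1" using assms by (simp_all add: power_mult)
  then have "\<omega> ^ (gcd i j) = 1" unfolding xy power_add by simp
  then show ?thesis using assms(1) by simp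
qed

lemma norm_root_of_unity:
  fixes \<omega> :: complex
  assumes "\<omega> ^ l = 1" "0 < l"
  shows "norm \<omega> = 1"
proof -
  have "norm \<omega> ^ l = 1" using assms(1) by (metis norm_one norm_power)
  then show ?thesis using power_eq_imp_eq_base[of "norm \<omega>" l 1] assms(2) by simp
qed

definition root_triples :: "nat \<Rightarrow> nat \<Rightarrow> nat \<Rightarrow> (complex \<times> complex \<times> complex) set"
  where "root_triples n m k = {(\<omega>, \<zeta>, \<eta>). \<omega> ^ n = 1 \<and> \<zeta> ^ m = 1 \<and> \<eta> ^ k = 1 \<and>
    \<omega> \<noteq> \<zeta> \<and> \<zeta> \<noteq> \<eta> \<and> \<eta> \<noteq> \<omega>}"

text \<open>The point \<open>(c, 1)\<close> with \<open>c = slope (\<omega>, \<zeta>, \<eta>)\<close> satisfies \<open>\<eta> * (c + 1) = \<omega> * c + \<zeta>\<close>, so that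
  it has the same image under \<open>f 0\<close> as \<open>(\<omega> * c, \<zeta>)\<close>.\<close>

definition slope :: "complex \<times> complex \<times> complex \<Rightarrow> complex"
  where "slope = (\<lambda>(\<omega>, \<zeta>, \<eta>). (\<zeta> - \<eta>) / (\<eta> - \<omega>))"

lemma finite_root_triples:
  assumes "0 < n" "0 < m" "0 < k"
  shows "finite (root_triples n m k)"
proof (rule finite_subset)
  show "root_triples n m k \<subseteq> {\<omega>. \<omega> ^ n = 1} \<times> {\<zeta>. \<zeta> ^ m = 1} \<times> {\<eta>. \<eta> ^ k = 1}"
    by (auto simp: root_triples_def)
  show "finite ({\<omega>::complex. \<omega> ^ n = 1} \<times> {\<zeta>::complex. \<zeta> ^ m = 1} \<times> {\<eta>::complex. \<eta> ^ k = 1})"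
    using assms by (intro finite_cartesian_product finite_roots_unity) simp_all
qed

text \<open>No double point line with three distinct roots is \<open>x = 0\<close> or
  \<open>x + y = 0\<close>: these would need \<open>\<zeta> = \<eta>\<close> or
  \<open>\<zeta> = \<omega>\<close>.\<close>

lemma slope_eq:
  assumes "(\<omega>, \<zeta>, \<eta>) \<in> root_triples n m k"
  shows "\<eta> * (slope (\<omega>, \<zeta>, \<eta>) + 1) = \<omega> * slope (\<omega>, \<zeta>, \<eta>) + \<zeta>"
    and "slope (\<omega>, \<zeta>, \<eta>) \<noteq> 0" and "slope (\<omega>, \<zeta>, \<eta>) \<noteq> - 1"
  using assms by (auto simp: root_triples_def slope_def divide_simps algebra_simps)

lemma root_triples_inverse:
  assumes "(\<omega>, \<zeta>, \<eta>) \<in> root_triples n m k"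
  shows "(1 / \<omega>, 1 / \<zeta>, 1 / \<eta>) \<in> root_triples n m k"
  using assms by (auto simp: root_triples_def power_divide divide_simps)

text \<open>Interchanging the two points of a double point pair inverts the roots. The partner of
  \<open>(c, 1)\<close> is \<open>(\<omega> * c, \<zeta>)\<close>, which has slope
  \<open>\<omega> / \<zeta> * c\<close>.\<close>

lemma slope_inverse:
  assumes "(\<omega>, \<zeta>, \<eta>) \<in> root_triples n m k" "0 < n" "0 < m" "0 < k"
  shows "slope (1 / \<omega>, 1 / \<zeta>, 1 / \<eta>) = \<omega> / \<zeta> * slope (\<omega>, \<zeta>, \<eta>)"
proof -
  have "\<omega> \<noteq> 0" "\<zeta> \<noteq> 0" "\<eta> \<noteq> 0" "\<eta> \<noteq> \<omega>" using assms by (auto simp: root_triples_def zero_power)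
  then show ?thesis by (simp add: slope_def divide_simps) (simp add: algebra_simps)
qed

lemma cnj_root_of_unity:
  assumes "\<omega> ^ n = 1" "0 < n"
  shows "cnj \<omega> = 1 / \<omega>"
proof -
  have "norm \<omega> = 1" by (rule norm_root_of_unity[OF assms])
  then have "\<omega> * cnj \<omega> = 1" using complex_norm_square[of \<omega>] by simp
  then show ?thesis by (metis mult_zero_left nonzero_mult_div_cancel_left zero_neq_one)
qed

text \<open>Complex conjugation multiplies \<open>slope (\<omega>, \<zeta>, \<eta>)\<close> by \<open>\<omega> / \<zeta>\<close>, so the slope determines this
  quotient, hence by coprimality \<open>\<omega>\<close> and \<open>\<zeta>\<close>, and finally \<open>\<eta>\<close>.\<close>

lemma inj_on_slope:
  assumes "0 < n" "0 < m" "0 < k" "coprime n m"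
  shows "inj_on slope (root_triples n m k)"
proof (rule inj_onI)
  fix i i' assume i: "i \<in> root_triples n m k" "i' \<in> root_triples n m k" "slope i = slope i'"
  obtain \<omega> \<zeta> \<eta> \<omega>' \<zeta>' \<eta>' where ii: "i = (\<omega>, \<zeta>, \<eta>)" "i' = (\<omega>', \<zeta>', \<eta>')" by (cases i, cases i')
  have T: "(\<omega>, \<zeta>, \<eta>) \<in> root_triples n m k" and T': "(\<omega>', \<zeta>', \<eta>') \<in> root_triples n m k"
    and eq: "slope (\<omega>, \<zeta>, \<eta>) = slope (\<omega>', \<zeta>', \<eta>')"
    using i by (simp_all add: ii)
  have cnj: "cnj (slope (a, b, c)) = a / b * slope (a, b, c)" if "(a, b, c) \<in> root_triples n m k" for a b c
  proof -
    have "cnj (slope (a, b, c)) = slope (1 / a, 1 / b, 1 / c)"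
      using that assms cnj_root_of_unity[of a n] cnj_root_of_unity[of b m] cnj_root_of_unity[of c k]
      by (simp add: slope_def root_triples_def)
    then show ?thesis using slope_inverse[OF that] assms by simp
  qed
  have nz: "\<omega> \<noteq> 0" "\<zeta> \<noteq> 0" "\<omega>' \<noteq> 0" "\<zeta>' \<noteq> 0"
    using T T' assms by (auto simp: root_triples_def zero_power)
  have "\<omega> / \<zeta> = \<omega>' / \<zeta>'"
    using cnj[OF T] cnj[OF T'] slope_eq(2)[OF T'] unfolding eq by (metis mult_cancel_right)
  then have q: "\<omega> / \<omega>' = \<zeta> / \<zeta>'" using nz by (simp add: field_simps)
  have "(\<omega> / \<omega>') ^ n = 1" "(\<zeta> / \<zeta>') ^ m = 1"
    using T T' by (auto simp: root_triples_def power_divide)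
  then have "\<omega> / \<omega>' = 1" using coprime_roots_of_unity[OF assms(4), of "\<omega> / \<omega>'"] assms(1) q by simp
  then have 1: "\<omega> = \<omega>'" "\<zeta> = \<zeta>'" using q nz by auto
  have d: "\<omega> \<noteq> \<zeta>" "\<eta> \<noteq> \<omega>" "\<eta>' \<noteq> \<omega>" using T T' 1 by (auto simp: root_triples_def)
  have "(\<zeta> - \<eta>) * (\<eta>' - \<omega>) = (\<zeta> - \<eta>') * (\<eta> - \<omega>)"
    using eq d unfolding slope_def 1[symmetric] by (simp add: divide_simps)
  then have "(\<eta> - \<eta>') * (\<omega> - \<zeta>) = 0" by (simp add: algebra_simps)
  then show "i = i'" using 1 d by (simp add: ii)
qed

section \<open>Estimates for powers and roots depending on a parameter\<close>

lemma power_diff_bound: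
  fixes A :: real
  assumes "0 \<le> A"
  obtains C where "0 \<le> C"
    "\<And>a b :: complex. norm a \<le> A \<Longrightarrow> norm b \<le> A \<Longrightarrow> norm (a ^ N - b ^ N) \<le> C * norm (a - b)"
proof
  show "0 \<le> real N * A ^ (N - 1)" using assms by simp
  fix a b :: complex assume "norm a \<le> A" "norm b \<le> A"
  have "norm (a ^ N - b ^ N) \<le> real N * A ^ (N - 1) * norm (a - b)"
  proof (rule field_differentiable_bound[of "cball 0 A" "\<lambda>z. z ^ N" "\<lambda>z. of_nat N * z ^ (N - 1)"])
    fix z :: complex assume "z \<in> cball 0 A"
    then show "norm (of_nat N * z ^ (N - 1)) \<le> real N * A ^ (N - 1)"
      by (auto simp: norm_mult norm_power intro!: mult_left_mono power_mono)
  qed (use \<open>norm a \<le> A\<close> \<open>norm b \<le> A\<close> in \<open>auto intro!: derivative_eq_intros\<close>)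
  then show "norm (a ^ N - b ^ N) \<le> real N * A ^ (N - 1) * norm (a - b)" .
qed

text \<open>The mixed second difference vanishes for \<open>w = 0\<close> and for
  \<open>v = 0\<close>. In the applications \<open>w\<close> is the distance to a double point slope
  and \<open>v\<close> a displacement of size O(t); both small factors are needed there.\<close>

lemma power_second_difference_bound:
  fixes a b e :: complex
  obtains C where "0 \<le> C" "\<And>w v. norm w \<le> 1 \<Longrightarrow> norm v \<le> 1 \<Longrightarrow>
    norm ((a + b * w + e * v) ^ N - (a + b * w) ^ N - (a + e * v) ^ N + a ^ N) \<le> C * norm w * norm v"
proof -
  define A where "A = norm a + norm b + norm e"
  have A: "0 \<le> A" by (simp add: A_def)
  have bd: "norm (a + b * w + e * v) \<le> A" if "norm w \<le> 1" "norm v \<le> 1" for w v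
  proof -
    have "norm (b * w) \<le> norm b" "norm (e * v) \<le> norm e"
      using that by (simp_all add: norm_mult mult_left_le)
    then show ?thesis unfolding A_def by norm
  qed
  have "\<exists>C\<ge>0. \<forall>w v. norm w \<le> 1 \<longrightarrow> norm v \<le> 1 \<longrightarrow>
    norm ((a + b * w + e * v) ^ N - (a + b * w) ^ N - (a + e * v) ^ N + a ^ N) \<le> C * norm w * norm v"
  proof (induction N)
    case (Suc N)
    then obtain C where C: "0 \<le> C" "\<And>w v. norm w \<le> 1 \<Longrightarrow> norm v \<le> 1 \<Longrightarrow>
      norm ((a + b * w + e * v) ^ N - (a + b * w) ^ N - (a + e * v) ^ N + a ^ N) \<le> C * norm w * norm v"
      by auto
    obtain L where L: "0 \<le> L"
      "\<And>x y :: complex. norm x \<le> A \<Longrightarrow> norm y \<le> A \<Longrightarrow> norm (x ^ N - y ^ N) \<le> L * norm (x - y)"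
      using power_diff_bound[OF A] by metis
    show ?case
    proof (intro exI[of _ "A * C + 2 * L * norm b * norm e"] conjI allI impI)
      show "0 \<le> A * C + 2 * L * norm b * norm e" using A C L by simp
      fix w v :: complex assume wv: "norm w \<le> 1" "norm v \<le> 1"
      define S where "S = (a + b * w + e * v) ^ N - (a + b * w) ^ N - (a + e * v) ^ N + a ^ N"
      \<comment> \<open>Product rule for the mixed difference: the induction hypothesis controls
        \<open>S\<close>, and the other terms are first differences with a further small
        factor.\<close>
      have "(a + b * w + e * v) ^ Suc N - (a + b * w) ^ Suc N - (a + e * v) ^ Suc N + a ^ Suc N
        = (a + b * w + e * v) * S + e * v * ((a + b * w) ^ N - a ^ N) + b * w * ((a + e * v) ^ N - a ^ N)"
        by (simp add: S_def algebra_simps)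
      also have "norm \<dots> \<le> norm ((a + b * w + e * v) * S) + norm (e * v * ((a + b * w) ^ N - a ^ N))
          + norm (b * w * ((a + e * v) ^ N - a ^ N))"
        by norm
      also have "norm ((a + b * w + e * v) * S) \<le> A * (C * norm w * norm v)"
        unfolding norm_mult using bd[OF wv] C(2)[OF wv] A unfolding S_def by (intro mult_mono) auto
      also have "norm (e * v * ((a + b * w) ^ N - a ^ N)) \<le> norm e * norm v * (L * (norm b * norm w))"
        unfolding norm_mult using L(2)[of "a + b * w" a] bd[of w 0] bd[of 0 0] wv
        by (intro mult_left_mono) (auto simp: norm_mult)
      also have "norm (b * w * ((a + e * v) ^ N - a ^ N)) \<le> norm b * norm w * (L * (norm e * norm v))"
        unfolding norm_mult using L(2)[of "a + e * v" a] bd[of 0 v] bd[of 0 0] wv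
        by (intro mult_left_mono) (auto simp: norm_mult)
      finally show "norm ((a + b * w + e * v) ^ Suc N - (a + b * w) ^ Suc N - (a + e * v) ^ Suc N + a ^ Suc N)
          \<le> (A * C + 2 * L * norm b * norm e) * norm w * norm v"
        by (simp add: algebra_simps)
    qed
  qed (auto intro!: exI[of _ 0])
  then show ?thesis using that by blast
qed

text \<open>Subtracting the linear part leaves a function whose derivative near \<open>a\<close> is
  at most half of \<open>norm (deriv D a)\<close>; the other half survives as the lower
  bound.\<close>

lemma locally_bounded_below:
  fixes D :: "complex \<Rightarrow> complex"
  assumes hol: "D holomorphic_on UNIV" and "deriv D a \<noteq> 0"
  obtains r c where "0 < r" "0 < c"
    "\<And>w w'. w \<in> ball a r \<Longrightarrow> w' \<in> ball a r \<Longrightarrow> c * norm (w - w') \<le> norm (D w - D w')"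
proof -
  define c where "c = norm (deriv D a) / 2"
  have "0 < c" using assms by (simp add: c_def)
  have "isCont (deriv D) a"
    using holomorphic_on_imp_continuous_on[OF holomorphic_deriv[OF hol open_UNIV]]
    by (simp add: continuous_on_eq_continuous_at)
  then obtain r where r: "0 < r" "\<And>w. dist w a < r \<Longrightarrow> dist (deriv D w) (deriv D a) < c"
    using \<open>0 < c\<close> unfolding continuous_at_eps_delta by blast
  have "c * norm (w - w') \<le> norm (D w - D w')" if "w \<in> ball a r" "w' \<in> ball a r" for w w'
  proof -
    have "norm ((D w - deriv D a * w) - (D w' - deriv D a * w')) \<le> c * norm (w - w')"
    proof (rule field_differentiable_bound[of "ball a r" "\<lambda>w. D w - deriv D a * w" "\<lambda>w. deriv D w - deriv D a"])
      fix z assume z: "z \<in> ball a r"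
      have "(D has_field_derivative deriv D z) (at z within ball a r)"
        using hol holomorphic_derivI[OF hol open_UNIV UNIV_I] has_field_derivative_at_within by blast
      then show "((\<lambda>w. D w - deriv D a * w) has_field_derivative deriv D z - deriv D a) (at z within ball a r)"
        by (auto intro!: derivative_eq_intros)
      show "norm (deriv D z - deriv D a) \<le> c" using r(2)[of z] z by (simp add: dist_norm norm_minus_commute)
    qed (use that in auto)
    moreover have "norm (deriv D a * (w - w')) = 2 * (c * norm (w - w'))" by (simp add: norm_mult c_def)
    moreover have eq: "deriv D a * (w - w') + ((D w - deriv D a * w) - (D w' - deriv D a * w')) = D w - D w'"
      by (simp add: algebra_simps)
    ultimately show ?thesis
      using norm_diff_ineq[of "deriv D a * (w - w')" "(D w - deriv D a * w) - (D w' - deriv D a * w')"]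
      unfolding eq by linarith
  qed
  then show ?thesis using that \<open>0 < r\<close> \<open>0 < c\<close> by blast
qed

text \<open>The path is a local inverse of \<open>D\<close>, evaluated at
  \<open>t * \<kappa>\<close>. The lower bound makes this inverse Lipschitz, which yields both
  continuity and size O(t). The uniqueness clause later identifies paths that solve the same
  equation.\<close>

lemma local_root_path:
  fixes D :: "complex \<Rightarrow> complex" and \<kappa> :: complex
  assumes hol: "D holomorphic_on UNIV" and "deriv D 0 \<noteq> 0" and "D 0 = 0"
  obtains \<Delta> \<rho> K r where "0 < \<rho>" "0 < r" "continuous_on (ball 0 \<rho>) \<Delta>"
    "\<And>t. t \<in> ball 0 \<rho> \<Longrightarrow> norm (\<Delta> t) \<le> K * norm t" "\<And>t. t \<in> ball 0 \<rho> \<Longrightarrow> D (\<Delta> t) = t * \<kappa>"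
    "\<And>t w. t \<in> ball 0 \<rho> \<Longrightarrow> w \<in> ball 0 r \<Longrightarrow> D w = t * \<kappa> \<Longrightarrow> w = \<Delta> t"
proof -
  obtain r c where rc: "0 < r" "0 < c"
    "\<And>w w'. w \<in> ball 0 r \<Longrightarrow> w' \<in> ball 0 r \<Longrightarrow> c * norm (w - w') \<le> norm (D w - D w')"
    using locally_bounded_below[OF assms(1,2)] by metis
  have inj: "inj_on D (ball 0 r)"
  proof (rule inj_onI)
    fix w w' assume "w \<in> ball 0 r" "w' \<in> ball 0 r" "D w = D w'"
    then have "c * norm (w - w') \<le> 0" using rc(3)[of w w'] by simp
    then show "w = w'" using rc(2) by (simp add: mult_le_0_iff)
  qed
  have "open (D ` ball 0 r)"
    using open_mapping_thm3[of D "ball 0 r"] hol inj by (meson holomorphic_on_subset open_ball subset_UNIV)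
  moreover have "0 \<in> D ` ball 0 r" using assms(3) rc(1) by (intro image_eqI[of _ _ 0]) auto
  ultimately obtain s where s: "0 < s" "ball 0 s \<subseteq> D ` ball 0 r" by (meson open_contains_ball)
  \<comment> \<open>The summand 1 avoids a division by zero for \<open>\<kappa> = 0\<close>, which
    occurs in the application when \<open>\<zeta> = 1\<close>.\<close>
  define \<rho> where "\<rho> = s / (norm \<kappa> + 1)"
  have "0 < \<rho>" using s by (simp add: \<rho>_def add_nonneg_pos)
  have in_s: "t * \<kappa> \<in> ball 0 s" if "t \<in> ball 0 \<rho>" for t
  proof -
    have "norm t * (norm \<kappa> + 1) < s" using that by (simp add: \<rho>_def pos_less_divide_eq add_nonneg_pos)
    then show ?thesis by (simp add: norm_mult algebra_simps) (smt (verit) norm_ge_zero)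
  qed
  define \<Delta> where "\<Delta> = (\<lambda>t. the_inv_into (ball 0 r) D (t * \<kappa>))"
  have \<Delta>: "\<Delta> t \<in> ball 0 r" "D (\<Delta> t) = t * \<kappa>" if "t \<in> ball 0 \<rho>" for t
  proof -
    have "t * \<kappa> \<in> D ` ball 0 r" using in_s[OF that] s by blast
    then show "D (\<Delta> t) = t * \<kappa>" "\<Delta> t \<in> ball 0 r"
      unfolding \<Delta>_def using f_the_inv_into_f[OF inj] the_inv_into_into[OF inj, of _ "ball 0 r"] by simp_all
  qed
  have lip: "norm (\<Delta> t - \<Delta> t') \<le> norm \<kappa> / c * norm (t - t')" if "t \<in> ball 0 \<rho>" "t' \<in> ball 0 \<rho>" for t t'
  proof -
    have "c * norm (\<Delta> t - \<Delta> t') \<le> norm (t * \<kappa> - t' * \<kappa>)"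
      using rc(3)[OF \<Delta>(1)[OF that(1)] \<Delta>(1)[OF that(2)]] \<Delta>(2) that by simp
    also have "\<dots> = norm (t - t') * norm \<kappa>" by (simp add: norm_mult[symmetric] algebra_simps)
    finally show ?thesis using rc(2) by (simp add: field_simps)
  qed
  have "\<Delta> 0 = 0"
    using \<Delta>[of 0] inj assms(3) rc(1) \<open>0 < \<rho>\<close> by (simp add: inj_on_def)
  show ?thesis
  proof (rule that[OF \<open>0 < \<rho>\<close> rc(1), of \<Delta> "norm \<kappa> / c"])
    have "(norm \<kappa> / c)-lipschitz_on (ball 0 \<rho>) \<Delta>"
      using lip rc(2) by (intro lipschitz_onI) (auto simp: dist_norm)
    then show "continuous_on (ball 0 \<rho>) \<Delta>" by (rule lipschitz_on_continuous_on)
    show "norm (\<Delta> t) \<le> norm \<kappa> / c * norm t" if "t \<in> ball 0 \<rho>" for t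
      using lip[OF that, of 0] \<open>\<Delta> 0 = 0\<close> \<open>0 < \<rho>\<close> by simp
    show "w = \<Delta> t" if "t \<in> ball 0 \<rho>" "w \<in> ball 0 r" "D w = t * \<kappa>" for t w
      using \<Delta>[OF that(1)] that(2,3) inj by (metis inj_onD)
  qed (use \<Delta> in auto)
qed

text \<open>Growth at infinity gives the bound outside a large disc, compactness inside it. This
  makes the estimates away from the double points uniform in the slope.\<close>

lemma poly_bounded_below_off_roots:
  fixes q :: "complex poly"
  assumes "q \<noteq> 0" "open E" "\<And>c. poly q c = 0 \<Longrightarrow> c \<in> E"
  obtains c0 where "0 < c0" "\<And>c. c \<notin> E \<Longrightarrow> c0 \<le> norm (poly q c)"
proof -
  obtain R where R: "\<And>z. R \<le> norm z \<Longrightarrow> norm (lead_coeff q) / 2 \<le> norm (poly q z) \<and> 0 < norm (lead_coeff q) / 2"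
  proof (cases "degree q = 0")
    case True
    then obtain a where "q = [:a:]" by (metis degree_eq_zeroE)
    then show ?thesis using assms(1) that[of 0] by simp
  next
    case False
    then obtain a p where p: "q = pCons a p" "p \<noteq> 0" by (cases q) (auto split: if_splits)
    show ?thesis using poly_infinity[OF p(2), of "norm (lead_coeff q) / 2" a] assms(1) that p by force
  qed
  show ?thesis
  proof (cases "cball 0 R - E = {}")
    case True
    show ?thesis
    proof (rule that[of "norm (lead_coeff q) / 2"])
      show "0 < norm (lead_coeff q) / 2" using assms(1) by simp
      fix c assume "c \<notin> E"
      then have "R \<le> norm c" using True by (force simp: dist_norm)
      then show "norm (lead_coeff q) / 2 \<le> norm (poly q c)" using R by blast
    qed
  next
    case False
    have "compact (cball 0 R - E)" using assms(2) by (simp add: compact_diff)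
    then obtain z where z: "z \<in> cball 0 R - E" "\<And>w. w \<in> cball 0 R - E \<Longrightarrow> norm (poly q z) \<le> norm (poly q w)"
      using continuous_attains_inf[OF _ False, of "\<lambda>c. norm (poly q c)"] continuous_on_norm[OF continuous_on_poly[OF continuous_on_id]]
      by blast
    show ?thesis
    proof (rule that[of "min (norm (lead_coeff q) / 2) (norm (poly q z))"])
      show "0 < min (norm (lead_coeff q) / 2) (norm (poly q z))" using assms z by auto
      fix c assume c: "c \<notin> E"
      show "min (norm (lead_coeff q) / 2) (norm (poly q z)) \<le> norm (poly q c)"
      proof (cases "R \<le> norm c")
        case True
        then show ?thesis using R[of c] by linarith
      next
        case False
        then have "c \<in> cball 0 R - E" using c by simp
        then show ?thesis using z(2)[of c] by simp
      qed
    qed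
  qed
qed

text \<open>The derivative is a nonzero multiple of \<open>a ^ (N - 1) * b - 1\<close>, that is of
  \<open>b / a - 1\<close>. So \<open>a \<noteq> b\<close> makes the zero at 0 simple.\<close>

lemma deriv_twisted_difference_nonzero:
  fixes a b x :: complex
  assumes "a ^ N = 1" "a \<noteq> b" "x \<noteq> 0" "0 < N"
  shows "deriv (\<lambda>w. (a * x + b * w) ^ N - (x + w) ^ N) 0 \<noteq> 0"
proof -
  have "((\<lambda>w. (a * x + b * w) ^ N - (x + w) ^ N) has_field_derivative
      of_nat N * (a * x) ^ (N - 1) * b - of_nat N * x ^ (N - 1)) (at 0)"
    by (auto intro!: derivative_eq_intros)
  then have "deriv (\<lambda>w. (a * x + b * w) ^ N - (x + w) ^ N) 0 = of_nat N * (a * x) ^ (N - 1) * b - of_nat N * x ^ (N - 1)"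
    by (rule DERIV_imp_deriv)
  also have "\<dots> = of_nat N * x ^ (N - 1) * (a ^ (N - 1) * b - 1)"
    by (simp add: power_mult_distrib algebra_simps)
  also have "\<dots> \<noteq> 0"
  proof -
    have "a ^ (N - 1) * b \<noteq> 1"
    proof
      assume "a ^ (N - 1) * b = 1"
      moreover have "a ^ N = a * a ^ (N - 1)" using assms(4) by (simp add: power_eq_if)
      ultimately have "b = a" using assms(1) by (metis mult.assoc mult.right_neutral mult_1)
      then show False using assms(2) by simp
    qed
    then show ?thesis using assms(3,4) by simp
  qed
  finally show ?thesis .
qed

text \<open>For every \<open>\<delta>\<close> the points \<open>(c + \<delta>, 1)\<close> and
  \<open>(\<omega> * c + \<eta> * \<delta>, \<zeta>)\<close> agree in the last two coordinates of
  \<open>f t\<close>, because \<open>\<eta> * (c + 1) = \<omega> * c + \<zeta>\<close>. Agreement in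
  the first coordinate is the equation imposed on \<open>\<delta> c t\<close>. The clause on
  \<open>\<delta> (\<omega> / \<zeta> * c) t\<close> describes the same pair seen from its other
  point.\<close>

lemma displacement_paths:
  fixes n m k :: nat
  assumes pos: "0 < n" "0 < m" "0 < k" and "coprime n m"
  obtains \<rho> K :: real and \<delta> :: "complex \<Rightarrow> complex \<Rightarrow> complex" where "0 < \<rho>" "0 < K"
    "\<And>c. continuous_on (ball 0 \<rho>) (\<delta> c)"
    "\<And>c t. t \<in> ball 0 \<rho> \<Longrightarrow> norm (\<delta> c t) \<le> K * norm t"
    "\<And>\<omega> \<zeta> \<eta> c t. (\<omega>, \<zeta>, \<eta>) \<in> root_triples n m k \<Longrightarrow> c = slope (\<omega>, \<zeta>, \<eta>) \<Longrightarrow> t \<in> ball 0 \<rho> \<Longrightarrow>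
      (\<omega> * c + \<eta> * \<delta> c t) ^ n - (c + \<delta> c t) ^ n = t * (1 - \<zeta> ^ n)"
    "\<And>\<omega> \<zeta> \<eta> c t. (\<omega>, \<zeta>, \<eta>) \<in> root_triples n m k \<Longrightarrow> c = slope (\<omega>, \<zeta>, \<eta>) \<Longrightarrow> t \<in> ball 0 \<rho> \<Longrightarrow>
      \<delta> (\<omega> / \<zeta> * c) t = \<eta> / \<zeta> * \<delta> c t"
    "\<And>c t. c \<notin> slope ` root_triples n m k \<Longrightarrow> \<delta> c t = 0"
proof -
  define T where "T = root_triples n m k"
  have fT: "finite T" using finite_root_triples pos by (simp add: T_def)
  define D where "D = (\<lambda>(\<omega>, \<zeta>, \<eta>) w. (\<omega> * slope (\<omega>, \<zeta>, \<eta>) + \<eta> * w) ^ n - (slope (\<omega>, \<zeta>, \<eta>) + w) ^ n)"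
  define \<kappa> where "\<kappa> = (\<lambda>(\<omega>::complex, \<zeta>::complex, \<eta>::complex). 1 - \<zeta> ^ n)"
  define P where "P = (\<lambda>i \<Delta> (\<rho>::real) (K::real) (r::real). 0 < \<rho> \<and> 0 < r \<and> continuous_on (ball 0 \<rho>) \<Delta> \<and>
    (\<forall>t\<in>ball 0 \<rho>. norm (\<Delta> t) \<le> K * norm t \<and> D i (\<Delta> t) = t * \<kappa> i \<and>
      (\<forall>w\<in>ball 0 r. D i w = t * \<kappa> i \<longrightarrow> w = \<Delta> t)))"
  have "\<exists>\<Delta> \<rho> K r. P i \<Delta> \<rho> K r" if i: "i \<in> T" for i
  proof -
    obtain \<omega> \<zeta> \<eta> where ii: "i = (\<omega>, \<zeta>, \<eta>)" by (cases i)
    define c where "c = slope (\<omega>, \<zeta>, \<eta>)"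
    have D: "D i = (\<lambda>w. (\<omega> * c + \<eta> * w) ^ n - (c + w) ^ n)" by (simp add: D_def ii c_def)
    have on: "\<omega> ^ n = 1" "\<eta> \<noteq> \<omega>" using i by (auto simp: T_def ii root_triples_def)
    have "c \<noteq> 0" using slope_eq(2) i by (simp add: T_def ii c_def)
    have d0: "deriv (D i) 0 \<noteq> 0"
      unfolding D by (rule deriv_twisted_difference_nonzero) (use on \<open>c \<noteq> 0\<close> pos in auto)
    have hol: "D i holomorphic_on UNIV" unfolding D by (intro holomorphic_intros)
    have D0: "D i 0 = 0" by (simp add: D power_mult_distrib on)
    show ?thesis
      by (rule local_root_path[OF hol d0 D0, of "\<kappa> i"]) (unfold P_def, blast)
  qed
  then obtain \<Delta> \<rho>' K' r' where X: "\<And>i. i \<in> T \<Longrightarrow> P i (\<Delta> i) (\<rho>' i) (K' i) (r' i)"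
    by metis
  obtain \<rho>1 where \<rho>1: "0 < \<rho>1" "\<And>i. i \<in> T \<Longrightarrow> \<rho>1 \<le> \<rho>' i"
    using finite_uniform_lower_bound[OF fT, of "\<rho>'"] X unfolding P_def by blast
  obtain r where r: "0 < r" "\<And>i. i \<in> T \<Longrightarrow> r \<le> r' i"
    using finite_uniform_lower_bound[OF fT, of "r'"] X unfolding P_def by blast
  obtain K where K: "0 < K" "\<And>i. i \<in> T \<Longrightarrow> K' i \<le> K"
    using finite_uniform_upper_bound[OF fT, of "K'"] by blast
  \<comment> \<open>For \<open>norm t < r / K\<close> the paths stay in the discs on which the roots
    are unique.\<close>
  define \<rho> where "\<rho> = min \<rho>1 (r / K)"
  have "0 < \<rho>" using \<rho>1 r K by (simp add: \<rho>_def)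
  have sub: "ball 0 \<rho> \<subseteq> ball 0 (\<rho>' i)" if "i \<in> T" for i
    using \<rho>1(2)[OF that] by (auto simp: \<rho>_def)
  have \<Delta>: "continuous_on (ball 0 \<rho>) (\<Delta> i)" if "i \<in> T" for i
    using X[OF that] continuous_on_subset[OF _ sub[OF that]] unfolding P_def by blast
  have \<Delta>b: "norm (\<Delta> i t) \<le> K * norm t" "D i (\<Delta> i t) = t * \<kappa> i" if "i \<in> T" "t \<in> ball 0 \<rho>" for i t
  proof -
    have "t \<in> ball 0 (\<rho>' i)" using sub that by blast
    then have 1: "norm (\<Delta> i t) \<le> K' i * norm t" "D i (\<Delta> i t) = t * \<kappa> i"
      using X[OF that(1)] unfolding P_def by auto
    then show "norm (\<Delta> i t) \<le> K * norm t" "D i (\<Delta> i t) = t * \<kappa> i"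
      using mult_right_mono[OF K(2)[OF that(1)], of "norm t"] by auto
  qed
  have uniq: "w = \<Delta> i t" if "i \<in> T" "t \<in> ball 0 \<rho>" "norm w < r" "D i w = t * \<kappa> i" for i t w
  proof -
    have "t \<in> ball 0 (\<rho>' i)" using sub that by blast
    moreover have "w \<in> ball 0 (r' i)" using that(3) r(2)[OF that(1)] by simp
    ultimately show ?thesis using X[OF that(1)] that(4) unfolding P_def by blast
  qed
  \<comment> \<open>Injectivity of \<open>slope\<close> allows the displacement to be attached to
    the slope instead of the triple.\<close>
  define \<delta> where "\<delta> = (\<lambda>c. if c \<in> slope ` T then \<Delta> (the_inv_into T slope c) else (\<lambda>t. 0))"
  have inj: "inj_on slope T" unfolding T_def by (rule inj_on_slope[OF assms])
  have \<delta>: "\<delta> (slope i) = \<Delta> i" if "i \<in> T" for i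
    using that by (simp add: \<delta>_def the_inv_into_f_f[OF inj])
  show ?thesis
  proof (rule that[OF \<open>0 < \<rho>\<close> K(1), of \<delta>])
    show "continuous_on (ball 0 \<rho>) (\<delta> c)" for c
      using \<Delta> \<delta> by (cases "c \<in> slope ` T") (auto simp: \<delta>_def[of ] image_iff the_inv_into_f_f[OF inj])
    show "norm (\<delta> c t) \<le> K * norm t" if "t \<in> ball 0 \<rho>" for c t
    proof (cases "c \<in> slope ` T")
      case True
      then obtain i where "i \<in> T" "c = slope i" by blast
      then show ?thesis using \<Delta>b(1)[OF _ that] \<delta> by simp
    next
      case False
      then show ?thesis using K by (simp add: \<delta>_def)
    qed
    show "\<delta> c t = 0" if "c \<notin> slope ` root_triples n m k" for c t
      using that by (simp add: \<delta>_def T_def)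
    fix \<omega> \<zeta> \<eta> c t :: complex
    assume i: "(\<omega>, \<zeta>, \<eta>) \<in> root_triples n m k" and c: "c = slope (\<omega>, \<zeta>, \<eta>)" and t: "t \<in> ball 0 \<rho>"
    let ?i = "(\<omega>, \<zeta>, \<eta>)" and ?j = "(1 / \<omega>, 1 / \<zeta>, 1 / \<eta>)"
    have iT: "?i \<in> T" using i by (simp add: T_def)
    have jT: "?j \<in> T" using root_triples_inverse[OF i] by (simp add: T_def)
    show eq: "(\<omega> * c + \<eta> * \<delta> c t) ^ n - (c + \<delta> c t) ^ n = t * (1 - \<zeta> ^ n)"
      using \<Delta>b(2)[OF iT t] \<delta>[OF iT] by (simp add: D_def \<kappa>_def c)
    have roots: "\<omega> ^ n = 1" "\<zeta> ^ m = 1" "\<eta> ^ k = 1" using i by (auto simp: root_triples_def)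
    have nz: "\<omega> \<noteq> 0" "\<zeta> \<noteq> 0" "\<eta> \<noteq> 0" using roots pos by (auto simp: zero_power)
    have sj: "slope ?j = \<omega> / \<zeta> * c" using slope_inverse[OF i pos] c by simp
    have "\<eta> / \<zeta> * \<delta> c t = \<Delta> ?j t"
    proof (rule uniq[OF jT t])
      have "norm (\<eta> / \<zeta> * \<delta> c t) = norm (\<Delta> ?i t)"
        using norm_root_of_unity[OF roots(2) pos(2)] norm_root_of_unity[OF roots(3) pos(3)] \<delta>[OF iT] by (simp add: norm_mult norm_divide c)
      also have "\<dots> \<le> K * norm t" by (rule \<Delta>b(1)[OF iT t])
      also have "\<dots> < r" using t K by (simp add: \<rho>_def pos_less_divide_eq mult.commute)
      finally show "norm (\<eta> / \<zeta> * \<delta> c t) < r" .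
      \<comment> \<open>The transported path solves the equation of the inverse triple: division by
        \<open>\<zeta>\<close> exchanges the two powers.\<close>
      have "D ?j (\<eta> / \<zeta> * \<delta> c t) = ((c + \<delta> c t) / \<zeta>) ^ n - ((\<omega> * c + \<eta> * \<delta> c t) / \<zeta>) ^ n"
        unfolding D_def sj prod.case using nz by (simp add: add_divide_distrib)
      also have "\<dots> = - (t * (1 - \<zeta> ^ n)) / \<zeta> ^ n"
        unfolding eq[symmetric] power_divide using nz by (simp add: divide_simps)
      also have "\<dots> = t * \<kappa> ?j" using nz by (simp add: \<kappa>_def power_divide divide_simps right_diff_distrib)
      finally show "D ?j (\<eta> / \<zeta> * \<delta> c t) = t * \<kappa> ?j" .
    qed
    then show "\<delta> (\<omega> / \<zeta> * c) t = \<eta> / \<zeta> * \<delta> c t" using \<delta>[OF jT] sj by simp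
  qed
qed

text \<open>The cut-off \<open>\<beta>\<close> is 1 below \<open>e\<close> and 0 from
  \<open>2 * e\<close> on; separation by \<open>3 * e\<close> keeps \<open>ball a e\<close> outside
  the supports of the other bumps. Hence \<open>\<tau>\<close> is constant in \<open>c\<close> near
  each \<open>a\<close>, not merely close to \<open>\<delta> a t\<close>.\<close>

lemma bump_interpolation:
  fixes \<delta> :: "complex \<Rightarrow> complex \<Rightarrow> complex" and A :: "complex set"
  assumes "finite A" "0 < e" "0 \<le> K"
    and cont: "\<And>a. a \<in> A \<Longrightarrow> continuous_on (ball 0 \<rho>) (\<delta> a)"
    and bound: "\<And>a t. a \<in> A \<Longrightarrow> t \<in> ball 0 \<rho> \<Longrightarrow> norm (\<delta> a t) \<le> K * norm t"
    and sep: "\<And>a b. a \<in> A \<Longrightarrow> b \<in> A \<Longrightarrow> a \<noteq> b \<Longrightarrow> 3 * e \<le> norm (a - b)"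
  obtains \<tau> :: "complex \<Rightarrow> complex \<Rightarrow> complex" and L R :: real where "0 \<le> L"
    "continuous_on (UNIV \<times> ball 0 \<rho>) (\<lambda>p. \<tau> (snd p) (fst p))"
    "\<And>t c. t \<in> ball 0 \<rho> \<Longrightarrow> norm (\<tau> t c) \<le> L * norm t"
    "\<And>t c c'. t \<in> ball 0 \<rho> \<Longrightarrow> norm (\<tau> t c - \<tau> t c') \<le> L * norm t * norm (c - c')"
    "\<And>t a c. a \<in> A \<Longrightarrow> c \<in> ball a e \<Longrightarrow> \<tau> t c = \<delta> a t"
    "\<And>t c. R \<le> norm c \<Longrightarrow> \<tau> t c = 0"
proof -
  define \<beta> where "\<beta> = (\<lambda>x::real. max 0 (min 1 (2 - x / e)))"
  have \<beta>_lip: "\<bar>\<beta> x - \<beta> y\<bar> \<le> \<bar>x - y\<bar> / e" for x y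
  proof -
    have "\<bar>\<beta> x - \<beta> y\<bar> \<le> \<bar>x / e - y / e\<bar>" unfolding \<beta>_def by linarith
    then show ?thesis using \<open>0 < e\<close> by (simp add: diff_divide_distrib[symmetric])
  qed
  have \<beta>_bd: "\<bar>\<beta> x\<bar> \<le> 1" for x unfolding \<beta>_def by linarith
  have \<beta>_1: "\<beta> x = 1" if "x < e" for x using that \<open>0 < e\<close> by (auto simp: \<beta>_def divide_simps max_def min_def)
  have \<beta>_0: "\<beta> x = 0" if "2 * e \<le> x" for x using that \<open>0 < e\<close> by (auto simp: \<beta>_def divide_simps max_def min_def)
  define \<tau> where "\<tau> = (\<lambda>t c. \<Sum>a\<in>A. \<delta> a t * of_real (\<beta> (norm (c - a))))"
  \<comment> \<open>One constant for both bounds: a summand has size at most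
    \<open>K * norm t\<close> and Lipschitz constant at most \<open>K * norm t / e\<close>.\<close>
  define L where "L = card A * (K * (1 + 1 / e))"
  obtain R0 where R0: "\<And>a. a \<in> A \<Longrightarrow> norm a \<le> R0"
    using finite_uniform_upper_bound[OF assms(1), of norm] by metis
  show ?thesis
  proof (rule that[of L \<tau> "R0 + 2 * e"])
    show "0 \<le> L" using assms by (simp add: L_def)
    have "continuous_on (UNIV \<times> ball 0 \<rho>) (\<lambda>p. \<delta> a (snd p))" if "a \<in> A" for a
      by (rule continuous_on_compose2[OF cont[OF that] continuous_on_snd[OF continuous_on_id]]) auto
    then show "continuous_on (UNIV \<times> ball 0 \<rho>) (\<lambda>p. \<tau> (snd p) (fst p))"
      unfolding \<tau>_def \<beta>_def using \<open>0 < e\<close> by (auto intro!: continuous_intros)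
    fix t c
    show "\<tau> t c = 0" if "R0 + 2 * e \<le> norm c"
    proof -
      have "\<beta> (norm (c - a)) = 0" if "a \<in> A" for a
        using R0[OF that] \<open>R0 + 2 * e \<le> norm c\<close> norm_triangle_ineq2[of c a] by (intro \<beta>_0) linarith
      then show ?thesis by (simp add: \<tau>_def)
    qed
    show "\<tau> t c = \<delta> a t" if "a \<in> A" "c \<in> ball a e" for a
    proof -
      have ca: "norm (c - a) < e" using that by (simp add: dist_norm norm_minus_commute)
      have "\<delta> b t * of_real (\<beta> (norm (c - b))) = 0" if "b \<in> A - {a}" for b
      proof -
        have "3 * e \<le> norm (a - b)" using sep that \<open>a \<in> A\<close> by blast
        also have "\<dots> \<le> norm (c - a) + norm (c - b)"
          using norm_triangle_ineq4[of "c - b" "c - a"] by simp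
        finally have "\<beta> (norm (c - b)) = 0" using ca by (intro \<beta>_0) linarith
        then show ?thesis by simp
      qed
      then have "\<tau> t c = \<delta> a t * of_real (\<beta> (norm (c - a)))"
        unfolding \<tau>_def by (subst sum.remove[OF assms(1) \<open>a \<in> A\<close>]) (simp add: sum.neutral)
      then show ?thesis using \<beta>_1[OF ca] by simp
    qed
    assume t: "t \<in> ball 0 \<rho>"
    have Kt: "0 \<le> K * norm t" using assms by simp
    have le: "K * norm t \<le> K * (1 + 1 / e) * norm t" "K * norm t * (1 / e) \<le> K * (1 + 1 / e) * norm t"
      using assms Kt by (simp_all add: algebra_simps)
    have "norm (\<tau> t c) \<le> (\<Sum>a\<in>A. K * (1 + 1 / e) * norm t)"
      unfolding \<tau>_def
    proof (rule sum_norm_le)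
      fix a assume a: "a \<in> A"
      have "norm (\<delta> a t * of_real (\<beta> (norm (c - a)))) \<le> K * norm t * 1"
        unfolding norm_mult norm_of_real by (intro mult_mono bound[OF a t] \<beta>_bd Kt abs_ge_zero)
      then show "norm (\<delta> a t * of_real (\<beta> (norm (c - a)))) \<le> K * (1 + 1 / e) * norm t" using le by simp
    qed
    then show "norm (\<tau> t c) \<le> L * norm t" by (simp add: L_def algebra_simps)
    fix c'
    have "\<tau> t c - \<tau> t c' = (\<Sum>a\<in>A. \<delta> a t * of_real (\<beta> (norm (c - a)) - \<beta> (norm (c' - a))))"
      by (simp add: \<tau>_def sum_subtractf[symmetric] algebra_simps)
    also have "norm \<dots> \<le> (\<Sum>a\<in>A. K * (1 + 1 / e) * norm t * norm (c - c'))"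
    proof (rule sum_norm_le)
      fix a assume a: "a \<in> A"
      have "\<bar>norm (c - a) - norm (c' - a)\<bar> \<le> norm (c - c')"
        using norm_triangle_ineq3[of "c - a" "c' - a"] by simp
      then have "\<bar>\<beta> (norm (c - a)) - \<beta> (norm (c' - a))\<bar> \<le> norm (c - c') / e"
        using \<beta>_lip[of "norm (c - a)" "norm (c' - a)"] \<open>0 < e\<close> by (smt (verit) divide_right_mono)
      then have "norm (\<delta> a t * of_real (\<beta> (norm (c - a)) - \<beta> (norm (c' - a)))) \<le> K * norm t * (norm (c - c') / e)"
        unfolding norm_mult norm_of_real by (intro mult_mono bound[OF a t] Kt abs_ge_zero)
      also have "\<dots> = K * norm t * (1 / e) * norm (c - c')" by simp
      also have "\<dots> \<le> K * (1 + 1 / e) * norm t * norm (c - c')"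
        by (intro mult_right_mono le) simp
      finally show "norm (\<delta> a t * of_real (\<beta> (norm (c - a)) - \<beta> (norm (c' - a)))) \<le> K * (1 + 1 / e) * norm t * norm (c - c')" .
    qed
    finally show "norm (\<tau> t c - \<tau> t c') \<le> L * norm t * norm (c - c')" by (simp add: L_def algebra_simps)
  qed
qed


section \<open>Topological triviality\<close>

lemma mem_ball_norm_diff:
  "c \<in> ball (s::complex) e \<longleftrightarrow> norm (c - s) < e"
  by (simp add: dist_norm norm_minus_commute)

text \<open>The slopes 0 and -1 belong to the lines \<open>x = 0\<close> and
  \<open>x + y = 0\<close>, where points of a fibre merge; the shift is trivial near them.
  \<open>L * \<rho> \<le> 1 / 2\<close> makes \<open>c \<mapsto> c + \<tau> t c\<close> injective,
  \<open>L * \<rho> \<le> e / 2\<close> keeps shifted slopes in controlled discs, and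
  \<open>low_n\<close>, \<open>low_k\<close> express that the zeros at the double point slopes are
  simple.\<close>

locale slope_displacement =
  fixes n m k :: nat and \<delta> \<tau> :: "complex \<Rightarrow> complex \<Rightarrow> complex" and \<rho> L R e lb :: real
  assumes pos: "0 < n" "0 < m" "0 < k"
    and coprime: "coprime n m" "coprime n k" "coprime m k"
    and param_bounds: "0 < \<rho>" "0 \<le> L" "0 < e" "0 < lb" "L * \<rho> \<le> 1 / 2" "L * \<rho> \<le> e / 2" "e \<le> 1"
    and \<tau>_cont: "continuous_on (UNIV \<times> ball 0 \<rho>) (\<lambda>p. \<tau> (snd p) (fst p))"
    and \<tau>_bound: "\<And>t c. t \<in> ball 0 \<rho> \<Longrightarrow> norm (\<tau> t c) \<le> L * norm t"
    and \<tau>_lip: "\<And>t c c'. t \<in> ball 0 \<rho> \<Longrightarrow> norm (\<tau> t c - \<tau> t c') \<le> L * norm t * norm (c - c')"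
    and \<tau>_near: "\<And>t i c. i \<in> root_triples n m k \<Longrightarrow> c \<in> ball (slope i) e \<Longrightarrow> \<tau> t c = \<delta> (slope i) t"
    and \<tau>_0: "\<And>t c. c \<in> ball 0 e \<Longrightarrow> \<tau> t c = 0"
    and \<tau>_m1: "\<And>t c. c \<in> ball (- 1) e \<Longrightarrow> \<tau> t c = 0"
    and \<tau>_far: "\<And>t c. R \<le> norm c \<Longrightarrow> \<tau> t c = 0"
    and \<delta>_bound: "\<And>t c. t \<in> ball 0 \<rho> \<Longrightarrow> norm (\<delta> c t) \<le> L * norm t"
    and \<delta>_root: "\<And>\<omega> \<zeta> \<eta> c t. (\<omega>, \<zeta>, \<eta>) \<in> root_triples n m k \<Longrightarrow> c = slope (\<omega>, \<zeta>, \<eta>) \<Longrightarrow> t \<in> ball 0 \<rho> \<Longrightarrow>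
      (\<omega> * c + \<eta> * \<delta> c t) ^ n - (c + \<delta> c t) ^ n = t * (1 - \<zeta> ^ n)"
    and \<delta>_inverse: "\<And>\<omega> \<zeta> \<eta> c t. (\<omega>, \<zeta>, \<eta>) \<in> root_triples n m k \<Longrightarrow> c = slope (\<omega>, \<zeta>, \<eta>) \<Longrightarrow> t \<in> ball 0 \<rho> \<Longrightarrow>
      \<delta> (\<omega> / \<zeta> * c) t = \<eta> / \<zeta> * \<delta> c t"
    and low_n: "\<And>\<omega> \<zeta> \<eta> c w. (\<omega>, \<zeta>, \<eta>) \<in> root_triples n m k \<Longrightarrow> c = slope (\<omega>, \<zeta>, \<eta>) \<Longrightarrow> norm w < e \<Longrightarrow>
      lb * norm w \<le> norm ((\<omega> * c + \<eta> * w) ^ n - (c + w) ^ n)"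
    and low_k: "\<And>\<omega> \<zeta> \<eta> c w. (\<omega>, \<zeta>, \<eta>) \<in> root_triples n m k \<Longrightarrow> c = slope (\<omega>, \<zeta>, \<eta>) \<Longrightarrow> norm w < e \<Longrightarrow>
      lb * norm w \<le> norm ((\<eta> * (c + 1) + \<omega> * w) ^ k - (c + 1 + w) ^ k)"
begin

lemma Lt_le:
  assumes "t \<in> ball 0 \<rho>"
  shows "L * norm t \<le> 1 / 2" "L * norm t \<le> e / 2"
proof -
  have "L * norm t \<le> L * \<rho>" using assms param_bounds by (intro mult_left_mono) auto
  then show "L * norm t \<le> 1 / 2" "L * norm t \<le> e / 2" using param_bounds by linarith+
qed

lemma \<tau>_zero: "\<tau> 0 c = 0"
  using \<tau>_bound[of 0 c] param_bounds(1) by simp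

lemma shift_inj:
  assumes "t \<in> ball 0 \<rho>" "c + \<tau> t c = c' + \<tau> t c'"
  shows "c = c'"
proof -
  have "c - c' - (\<tau> t c' - \<tau> t c) = (c + \<tau> t c) - (c' + \<tau> t c')" by simp
  then have "c - c' = \<tau> t c' - \<tau> t c" unfolding assms(2) by simp
  then have "norm (c - c') = norm (\<tau> t c' - \<tau> t c)" by simp
  also have "\<dots> \<le> L * norm t * norm (c' - c)" by (rule \<tau>_lip[OF assms(1)])
  also have "\<dots> \<le> 1 / 2 * norm (c' - c)" by (intro mult_right_mono Lt_le assms) simp
  finally show ?thesis by (simp add: norm_minus_commute)
qed

text \<open>Powers are not Lipschitz on the whole plane, but the shift vanishes for
  \<open>R \<le> norm c\<close>, so a bound on a disc suffices.\<close>

lemma shifted_power_bound: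
  obtains C where "0 \<le> C"
    "\<And>t c. t \<in> ball 0 \<rho> \<Longrightarrow> norm ((c + \<tau> t c + \<alpha>) ^ N - (c + \<alpha>) ^ N) \<le> C * norm t"
proof -
  define A where "A = \<bar>R\<bar> + norm \<alpha> + 1"
  have "0 \<le> A" by (simp add: A_def)
  then obtain C where C: "0 \<le> C"
    "\<And>a b :: complex. norm a \<le> A \<Longrightarrow> norm b \<le> A \<Longrightarrow> norm (a ^ N - b ^ N) \<le> C * norm (a - b)"
    using power_diff_bound[of A N] by blast
  show ?thesis
  proof (rule that[of "C * L"])
    show "0 \<le> C * L" using C param_bounds by simp
    fix t c :: complex assume t: "t \<in> ball 0 \<rho>"
    show "norm ((c + \<tau> t c + \<alpha>) ^ N - (c + \<alpha>) ^ N) \<le> C * L * norm t"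
    proof (cases "R \<le> norm c")
      case True
      then show ?thesis using \<tau>_far[OF True] C param_bounds by simp
    next
      case False
      have "norm (\<tau> t c) \<le> 1 / 2" using \<tau>_bound[OF t, of c] Lt_le(1)[OF t] by linarith
      then have "norm (c + \<tau> t c + \<alpha>) \<le> A" "norm (c + \<alpha>) \<le> A"
        using False norm_triangle_ineq[of c \<alpha>] norm_triangle_ineq[of "c + \<alpha>" "\<tau> t c"]
        unfolding A_def by (auto simp: algebra_simps)
      then have "norm ((c + \<tau> t c + \<alpha>) ^ N - (c + \<alpha>) ^ N) \<le> C * norm (\<tau> t c)"
        using C(2)[of "c + \<tau> t c + \<alpha>" "c + \<alpha>"] by simp
      also have "\<dots> \<le> C * (L * norm t)" by (intro mult_left_mono \<tau>_bound t C)
      finally show ?thesis by (simp add: mult.assoc)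
    qed
  qed
qed

text \<open>The partner slope \<open>\<omega> / \<zeta> * s\<close> is again a double point slope,
  so \<open>\<tau>\<close> is constant near it as well. The factor \<open>\<theta>\<close> covers
  two pairings: it is \<open>\<omega> / \<zeta>\<close> over the fibres of
  \<open>(x ^ n, y ^ m)\<close> and \<open>\<eta> / \<zeta>\<close> over those of the last two
  coordinates.\<close>

lemma inverse_slope_near:
  assumes i: "(\<omega>, \<zeta>, \<eta>) \<in> root_triples n m k" and s: "s = slope (\<omega>, \<zeta>, \<eta>)"
    and t: "t \<in> ball 0 \<rho>" and w: "norm w < e" "norm \<theta> = 1"
  shows "\<tau> t (\<omega> / \<zeta> * s + \<theta> * w) = \<eta> / \<zeta> * \<delta> s t" "\<tau> t (s + w) = \<delta> s t"
proof -
  have sj: "slope (1 / \<omega>, 1 / \<zeta>, 1 / \<eta>) = \<omega> / \<zeta> * s" using slope_inverse[OF i pos] s by simp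
  have "\<tau> t (\<omega> / \<zeta> * s + \<theta> * w) = \<delta> (\<omega> / \<zeta> * s) t"
    using \<tau>_near[OF root_triples_inverse[OF i], of "\<omega> / \<zeta> * s + \<theta> * w" t] w
    unfolding sj mem_ball_norm_diff by (simp add: norm_mult)
  then show "\<tau> t (\<omega> / \<zeta> * s + \<theta> * w) = \<eta> / \<zeta> * \<delta> s t" using \<delta>_inverse[OF i s t] by simp
  show "\<tau> t (s + w) = \<delta> s t" using \<tau>_near[OF i, of "s + w" t] w unfolding mem_ball_norm_diff s by simp
qed

text \<open>The change \<open>N t c\<close> is compared with \<open>poly q c\<close>. Near a double
  point slope both vanish at the slope, near 0 there is no shift, and elsewhere
  \<open>poly q c\<close> is bounded away from 0 while \<open>N t c\<close> is O(t).\<close>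

lemma third_coordinate_estimate:
  assumes roots: "\<omega> ^ n = 1" "\<zeta> ^ m = 1"
  obtains K where "0 \<le> K"
    "\<And>t c c'. t \<in> ball 0 \<rho> \<Longrightarrow> c' = \<omega> / \<zeta> * c \<Longrightarrow>
      norm (((\<zeta> * (c' + \<tau> t c' + 1)) ^ k - (c + \<tau> t c + 1) ^ k) - ((\<zeta> * (c' + 1)) ^ k - (c + 1) ^ k))
        \<le> K * norm t * norm ((\<zeta> * (c' + 1)) ^ k - (c + 1) ^ k)"
proof (cases "\<omega> = \<zeta>")
  case True
  \<comment> \<open>By coprimality a common root of unity is 1, so the two points coincide.\<close>
  then have "\<omega> = 1" "\<zeta> = 1" using coprime_roots_of_unity[OF coprime(1), of \<zeta>] roots pos by auto
  then show ?thesis using that[of 0] by simp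
next
  case False
  have n1: "norm \<omega> = 1" "norm \<zeta> = 1" using norm_root_of_unity roots pos by blast+
  then have "\<zeta> \<noteq> 0" by auto
  define q where "q = [:\<zeta>, \<omega>:] ^ k - [:1, 1:] ^ k"
  have q: "poly q c = (\<zeta> * (\<omega> / \<zeta> * c + 1)) ^ k - (c + 1) ^ k" for c
    using \<open>\<zeta> \<noteq> 0\<close> by (simp add: q_def algebra_simps)
  have q': "poly q c = (\<omega> * c + \<zeta>) ^ k - (c + 1) ^ k" for c by (simp add: q_def algebra_simps)
  define N where "N = (\<lambda>t c. ((\<zeta> * (\<omega> / \<zeta> * c + \<tau> t (\<omega> / \<zeta> * c) + 1)) ^ k - (c + \<tau> t c + 1) ^ k) - poly q c)"
  define I where "I = {\<eta>. (\<omega>, \<zeta>, \<eta>) \<in> root_triples n m k}"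
  have fI: "finite I"
  proof (rule finite_subset)
    show "I \<subseteq> {\<eta>. \<eta> ^ k = 1}" by (auto simp: I_def root_triples_def)
    show "finite {\<eta>::complex. \<eta> ^ k = 1}" using pos by (intro finite_roots_unity) simp
  qed
  define E where "E = (\<Union>\<eta>\<in>I. ball (slope (\<omega>, \<zeta>, \<eta>)) e) \<union> ball 0 e"
  have roots_q: "c = 0 \<or> (\<exists>\<eta>\<in>I. c = slope (\<omega>, \<zeta>, \<eta>))" if c: "poly q c = 0" for c
  proof -
    have "(c + 1) ^ k = (\<omega> * c + \<zeta>) ^ k" using c by (simp add: q')
    then obtain \<eta> where \<eta>: "\<eta> ^ k = 1" "\<omega> * c + \<zeta> = \<eta> * (c + 1)"
      using eq_power_imp_root_of_unity pos(3) by blast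
    then have eq: "(\<eta> - \<omega>) * c = \<zeta> - \<eta>" by (simp add: algebra_simps)
    \<comment> \<open>For \<open>\<eta> = \<zeta>\<close> the root is 0, whereas
      \<open>\<eta> = \<omega>\<close> would force \<open>\<zeta> = \<omega>\<close>.\<close>
    show ?thesis
    proof (cases "\<eta> = \<omega> \<or> \<eta> = \<zeta>")
      case True
      then show ?thesis using eq False by auto
    next
      case F: False
      then have "\<eta> \<in> I" using roots \<eta> False by (auto simp: I_def root_triples_def)
      moreover have "c = slope (\<omega>, \<zeta>, \<eta>)" using eq F by (simp add: slope_def field_simps)
      ultimately show ?thesis by blast
    qed
  qed
  have "q \<noteq> 0"
  proof
    assume "q = 0"
    then have "UNIV \<subseteq> insert 0 ((\<lambda>\<eta>. slope (\<omega>, \<zeta>, \<eta>)) ` I)" using roots_q by auto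
    then have "finite (UNIV :: complex set)" using fI by (meson finite_imageI finite_insert finite_subset)
    then show False by (simp add: infinite_UNIV_char_0)
  qed
  moreover have "open E" by (auto simp: E_def)
  moreover have "c \<in> E" if "poly q c = 0" for c
    using roots_q[OF that] centre_in_ball[of _ e] param_bounds(3) unfolding E_def by blast
  ultimately obtain c0 where c0: "0 < c0" "\<And>c. c \<notin> E \<Longrightarrow> c0 \<le> norm (poly q c)"
    using poly_bounded_below_off_roots by blast
  obtain C where C: "0 \<le> C" "\<And>t c. t \<in> ball 0 \<rho> \<Longrightarrow> norm ((c + \<tau> t c + 1) ^ k - (c + 1) ^ k) \<le> C * norm t"
    using shifted_power_bound by blast
  have "\<exists>K\<ge>0. \<forall>t\<in>ball 0 \<rho>. \<forall>c\<in>ball (slope (\<omega>, \<zeta>, \<eta>)) e. norm (N t c) \<le> K * norm t * norm (poly q c)"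
    if \<eta>: "\<eta> \<in> I" for \<eta>
  proof -
    have i: "(\<omega>, \<zeta>, \<eta>) \<in> root_triples n m k" using \<eta> by (simp add: I_def)
    define s where "s = slope (\<omega>, \<zeta>, \<eta>)"
    have se: "\<eta> * (s + 1) = \<omega> * s + \<zeta>" using slope_eq(1)[OF i] by (simp add: s_def)
    have \<eta>k: "\<eta> ^ k = 1" using i by (simp add: root_triples_def)
    obtain C1 where C1: "0 \<le> C1" "\<And>w v. norm w \<le> 1 \<Longrightarrow> norm v \<le> 1 \<Longrightarrow>
      norm ((\<eta> * (s + 1) + \<omega> * w + \<eta> * v) ^ k - (\<eta> * (s + 1) + \<omega> * w) ^ k - (\<eta> * (s + 1) + \<eta> * v) ^ k + (\<eta> * (s + 1)) ^ k) \<le> C1 * norm w * norm v"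
      using power_second_difference_bound by blast
    obtain C2 where C2: "0 \<le> C2" "\<And>w v. norm w \<le> 1 \<Longrightarrow> norm v \<le> 1 \<Longrightarrow>
      norm ((s + 1 + 1 * w + 1 * v) ^ k - (s + 1 + 1 * w) ^ k - (s + 1 + 1 * v) ^ k + (s + 1) ^ k) \<le> C2 * norm w * norm v"
      using power_second_difference_bound by blast
    have "norm (N t c) \<le> (C1 + C2) * L / lb * norm t * norm (poly q c)"
      if t: "t \<in> ball 0 \<rho>" and c: "c \<in> ball (slope (\<omega>, \<zeta>, \<eta>)) e" for t c
    proof -
      define w where "w = c - s"
      define d where "d = \<delta> s t"
      have cw: "c = s + w" by (simp add: w_def)
      have w: "norm w < e" "norm w \<le> 1" using c param_bounds unfolding w_def s_def mem_ball_norm_diff by linarith+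
      have d: "norm d \<le> L * norm t" "norm d \<le> 1"
        using \<delta>_bound[OF t, of s] Lt_le(1)[OF t] by (auto simp: d_def)
      have nt: "norm (\<omega> / \<zeta>) = 1" using n1 by (simp add: norm_divide)
      have c': "\<omega> / \<zeta> * c = \<omega> / \<zeta> * s + \<omega> / \<zeta> * w" by (simp add: cw algebra_simps add_divide_distrib)
      have tau: "\<tau> t (\<omega> / \<zeta> * c) = \<eta> / \<zeta> * d" "\<tau> t c = d"
        using inverse_slope_near[OF i s_def t w(1) nt] unfolding c' unfolding cw d_def .
      have "\<zeta> * (\<omega> / \<zeta> * c + \<tau> t (\<omega> / \<zeta> * c) + 1) = \<eta> * (s + 1) + \<omega> * w + \<eta> * d"
        unfolding tau(1) unfolding se cw using \<open>\<zeta> \<noteq> 0\<close> by (simp add: divide_simps) (simp add: algebra_simps)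
      moreover have pq: "poly q c = (\<eta> * (s + 1) + \<omega> * w) ^ k - (s + 1 + w) ^ k"
        unfolding q' se by (simp add: cw algebra_simps)
      \<comment> \<open>Since \<open>\<eta> ^ k = 1\<close>, the terms without \<open>w\<close>
        cancel in pairs. Inserting them completes \<open>N t c\<close> to a difference of two mixed
        second differences.\<close>
      moreover have "(\<eta> * (s + 1) + \<eta> * d) ^ k = (s + 1 + d) ^ k" "(\<eta> * (s + 1)) ^ k = (s + 1) ^ k"
        using \<eta>k by (simp_all add: distrib_left[symmetric] power_mult_distrib del: distrib_left)
      ultimately have "N t c =
          ((\<eta> * (s + 1) + \<omega> * w + \<eta> * d) ^ k - (\<eta> * (s + 1) + \<omega> * w) ^ k - (\<eta> * (s + 1) + \<eta> * d) ^ k + (\<eta> * (s + 1)) ^ k)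
          - ((s + 1 + 1 * w + 1 * d) ^ k - (s + 1 + 1 * w) ^ k - (s + 1 + 1 * d) ^ k + (s + 1) ^ k)"
        unfolding N_def tau(2) cw[symmetric] by (simp add: cw add_ac)
      then have "norm (N t c) \<le> C1 * norm w * norm d + C2 * norm w * norm d"
        using C1(2)[OF w(2) d(2)] C2(2)[OF w(2) d(2)] norm_triangle_ineq4 by (smt (verit, best))
      also have "\<dots> = (C1 + C2) * norm w * norm d" by (simp add: algebra_simps)
      also have "\<dots> \<le> (C1 + C2) * norm w * (L * norm t)" using d C1 C2 by (intro mult_left_mono) auto
      \<comment> \<open>Through \<open>low_k\<close> the distance \<open>norm w\<close> to a simple
        zero is turned into \<open>norm (poly q c)\<close>.\<close>
      also have "\<dots> = (C1 + C2) * L / lb * norm t * (lb * norm w)" using param_bounds by simp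
      also have "\<dots> \<le> (C1 + C2) * L / lb * norm t * norm (poly q c)"
        using low_k[OF i s_def w(1)] C1 C2 param_bounds unfolding pq
        by (intro mult_left_mono mult_nonneg_nonneg divide_nonneg_nonneg) auto
      finally show ?thesis .
    qed
    then show ?thesis using C1 C2 param_bounds by (intro exI[of _ "(C1 + C2) * L / lb"]) auto
  qed
  then obtain K where K: "\<And>\<eta> t c. \<eta> \<in> I \<Longrightarrow> t \<in> ball 0 \<rho> \<Longrightarrow> c \<in> ball (slope (\<omega>, \<zeta>, \<eta>)) e \<Longrightarrow>
      norm (N t c) \<le> K \<eta> * norm t * norm (poly q c)"
    by metis
  obtain K0 where K0: "0 < K0" "\<And>\<eta>. \<eta> \<in> I \<Longrightarrow> K \<eta> \<le> K0" using finite_uniform_upper_bound[OF fI] by blast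
  have main: "norm (N t c) \<le> (K0 + 2 * C / c0) * norm t * norm (poly q c)" if t: "t \<in> ball 0 \<rho>" for t c
  proof -
    have nn: "0 \<le> norm t * norm (poly q c)" by simp
    have split: "(K0 + 2 * C / c0) * norm t * norm (poly q c)
        = K0 * norm t * norm (poly q c) + 2 * C / c0 * norm t * norm (poly q c)" by (simp add: algebra_simps)
    have nn2: "0 \<le> K0 * norm t * norm (poly q c)" "0 \<le> 2 * C / c0 * norm t * norm (poly q c)" using K0 C c0 by auto
    consider (near) \<eta> where "\<eta> \<in> I" "c \<in> ball (slope (\<omega>, \<zeta>, \<eta>)) e" | (zero) "c \<in> ball 0 e" | (off) "c \<notin> E"
      unfolding E_def by blast
    then show ?thesis
    proof cases
      case near
      have "norm (N t c) \<le> K \<eta> * (norm t * norm (poly q c))" using K[OF near(1) t near(2)] by (simp add: mult.assoc)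
      also have "\<dots> \<le> K0 * (norm t * norm (poly q c))" by (intro mult_right_mono K0 near nn)
      finally show ?thesis using split nn2 by (simp add: mult.assoc)
    next
      case zero
      then have "\<omega> / \<zeta> * c \<in> ball 0 e" using n1 by (simp add: norm_mult norm_divide)
      then have "N t c = 0" using \<tau>_0 zero by (simp add: N_def q)
      then show ?thesis using split nn2 by simp
    next
      case off
      define c' where "c' = \<omega> / \<zeta> * c"
      have "N t c = \<zeta> ^ k * ((c' + \<tau> t c' + 1) ^ k - (c' + 1) ^ k) - ((c + \<tau> t c + 1) ^ k - (c + 1) ^ k)"
        unfolding N_def q c'_def[symmetric] power_mult_distrib by (simp add: algebra_simps)
      also have "norm \<dots> \<le> norm (\<zeta> ^ k * ((c' + \<tau> t c' + 1) ^ k - (c' + 1) ^ k)) + norm ((c + \<tau> t c + 1) ^ k - (c + 1) ^ k)"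
        by (rule norm_triangle_ineq4)
      also have "\<dots> \<le> 2 * C * norm t" using C(2)[OF t, of c] C(2)[OF t, of c'] n1 by (simp add: norm_mult norm_power)
      also have "\<dots> = 2 * C / c0 * norm t * c0" using c0 by simp
      also have "\<dots> \<le> 2 * C / c0 * norm t * norm (poly q c)"
        using c0 C off by (intro mult_left_mono) auto
      finally show ?thesis using split nn2 by simp
    qed
  qed
  show ?thesis
  proof (rule that[of "K0 + 2 * C / c0"])
    show "0 \<le> K0 + 2 * C / c0" using K0 C c0 by simp
    fix t c c' :: complex assume t: "t \<in> ball 0 \<rho>" and c': "c' = \<omega> / \<zeta> * c"
    show "norm (((\<zeta> * (c' + \<tau> t c' + 1)) ^ k - (c + \<tau> t c + 1) ^ k) - ((\<zeta> * (c' + 1)) ^ k - (c + 1) ^ k))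
        \<le> (K0 + 2 * C / c0) * norm t * norm ((\<zeta> * (c' + 1)) ^ k - (c + 1) ^ k)"
      using main[OF t, of c] unfolding N_def q c' .
  qed
qed

text \<open>The second target map acts after the first, so fibre points are paired by their shifted
  slopes, and \<open>q\<close> has to be tested at \<open>c + \<tau> t c\<close>. Near a double
  point slope the contribution \<open>t * (1 - \<zeta> ^ n)\<close> of the deformation is absorbed
  by \<open>\<delta>_root\<close>.\<close>

lemma first_coordinate_estimate:
  assumes roots: "\<zeta> ^ m = 1" "\<eta> ^ k = 1"
  obtains K \<rho>' where "0 \<le> K" "0 < \<rho>'" "\<rho>' \<le> \<rho>"
    "\<And>t c c'. t \<in> ball 0 \<rho>' \<Longrightarrow> \<zeta> * (c' + \<tau> t c' + 1) = \<eta> * (c + \<tau> t c + 1) \<Longrightarrow>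
      norm ((((\<zeta> * (c' + \<tau> t c')) ^ n + t * \<zeta> ^ n) - ((c + \<tau> t c) ^ n + t)) - ((\<zeta> * c') ^ n - c ^ n))
        \<le> K * norm t * norm ((\<zeta> * c') ^ n - c ^ n)"
proof (cases "\<zeta> = \<eta>")
  case True
  then have "\<zeta> = 1" "\<eta> = 1" using coprime_roots_of_unity[OF coprime(3), of \<zeta>] roots pos by auto
  have "c' = c" if "t \<in> ball 0 \<rho>" "\<zeta> * (c' + \<tau> t c' + 1) = \<eta> * (c + \<tau> t c + 1)" for t c c'
    using shift_inj[OF that(1), of c' c] that(2) unfolding \<open>\<zeta> = 1\<close> \<open>\<eta> = 1\<close> by simp
  note cc = this
  show ?thesis
  proof (rule that[of 0 \<rho>])
    fix t c c' :: complex assume t: "t \<in> ball 0 \<rho>" "\<zeta> * (c' + \<tau> t c' + 1) = \<eta> * (c + \<tau> t c + 1)"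
    show "norm ((((\<zeta> * (c' + \<tau> t c')) ^ n + t * \<zeta> ^ n) - ((c + \<tau> t c) ^ n + t)) - ((\<zeta> * c') ^ n - c ^ n))
        \<le> 0 * norm t * norm ((\<zeta> * c') ^ n - c ^ n)"
      unfolding cc[OF t] \<open>\<zeta> = 1\<close> by simp
  qed (use param_bounds in simp_all)
next
  case False
  have n1: "norm \<zeta> = 1" "norm \<eta> = 1" using norm_root_of_unity roots pos by blast+
  then have "\<zeta> \<noteq> 0" by auto
  define q where "q = [:\<eta> - \<zeta>, \<eta>:] ^ n - [:0, 1:] ^ n"
  have q: "poly q d = (\<eta> * (d + 1) - \<zeta>) ^ n - d ^ n" for d by (simp add: q_def algebra_simps)
  define Nn where "Nn = (\<lambda>t c c'. (((\<zeta> * (c' + \<tau> t c')) ^ n + t * \<zeta> ^ n) - ((c + \<tau> t c) ^ n + t)) - ((\<zeta> * c') ^ n - c ^ n))"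
  define I where "I = {\<omega>. (\<omega>, \<zeta>, \<eta>) \<in> root_triples n m k}"
  have fI: "finite I"
  proof (rule finite_subset)
    show "I \<subseteq> {\<omega>. \<omega> ^ n = 1}" by (auto simp: I_def root_triples_def)
    show "finite {\<omega>::complex. \<omega> ^ n = 1}" using pos by (intro finite_roots_unity) simp
  qed
  \<comment> \<open>For \<open>\<zeta> = 1\<close> the two points merge on the line
    \<open>x + y = 0\<close>, which adds the root -1.\<close>
  define M where "M = (if \<zeta> = 1 then {-1} else {} :: complex set)"
  \<comment> \<open>Half the radius, because \<open>\<tau>\<close> moves a slope by at most
    \<open>e / 2\<close>: a slope outside \<open>ball z e\<close> stays outside
    \<open>ball z (e / 2)\<close> after the shift.\<close>
  define E where "E = (\<Union>\<omega>\<in>I. ball (slope (\<omega>, \<zeta>, \<eta>)) (e / 2)) \<union> (\<Union>z\<in>M. ball z (e / 2))"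
  have roots_q: "d \<in> M \<or> (\<exists>\<omega>\<in>I. d = slope (\<omega>, \<zeta>, \<eta>))" if d: "poly q d = 0" for d
  proof -
    have "d ^ n = (\<eta> * (d + 1) - \<zeta>) ^ n" using d by (simp add: q)
    then obtain \<omega> where \<omega>: "\<omega> ^ n = 1" "\<eta> * (d + 1) - \<zeta> = \<omega> * d"
      using eq_power_imp_root_of_unity pos(1) by blast
    then have eq: "(\<eta> - \<omega>) * d = \<zeta> - \<eta>" by (simp add: algebra_simps)
    then have "\<eta> \<noteq> \<omega>" using False by auto
    then have d: "d = slope (\<omega>, \<zeta>, \<eta>)" using eq by (simp add: slope_def field_simps)
    show ?thesis
    proof (cases "\<omega> = \<zeta>")
      case True
      then have "\<zeta> = 1" using coprime_roots_of_unity[OF coprime(1), of \<zeta>] roots \<omega> pos by auto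
      moreover have "d = - 1" using True d \<open>\<eta> \<noteq> \<omega>\<close> minus_divide_left[of "\<eta> - \<omega>" "\<eta> - \<omega>"] by (simp add: slope_def)
      ultimately show ?thesis by (simp add: M_def)
    next
      case F: False
      then have "\<omega> \<in> I" using roots \<omega> False \<open>\<eta> \<noteq> \<omega>\<close> by (auto simp: I_def root_triples_def)
      then show ?thesis using d by blast
    qed
  qed
  have "q \<noteq> 0"
  proof
    assume "q = 0"
    then have "UNIV \<subseteq> M \<union> ((\<lambda>\<omega>. slope (\<omega>, \<zeta>, \<eta>)) ` I)" using roots_q by auto
    moreover have "finite M" by (simp add: M_def)
    ultimately have "finite (UNIV :: complex set)" using fI by (meson finite_imageI finite_Un finite_subset)
    then show False by (simp add: infinite_UNIV_char_0)
  qed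
  moreover have "open E" by (auto simp: E_def)
  moreover have "d \<in> E" if "poly q d = 0" for d
    using roots_q[OF that] centre_in_ball[of _ "e / 2"] param_bounds(3) unfolding E_def by fastforce
  ultimately obtain c0 where c0: "0 < c0" "\<And>d. d \<notin> E \<Longrightarrow> c0 \<le> norm (poly q d)"
    using poly_bounded_below_off_roots by blast
  obtain C where C: "0 \<le> C" "\<And>t c. t \<in> ball 0 \<rho> \<Longrightarrow> norm ((c + \<tau> t c + 0) ^ n - (c + 0) ^ n) \<le> C * norm t"
    using shifted_power_bound by blast
  have "\<exists>K\<ge>0. \<forall>t\<in>ball 0 \<rho>. \<forall>c\<in>ball (slope (\<omega>, \<zeta>, \<eta>)) e. \<forall>c'. \<zeta> * (c' + \<tau> t c' + 1) = \<eta> * (c + \<tau> t c + 1) \<longrightarrow>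
      norm (Nn t c c') \<le> K * norm t * norm ((\<zeta> * c') ^ n - c ^ n)"
    if \<omega>: "\<omega> \<in> I" for \<omega>
  proof -
    have i: "(\<omega>, \<zeta>, \<eta>) \<in> root_triples n m k" using \<omega> by (simp add: I_def)
    define s where "s = slope (\<omega>, \<zeta>, \<eta>)"
    have se: "\<eta> * (s + 1) = \<omega> * s + \<zeta>" using slope_eq(1)[OF i] by (simp add: s_def)
    have \<omega>n: "\<omega> ^ n = 1" using i by (simp add: root_triples_def)
    obtain C1 where C1: "0 \<le> C1" "\<And>w v. norm w \<le> 1 \<Longrightarrow> norm v \<le> 1 \<Longrightarrow>
      norm ((\<omega> * s + \<eta> * w + \<eta> * v) ^ n - (\<omega> * s + \<eta> * w) ^ n - (\<omega> * s + \<eta> * v) ^ n + (\<omega> * s) ^ n) \<le> C1 * norm w * norm v"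
      using power_second_difference_bound by blast
    obtain C2 where C2: "0 \<le> C2" "\<And>w v. norm w \<le> 1 \<Longrightarrow> norm v \<le> 1 \<Longrightarrow>
      norm ((s + 1 * w + 1 * v) ^ n - (s + 1 * w) ^ n - (s + 1 * v) ^ n + s ^ n) \<le> C2 * norm w * norm v"
      using power_second_difference_bound by blast
    have "norm (Nn t c c') \<le> (C1 + C2) * L / lb * norm t * norm ((\<zeta> * c') ^ n - c ^ n)"
      if t: "t \<in> ball 0 \<rho>" and c: "c \<in> ball (slope (\<omega>, \<zeta>, \<eta>)) e"
        and cc: "\<zeta> * (c' + \<tau> t c' + 1) = \<eta> * (c + \<tau> t c + 1)" for t c c'
    proof -
      define w where "w = c - s"
      define d where "d = \<delta> s t"
      have cw: "c = s + w" by (simp add: w_def)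
      have w: "norm w < e" "norm w \<le> 1" using c param_bounds unfolding w_def s_def mem_ball_norm_diff by linarith+
      have d: "norm d \<le> L * norm t" "norm d \<le> 1"
        using \<delta>_bound[OF t, of s] Lt_le(1)[OF t] by (auto simp: d_def)
      have nt: "norm (\<eta> / \<zeta>) = 1" using n1 by (simp add: norm_divide)
      define c1 where "c1 = \<omega> / \<zeta> * s + \<eta> / \<zeta> * w"
      have tau: "\<tau> t c1 = \<eta> / \<zeta> * d" "\<tau> t c = d"
        using inverse_slope_near[OF i s_def t w(1) nt] unfolding c1_def cw d_def .
      have z1: "\<zeta> * (c1 + \<tau> t c1) = \<omega> * s + \<eta> * w + \<eta> * d" "\<zeta> * c1 = \<omega> * s + \<eta> * w"
        unfolding tau unfolding c1_def using \<open>\<zeta> \<noteq> 0\<close> by (simp_all add: algebra_simps)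
      have "\<zeta> * (c1 + \<tau> t c1) + \<zeta> = \<eta> * (s + 1) + \<eta> * (w + d)"
        unfolding z1 se by (simp add: algebra_simps)
      also have "\<dots> = \<zeta> * (c' + \<tau> t c') + \<zeta>"
        using cc unfolding tau(2) unfolding cw by (simp add: algebra_simps)
      \<comment> \<open>The pairing condition determines the partner by injectivity of the shift,
        and \<open>c1\<close> satisfies it.\<close>
      finally have "c' = c1" using shift_inj[OF t, of c' c1] \<open>\<zeta> \<noteq> 0\<close> by simp
      have dr: "(\<omega> * s + \<eta> * d) ^ n - (s + d) ^ n = t * (1 - \<zeta> ^ n)" using \<delta>_root[OF i s_def t] by (simp add: d_def)
      have e1: "(\<omega> * s) ^ n = s ^ n" by (simp add: power_mult_distrib \<omega>n)
      have "Nn t c c' =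
          ((\<omega> * s + \<eta> * w + \<eta> * d) ^ n - (\<omega> * s + \<eta> * w) ^ n - (\<omega> * s + \<eta> * d) ^ n + (\<omega> * s) ^ n)
          - ((s + 1 * w + 1 * d) ^ n - (s + 1 * w) ^ n - (s + 1 * d) ^ n + s ^ n)"
        unfolding Nn_def \<open>c' = c1\<close> z1 e1 unfolding tau(2) unfolding cw using dr by (simp add: algebra_simps)
      then have "norm (Nn t c c') \<le> C1 * norm w * norm d + C2 * norm w * norm d"
        using C1(2)[OF w(2) d(2)] C2(2)[OF w(2) d(2)] norm_triangle_ineq4 by (smt (verit, best))
      also have "\<dots> = (C1 + C2) * norm w * norm d" by (simp add: algebra_simps)
      also have "\<dots> \<le> (C1 + C2) * norm w * (L * norm t)" using d C1 C2 by (intro mult_left_mono) auto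
      also have "\<dots> = (C1 + C2) * L / lb * norm t * (lb * norm w)" using param_bounds by simp
      also have "\<dots> \<le> (C1 + C2) * L / lb * norm t * norm ((\<zeta> * c') ^ n - c ^ n)"
        using low_n[OF i s_def w(1)] C1 C2 param_bounds unfolding \<open>c' = c1\<close> z1 cw
        by (intro mult_left_mono mult_nonneg_nonneg divide_nonneg_nonneg) auto
      finally show ?thesis .
    qed
    then show ?thesis using C1 C2 param_bounds by (intro exI[of _ "(C1 + C2) * L / lb"]) auto
  qed
  then obtain K where K: "\<And>\<omega> t c c'. \<omega> \<in> I \<Longrightarrow> t \<in> ball 0 \<rho> \<Longrightarrow> c \<in> ball (slope (\<omega>, \<zeta>, \<eta>)) e \<Longrightarrow>
      \<zeta> * (c' + \<tau> t c' + 1) = \<eta> * (c + \<tau> t c + 1) \<Longrightarrow>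
      norm (Nn t c c') \<le> K \<omega> * norm t * norm ((\<zeta> * c') ^ n - c ^ n)"
    by metis
  obtain K0 where K0: "0 < K0" "\<And>\<omega>. \<omega> \<in> I \<Longrightarrow> K \<omega> \<le> K0" using finite_uniform_upper_bound[OF fI] by blast
  \<comment> \<open>This gives \<open>2 * C * norm t \<le> c0 / 2\<close>, so the lower bound
    \<open>c0\<close> at the shifted slope leaves \<open>c0 / 2\<close> for the unshifted difference
    \<open>D\<close>.\<close>
  define \<rho>' where "\<rho>' = min \<rho> (c0 / (4 * C + 1))"
  have \<rho>': "0 < \<rho>'" "\<rho>' \<le> \<rho>" using param_bounds c0 C by (auto simp: \<rho>'_def)
  define K1 where "K1 = K0 + (2 * C + 2) * 2 / c0"
  have main: "norm (Nn t c c') \<le> K1 * norm t * norm ((\<zeta> * c') ^ n - c ^ n)"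
    if t': "t \<in> ball 0 \<rho>'" and cc: "\<zeta> * (c' + \<tau> t c' + 1) = \<eta> * (c + \<tau> t c + 1)" for t c c'
  proof -
    have t: "t \<in> ball 0 \<rho>" using t' \<rho>' by simp
    define D where "D = (\<zeta> * c') ^ n - c ^ n"
    have nn: "0 \<le> norm t * norm D" by simp
    have split: "K1 * norm t * norm D = K0 * norm t * norm D + (2 * C + 2) * 2 / c0 * norm t * norm D"
      by (simp add: K1_def algebra_simps)
    have nn2: "0 \<le> K0 * norm t * norm D" "0 \<le> (2 * C + 2) * 2 / c0 * norm t * norm D" using K0 C c0 by auto
    consider (near) \<omega> where "\<omega> \<in> I" "c \<in> ball (slope (\<omega>, \<zeta>, \<eta>)) e" | (m1) "\<exists>z\<in>M. c \<in> ball z e"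
      | (off) "\<forall>\<omega>\<in>I. c \<notin> ball (slope (\<omega>, \<zeta>, \<eta>)) e" "\<forall>z\<in>M. c \<notin> ball z e"
      by blast
    then have "norm (Nn t c c') \<le> K1 * norm t * norm D"
    proof cases
      case near
      have "norm (Nn t c c') \<le> K \<omega> * (norm t * norm D)" using K[OF near(1) t near(2) cc] by (simp add: mult.assoc D_def)
      also have "\<dots> \<le> K0 * (norm t * norm D)" by (intro mult_right_mono K0 near nn)
      finally show ?thesis using split nn2 by (simp add: mult.assoc)
    next
      case M: m1
      have m1: "\<zeta> = 1" "c \<in> ball (- 1) e" using M by (auto simp: M_def split: if_splits)
      define c1 where "c1 = \<eta> * (c + 1) - 1"
      have "norm (\<eta> * (c + 1)) < e" using m1 n1 unfolding mem_ball_norm_diff by (simp add: norm_mult)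
      then have "c1 \<in> ball (- 1) e" unfolding mem_ball_norm_diff by (simp add: c1_def)
      then have tau: "\<tau> t c1 = 0" "\<tau> t c = 0" using \<tau>_m1 m1 by auto
      then have "c' = c1" using cc m1 shift_inj[OF t, of c' c1] by (simp add: c1_def algebra_simps)
      then have "Nn t c c' = 0" using tau m1 by (simp add: Nn_def)
      then show ?thesis using split nn2 by simp
    next
      case off
      have far: "c + \<tau> t c \<notin> ball z (e / 2)" if "c \<notin> ball z e" for z
        using that \<tau>_bound[OF t, of c] Lt_le(2)[OF t] norm_triangle_ineq4[of "c + \<tau> t c - z" "\<tau> t c"]
        unfolding mem_ball_norm_diff by (simp add: algebra_simps)
      have "c + \<tau> t c \<notin> E" using far off unfolding E_def by blast
      then have qb: "c0 \<le> norm (poly q (c + \<tau> t c))" by (rule c0(2))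
      have eq: "\<eta> * (c + \<tau> t c + 1) - \<zeta> = \<zeta> * (c' + \<tau> t c')" using cc by (simp add: algebra_simps)
      define a where "a = \<zeta> ^ n * ((c' + \<tau> t c' + 0) ^ n - (c' + 0) ^ n) - ((c + \<tau> t c + 0) ^ n - (c + 0) ^ n)"
      have "norm a \<le> norm (\<zeta> ^ n * ((c' + \<tau> t c' + 0) ^ n - (c' + 0) ^ n)) + norm ((c + \<tau> t c + 0) ^ n - (c + 0) ^ n)"
        unfolding a_def by (rule norm_triangle_ineq4)
      also have "\<dots> \<le> 2 * C * norm t" using C(2)[OF t, of c] C(2)[OF t, of c'] n1 by (simp add: norm_mult norm_power)
      finally have a: "norm a \<le> 2 * C * norm t" .
      have "poly q (c + \<tau> t c) = D + a"
        unfolding q eq D_def a_def power_mult_distrib by (simp add: algebra_simps)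
      then have "c0 \<le> norm D + norm a" using qb norm_triangle_ineq[of D a] by simp
      moreover have "2 * C * norm t \<le> c0 / 2"
      proof -
        have "norm t * (4 * C + 1) \<le> c0" using t' C by (simp add: \<rho>'_def pos_less_divide_eq)
        then show ?thesis using norm_ge_zero[of t] by (simp add: algebra_simps del: norm_ge_zero)
      qed
      ultimately have D: "c0 / 2 \<le> norm D" using a by linarith
      have "Nn t c c' = a - t * (1 - \<zeta> ^ n)"
        unfolding Nn_def a_def power_mult_distrib by (simp add: algebra_simps)
      then have "norm (Nn t c c') \<le> norm a + norm (t * (1 - \<zeta> ^ n))" using norm_triangle_ineq4 by simp
      also have "norm (t * (1 - \<zeta> ^ n)) \<le> norm t * 2"
        unfolding norm_mult using norm_triangle_ineq4[of 1 "\<zeta> ^ n"] n1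
        by (intro mult_left_mono) (auto simp: norm_power)
      finally have "norm (Nn t c c') \<le> (2 * C + 2) * norm t" using a by (simp add: algebra_simps)
      also have "\<dots> = (2 * C + 2) * 2 / c0 * norm t * (c0 / 2)" using c0 by simp
      also have "\<dots> \<le> (2 * C + 2) * 2 / c0 * norm t * norm D"
        using c0 C D by (intro mult_left_mono) auto
      finally show ?thesis using split nn2 by simp
    qed
    then show ?thesis by (simp add: D_def)
  qed
  show ?thesis
  proof (rule that[of K1 \<rho>'])
    show "0 \<le> K1" using K0 C c0 by (simp add: K1_def)
    fix t c c' :: complex assume "t \<in> ball 0 \<rho>'" "\<zeta> * (c' + \<tau> t c' + 1) = \<eta> * (c + \<tau> t c + 1)"
    then show "norm ((((\<zeta> * (c' + \<tau> t c')) ^ n + t * \<zeta> ^ n) - ((c + \<tau> t c) ^ n + t)) - ((\<zeta> * c') ^ n - c ^ n))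
        \<le> K1 * norm t * norm ((\<zeta> * c') ^ n - c ^ n)"
      using main unfolding Nn_def by blast
  qed (rule \<rho>')+
qed

end

text \<open>At \<open>y = 0\<close> the quotient has no limit, but \<open>\<sigma>\<close> is
  bounded and the factor \<open>y\<close> forces the limit 0, which is also the value.\<close>

lemma continuous_on_homogenization:
  fixes \<sigma> :: "complex \<Rightarrow> complex \<Rightarrow> complex"
  assumes cont: "continuous_on (UNIV \<times> ball 0 \<rho>) (\<lambda>p. \<sigma> (snd p) (fst p))"
    and bound: "\<And>t c. t \<in> ball 0 \<rho> \<Longrightarrow> norm (\<sigma> t c) \<le> M"
  shows "continuous_on (UNIV \<times> ball 0 \<rho>) (\<lambda>p. snd (fst p) * \<sigma> (snd p) (fst (fst p) / snd (fst p)))"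
    (is "continuous_on ?D ?h")
proof -
  have D: "open ?D" "open (UNIV \<times> ball 0 \<rho> :: (complex \<times> complex) set)" by (auto simp: open_Times)
  have "isCont ?h p" if p: "p \<in> ?D" for p
  proof (cases "snd (fst p) = 0")
    case False
    have "isCont (\<lambda>p. \<sigma> (snd p) (fst p)) (fst (fst p) / snd (fst p), snd p)"
      using cont p by (auto simp: continuous_on_eq_continuous_at[OF D(2)])
    moreover have "isCont (\<lambda>p. (fst (fst p) / snd (fst p), snd p)) p"
      using False by (intro continuous_intros)
    ultimately have "isCont (\<lambda>p. \<sigma> (snd p) (fst (fst p) / snd (fst p))) p"
      using isCont_o2[of p "\<lambda>p. (fst (fst p) / snd (fst p), snd p)" "\<lambda>p. \<sigma> (snd p) (fst p)"] by simp
    then show ?thesis by (intro continuous_intros)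
  next
    case True
    have "((\<lambda>p. snd (fst p)) \<longlongrightarrow> snd (fst p)) (at p)" by (intro tendsto_intros)
    then have "((\<lambda>p. norm (snd (fst p)) * M) \<longlongrightarrow> 0) (at p)"
      using True by (auto intro!: tendsto_eq_intros)
    moreover have "\<forall>\<^sub>F p in at p. norm (?h p) \<le> norm (snd (fst p)) * M"
      using eventually_at_topological[of "\<lambda>p. p \<in> ?D" p UNIV] D(1) p
      by (rule_tac eventually_mono[of "\<lambda>p. p \<in> ?D"])
         (auto simp: norm_mult intro!: mult_left_mono bound)
    ultimately have "(?h \<longlongrightarrow> 0) (at p)" by (rule Lim_null_comparison[rotated])
    then show ?thesis using True by (simp add: isCont_def)
  qed
  then show ?thesis by (simp add: continuous_on_eq_continuous_at[OF D(1)])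
qed

section \<open>Inverse shift and construction of the homeomorphisms\<close>

context slope_displacement
begin

definition unshift :: "complex \<Rightarrow> complex \<Rightarrow> complex"
  where "unshift t d = (THE c. c + \<tau> t c = d)"

text \<open>The map \<open>c \<mapsto> d - \<tau> t c\<close> is a contraction with factor 1/2; its
  fixed point is the required preimage.\<close>

lemma unshift_eq:
  assumes t: "t \<in> ball 0 \<rho>"
  shows "unshift t d + \<tau> t (unshift t d) = d"
proof -
  have "\<exists>!c. d - \<tau> t c = c"
  proof (rule banach_fix_type)
    show "(0::real) \<le> 1 / 2" "1 / 2 < (1::real)" by simp_all
    show "\<forall>c c'. dist (d - \<tau> t c) (d - \<tau> t c') \<le> 1 / 2 * dist c c'"
    proof (intro allI)
      fix c c'
      have "norm (\<tau> t c' - \<tau> t c) \<le> L * norm t * norm (c' - c)" by (rule \<tau>_lip[OF t])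
      also have "\<dots> \<le> 1 / 2 * norm (c' - c)" by (intro mult_right_mono Lt_le t) simp
      finally show "dist (d - \<tau> t c) (d - \<tau> t c') \<le> 1 / 2 * dist c c'"
        by (simp add: dist_norm norm_minus_commute)
    qed
  qed
  then have "\<exists>!c. c + \<tau> t c = d" by (metis add_diff_cancel_right' diff_add_cancel)
  then show ?thesis unfolding unshift_def by (rule theI')
qed

lemma unshift_unique:
  assumes "t \<in> ball 0 \<rho>" "c + \<tau> t c = d"
  shows "unshift t d = c"
  using shift_inj[OF assms(1), of "unshift t d" c] unshift_eq[OF assms(1), of d] assms(2) by simp

text \<open>The distance of two preimages is at most twice the change of the data, because the
  Lipschitz bound on \<open>\<tau>\<close> absorbs half of it.\<close>

lemma continuous_on_unshift:
  "continuous_on (UNIV \<times> ball 0 \<rho>) (\<lambda>p. unshift (snd p) (fst p))"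
proof -
  have D: "open (UNIV \<times> ball 0 \<rho> :: (complex \<times> complex) set)" by (auto simp: open_Times)
  have "isCont (\<lambda>p. unshift (snd p) (fst p)) p" if p: "p \<in> UNIV \<times> ball 0 \<rho>" for p
  proof -
    define c where "c = unshift (snd p) (fst p)"
    have c: "c + \<tau> (snd p) c = fst p" using unshift_eq p by (auto simp: c_def)
    have "isCont (\<lambda>p. \<tau> (snd p) (fst p)) (c, snd p)"
      using \<tau>_cont p by (auto simp: continuous_on_eq_continuous_at[OF D])
    then have "isCont (\<lambda>q. \<tau> (snd q) c) p"
      using isCont_o2[of p "\<lambda>q. (c, snd q)" "\<lambda>p. \<tau> (snd p) (fst p)"] by (simp add: continuous_intros)
    then have "((\<lambda>q. 2 * (norm (fst q - fst p) + norm (\<tau> (snd q) c - \<tau> (snd p) c))) \<longlongrightarrow> 0) (at p)"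
      unfolding isCont_def by (auto intro!: tendsto_eq_intros)
    moreover have "norm (unshift (snd q) (fst q) - c) \<le> 2 * (norm (fst q - fst p) + norm (\<tau> (snd q) c - \<tau> (snd p) c))"
      if q: "snd q \<in> ball 0 \<rho>" for q
    proof -
      define a where "a = unshift (snd q) (fst q)"
      have a: "a + \<tau> (snd q) a = fst q" using unshift_eq[OF q] by (simp add: a_def)
      have "a - c = (fst q - fst p) - (\<tau> (snd q) a - \<tau> (snd q) c) - (\<tau> (snd q) c - \<tau> (snd p) c)"
        unfolding a[symmetric] c[symmetric] by simp
      also have "norm \<dots> \<le> norm ((fst q - fst p) - (\<tau> (snd q) a - \<tau> (snd q) c)) + norm (\<tau> (snd q) c - \<tau> (snd p) c)"
        by (rule norm_triangle_ineq4)
      also have "norm ((fst q - fst p) - (\<tau> (snd q) a - \<tau> (snd q) c)) \<le> norm (fst q - fst p) + norm (\<tau> (snd q) a - \<tau> (snd q) c)"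
        by (rule norm_triangle_ineq4)
      finally have "norm (a - c) \<le> norm (fst q - fst p) + norm (\<tau> (snd q) a - \<tau> (snd q) c) + norm (\<tau> (snd q) c - \<tau> (snd p) c)"
        by simp
      moreover have "norm (\<tau> (snd q) a - \<tau> (snd q) c) \<le> 1 / 2 * norm (a - c)"
        using \<tau>_lip[OF q, of a c] mult_right_mono[OF Lt_le(1)[OF q], of "norm (a - c)"] by simp
      moreover have "x \<le> 2 * (p + q)" if "x \<le> p + r + q" "r \<le> 1 / 2 * x" for x p q r :: real
        using that by (simp add: field_simps)
      ultimately show ?thesis unfolding a_def[symmetric] by blast
    qed
    then have "\<forall>\<^sub>F q in at p. norm (unshift (snd q) (fst q) - c) \<le> 2 * (norm (fst q - fst p) + norm (\<tau> (snd q) c - \<tau> (snd p) c))"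
      using eventually_at_topological[of "\<lambda>q. q \<in> UNIV \<times> ball 0 \<rho>" p UNIV] D p
      by (rule_tac eventually_mono[of "\<lambda>q. q \<in> UNIV \<times> ball 0 \<rho>"]) auto
    ultimately have "((\<lambda>q. unshift (snd q) (fst q) - c) \<longlongrightarrow> 0) (at p)" by (rule Lim_null_comparison[rotated])
    then show ?thesis by (simp add: isCont_def c_def[symmetric] LIM_zero_iff)
  qed
  then show ?thesis by (simp add: continuous_on_eq_continuous_at[OF D])
qed

text \<open>There are only finitely many roots of unity, so one constant serves all. The condition
  \<open>2 * K * \<epsilon> < 1\<close> matches the Lipschitz constant \<open>2 * K * norm t\<close>
  of the extensions.\<close>

lemma uniform_estimates:
  obtains K \<epsilon> where "0 \<le> K" "0 < \<epsilon>" "\<epsilon> \<le> \<rho>" "2 * K * \<epsilon> < 1"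
    "\<And>t c c' \<omega> \<zeta>. t \<in> ball 0 \<epsilon> \<Longrightarrow> \<omega> ^ n = 1 \<Longrightarrow> \<zeta> ^ m = 1 \<Longrightarrow> c' = \<omega> / \<zeta> * c \<Longrightarrow>
      norm (((\<zeta> * (c' + \<tau> t c' + 1)) ^ k - (c + \<tau> t c + 1) ^ k) - ((\<zeta> * (c' + 1)) ^ k - (c + 1) ^ k))
        \<le> K * norm t * norm ((\<zeta> * (c' + 1)) ^ k - (c + 1) ^ k)"
    "\<And>t c c' \<zeta> \<eta>. t \<in> ball 0 \<epsilon> \<Longrightarrow> \<zeta> ^ m = 1 \<Longrightarrow> \<eta> ^ k = 1 \<Longrightarrow> \<zeta> * (c' + \<tau> t c' + 1) = \<eta> * (c + \<tau> t c + 1) \<Longrightarrow>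
      norm ((((\<zeta> * (c' + \<tau> t c')) ^ n + t * \<zeta> ^ n) - ((c + \<tau> t c) ^ n + t)) - ((\<zeta> * c') ^ n - c ^ n))
        \<le> K * norm t * norm ((\<zeta> * c') ^ n - c ^ n)"
proof -
  define A where "A = {\<omega>::complex. \<omega> ^ n = 1} \<times> {\<zeta>::complex. \<zeta> ^ m = 1}"
  define B where "B = {\<zeta>::complex. \<zeta> ^ m = 1} \<times> {\<eta>::complex. \<eta> ^ k = 1}"
  have fin: "finite A" "finite B"
    using pos unfolding A_def B_def by (intro finite_cartesian_product finite_roots_unity; simp)+
  define P where "P = (\<lambda>(\<omega>, \<zeta>) K. \<forall>t c c'. t \<in> ball 0 \<rho> \<longrightarrow> c' = \<omega> / \<zeta> * c \<longrightarrow>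
      norm (((\<zeta> * (c' + \<tau> t c' + 1)) ^ k - (c + \<tau> t c + 1) ^ k) - ((\<zeta> * (c' + 1)) ^ k - (c + 1) ^ k))
        \<le> K * norm t * norm ((\<zeta> * (c' + 1)) ^ k - (c + 1) ^ k))"
  define Q where "Q = (\<lambda>(\<zeta>, \<eta>) K r. \<forall>t c c'. t \<in> ball 0 r \<longrightarrow> \<zeta> * (c' + \<tau> t c' + 1) = \<eta> * (c + \<tau> t c + 1) \<longrightarrow>
      norm ((((\<zeta> * (c' + \<tau> t c')) ^ n + t * \<zeta> ^ n) - ((c + \<tau> t c) ^ n + t)) - ((\<zeta> * c') ^ n - c ^ n))
        \<le> K * norm t * norm ((\<zeta> * c') ^ n - c ^ n))"
  have "\<exists>K. P a K" if "a \<in> A" for a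
  proof -
    obtain \<omega> \<zeta> where a: "a = (\<omega>, \<zeta>)" by (cases a)
    have "\<omega> ^ n = 1" "\<zeta> ^ m = 1" using that by (auto simp: a A_def)
    then show ?thesis unfolding P_def a prod.case by (rule third_coordinate_estimate) blast
  qed
  then obtain KA where KA: "\<And>a. a \<in> A \<Longrightarrow> P a (KA a)" by metis
  have "\<exists>K r. 0 < r \<and> Q b K r" if "b \<in> B" for b
  proof -
    obtain \<zeta> \<eta> where b: "b = (\<zeta>, \<eta>)" by (cases b)
    have "\<zeta> ^ m = 1" "\<eta> ^ k = 1" using that by (auto simp: b B_def)
    then show ?thesis unfolding Q_def b prod.case by (rule first_coordinate_estimate) blast
  qed
  then obtain KB rB where KB: "\<And>b. b \<in> B \<Longrightarrow> 0 < rB b \<and> Q b (KB b) (rB b)" by metis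
  obtain K1 where K1: "0 < K1" "\<And>a. a \<in> A \<Longrightarrow> KA a \<le> K1" using finite_uniform_upper_bound[OF fin(1)] by blast
  obtain K2 where K2: "0 < K2" "\<And>b. b \<in> B \<Longrightarrow> KB b \<le> K2" using finite_uniform_upper_bound[OF fin(2)] by blast
  obtain r where r: "0 < r" "\<And>b. b \<in> B \<Longrightarrow> r \<le> rB b" using finite_uniform_lower_bound[OF fin(2), of rB] KB by blast
  define K where "K = max K1 K2"
  have "0 < K" using K1 by (simp add: K_def)
  define \<epsilon> where "\<epsilon> = min (min \<rho> r) (1 / (4 * K))"
  show ?thesis
  proof (rule that[of K \<epsilon>])
    show "0 \<le> K" "0 < \<epsilon>" "\<epsilon> \<le> \<rho>" using \<open>0 < K\<close> r param_bounds by (auto simp: \<epsilon>_def)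
    have "\<epsilon> \<le> 1 / (4 * K)" by (simp add: \<epsilon>_def)
    then show "2 * K * \<epsilon> < 1" using \<open>0 < K\<close> by (simp add: field_simps)
  next
    fix t c c' \<omega> \<zeta> :: complex
    assume t: "t \<in> ball 0 \<epsilon>" and roots: "\<omega> ^ n = 1" "\<zeta> ^ m = 1" and c: "c' = \<omega> / \<zeta> * c"
    have A: "(\<omega>, \<zeta>) \<in> A" using roots by (simp add: A_def)
    have "t \<in> ball 0 \<rho>" using t by (simp add: \<epsilon>_def)
    then have "norm (((\<zeta> * (c' + \<tau> t c' + 1)) ^ k - (c + \<tau> t c + 1) ^ k) - ((\<zeta> * (c' + 1)) ^ k - (c + 1) ^ k))
        \<le> KA (\<omega>, \<zeta>) * norm t * norm ((\<zeta> * (c' + 1)) ^ k - (c + 1) ^ k)"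
      using KA[OF A] c unfolding P_def prod.case by blast
    also have "\<dots> \<le> K * norm t * norm ((\<zeta> * (c' + 1)) ^ k - (c + 1) ^ k)"
      using K1(2)[OF A] by (intro mult_right_mono) (auto simp: K_def)
    finally show "norm (((\<zeta> * (c' + \<tau> t c' + 1)) ^ k - (c + \<tau> t c + 1) ^ k) - ((\<zeta> * (c' + 1)) ^ k - (c + 1) ^ k))
        \<le> K * norm t * norm ((\<zeta> * (c' + 1)) ^ k - (c + 1) ^ k)" .
  next
    fix t c c' \<zeta> \<eta> :: complex
    assume t: "t \<in> ball 0 \<epsilon>" and roots: "\<zeta> ^ m = 1" "\<eta> ^ k = 1"
      and c: "\<zeta> * (c' + \<tau> t c' + 1) = \<eta> * (c + \<tau> t c + 1)"
    have B: "(\<zeta>, \<eta>) \<in> B" using roots by (simp add: B_def)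
    have "t \<in> ball 0 (rB (\<zeta>, \<eta>))" using t r(2)[OF B] by (simp add: \<epsilon>_def)
    then have "norm ((((\<zeta> * (c' + \<tau> t c')) ^ n + t * \<zeta> ^ n) - ((c + \<tau> t c) ^ n + t)) - ((\<zeta> * c') ^ n - c ^ n))
        \<le> KB (\<zeta>, \<eta>) * norm t * norm ((\<zeta> * c') ^ n - c ^ n)"
      using KB[OF B] c unfolding Q_def prod.case by blast
    also have "\<dots> \<le> K * norm t * norm ((\<zeta> * c') ^ n - c ^ n)"
      using K2(2)[OF B] by (intro mult_right_mono) (auto simp: K_def)
    finally show "norm ((((\<zeta> * (c' + \<tau> t c')) ^ n + t * \<zeta> ^ n) - ((c + \<tau> t c) ^ n + t)) - ((\<zeta> * c') ^ n - c ^ n))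
        \<le> K * norm t * norm ((\<zeta> * c') ^ n - c ^ n)" .
  qed
qed

text \<open>With \<open>x' = x + h t (x, y)\<close> the target maps pass through the intermediate
  map \<open>(x ^ n, y ^ m, (x' + y) ^ k)\<close>: \<open>HB\<close> replaces the third coordinate,
  and then \<open>HA\<close>, over the new third coordinate, replaces \<open>x ^ n\<close> by
  \<open>x' ^ n + t * y ^ n\<close>.\<close>

lemma topologically_trivial_unfolding:
  "topologically_trivial (\<lambda>t (x, y). (x ^ n + t * y ^ n, y ^ m, (x + y) ^ k))"
proof -
  obtain K \<epsilon> where K: "0 \<le> K" "0 < \<epsilon>" "\<epsilon> \<le> \<rho>" "2 * K * \<epsilon> < 1"
    and estB: "\<And>t c c' \<omega> \<zeta>. t \<in> ball 0 \<epsilon> \<Longrightarrow> \<omega> ^ n = 1 \<Longrightarrow> \<zeta> ^ m = 1 \<Longrightarrow> c' = \<omega> / \<zeta> * c \<Longrightarrow>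
      norm (((\<zeta> * (c' + \<tau> t c' + 1)) ^ k - (c + \<tau> t c + 1) ^ k) - ((\<zeta> * (c' + 1)) ^ k - (c + 1) ^ k))
        \<le> K * norm t * norm ((\<zeta> * (c' + 1)) ^ k - (c + 1) ^ k)"
    and estA: "\<And>t c c' \<zeta> \<eta>. t \<in> ball 0 \<epsilon> \<Longrightarrow> \<zeta> ^ m = 1 \<Longrightarrow> \<eta> ^ k = 1 \<Longrightarrow> \<zeta> * (c' + \<tau> t c' + 1) = \<eta> * (c + \<tau> t c + 1) \<Longrightarrow>
      norm ((((\<zeta> * (c' + \<tau> t c')) ^ n + t * \<zeta> ^ n) - ((c + \<tau> t c) ^ n + t)) - ((\<zeta> * c') ^ n - c ^ n))
        \<le> K * norm t * norm ((\<zeta> * c') ^ n - c ^ n)"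
    using uniform_estimates by blast
  have sub: "t \<in> ball 0 \<rho>" if "t \<in> ball 0 \<epsilon>" for t :: complex using that K(3) by simp
  have Ds: "UNIV \<times> ball 0 \<epsilon> \<subseteq> UNIV \<times> ball (0::complex) \<rho>" using K(3) by auto
  define D where "D = (UNIV \<times> ball 0 \<epsilon> :: (C2 \<times> complex) set)"
  have homog: "continuous_on D (\<lambda>p. snd (fst p) * \<sigma> (snd p) (fst (fst p) / snd (fst p)))"
    if "continuous_on (UNIV \<times> ball 0 \<rho>) (\<lambda>p. \<sigma> (snd p) (fst p))"
      "\<And>t c. t \<in> ball 0 \<rho> \<Longrightarrow> norm (\<sigma> t c) \<le> 1" for \<sigma>
    unfolding D_def by (rule continuous_on_subset[OF continuous_on_homogenization[OF that]]) (use K(3) in auto)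
  have \<tau>1: "norm (\<tau> t c) \<le> 1" if "t \<in> ball 0 \<rho>" for t c
    using \<tau>_bound[OF that, of c] Lt_le(1)[OF that] by linarith
  define h where "h = (\<lambda>t z. snd z * \<tau> t (fst z / snd z))"
  have hc: "continuous_on D (\<lambda>p. h (snd p) (fst p))"
    unfolding h_def by (rule homog[OF \<tau>_cont \<tau>1])
  \<comment> \<open>The displacement \<open>h\<close>, read off at the moved point;
    \<open>unshift\<close> recovers the original slope.\<close>
  define g where "g = (\<lambda>t z. snd z * \<tau> t (unshift t (fst z / snd z)))"
  have gc: "continuous_on D (\<lambda>p. g (snd p) (fst p))"
    unfolding g_def
  proof (rule homog)
    have "continuous_on (UNIV \<times> ball 0 \<rho>) (\<lambda>p. (unshift (snd p) (fst p), snd p))"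
      by (intro continuous_intros continuous_on_unshift)
    then show "continuous_on (UNIV \<times> ball 0 \<rho>) (\<lambda>p. \<tau> (snd p) (unshift (snd p) (fst p)))"
      using continuous_on_compose2[OF \<tau>_cont] by fastforce
  qed (rule \<tau>1)
  define \<phi> where "\<phi> = (\<lambda>t (z :: C2). (fst z + h t z, snd z))"
  \<comment> \<open>\<open>aB\<close>, \<open>bB\<close> and \<open>aA\<close>, \<open>bA\<close>
    are the old and new values of the coordinate to be moved. The second pair is written in
    \<open>(s, y)\<close>, where \<open>s\<close> is the moved \<open>x\<close> plus
    \<open>y\<close>, because \<open>(s ^ k, y ^ m)\<close> is the base of that step.\<close>
  define aB where "aB = (\<lambda>(t::complex) (z :: C2). (fst z + snd z) ^ k)"
  define bB where "bB = (\<lambda>t (z :: C2). (fst z + h t z + snd z) ^ k)"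
  define aA where "aA = (\<lambda>t (z :: C2). (fst z - snd z - g t (fst z - snd z, snd z)) ^ n)"
  define bA where "bA = (\<lambda>t (z :: C2). (fst z - snd z) ^ n + t * snd z ^ n)"
  obtain HB where HB: "continuous_on ((UNIV \<times> UNIV) \<times> ball 0 \<epsilon>) (\<lambda>p. HB (snd p) (fst (fst p)) (snd (fst p)))"
    "\<And>t x y. t \<in> ball 0 \<epsilon> \<Longrightarrow> HB t (aB t (x, y)) (x ^ n, y ^ m) = bB t (x, y)"
    "\<And>t v v' w. norm ((HB t v w - v) - (HB t v' w - v')) \<le> 2 * K * norm t * norm (v - v')"
    "\<And>v w. HB 0 v w = v"
  proof (rule fibrewise_lipschitz_extension[of n m \<epsilon> K aB bB])
    show "continuous_on (UNIV \<times> ball 0 \<epsilon>) (\<lambda>p. aB (snd p) (fst p))"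
      unfolding aB_def by (intro continuous_intros)
    show "continuous_on (UNIV \<times> ball 0 \<epsilon>) (\<lambda>p. bB (snd p) (fst p))"
      unfolding bB_def using hc[unfolded D_def] by (intro continuous_intros)
    show "bB 0 = aB 0" by (simp add: aB_def bB_def h_def \<tau>_zero)
    fix t x y \<omega> \<zeta> :: complex assume t: "t \<in> ball 0 \<epsilon>" and roots: "\<omega> ^ n = 1" "\<zeta> ^ m = 1"
    show "norm ((bB t (\<omega> * x, \<zeta> * y) - bB t (x, y)) - (aB t (\<omega> * x, \<zeta> * y) - aB t (x, y)))
        \<le> K * norm t * norm (aB t (\<omega> * x, \<zeta> * y) - aB t (x, y))"
    proof (cases "y = 0")
      case True
      then show ?thesis using K(1) by (simp add: aB_def bB_def h_def)
    next
      case False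
      have "\<zeta> \<noteq> 0" using roots pos by (auto simp: zero_power)
      \<comment> \<open>By homogeneity a factor \<open>y ^ k\<close> splits off and only the slope
        remains.\<close>
      define c where "c = x / y"
      define c' where "c' = \<omega> / \<zeta> * c"
      have x: "x = y * c" "\<omega> * x = y * (\<zeta> * c')" "\<omega> * x / (\<zeta> * y) = c'"
        using False \<open>\<zeta> \<noteq> 0\<close> by (simp_all add: c_def c'_def)
      have a: "aB t (x, y) = y ^ k * (c + 1) ^ k" "aB t (\<omega> * x, \<zeta> * y) = y ^ k * (\<zeta> * (c' + 1)) ^ k"
        unfolding aB_def power_mult_distrib[symmetric] fst_conv snd_conv x(2) by (simp_all add: x(1) algebra_simps)
      have b: "bB t (x, y) = y ^ k * (c + \<tau> t c + 1) ^ k" "bB t (\<omega> * x, \<zeta> * y) = y ^ k * (\<zeta> * (c' + \<tau> t c' + 1)) ^ k"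
        unfolding bB_def h_def power_mult_distrib[symmetric] fst_conv snd_conv x(3) c_def[symmetric] x(2)
        by (simp_all add: x(1) algebra_simps)
      have "norm (y ^ k) * norm (((\<zeta> * (c' + \<tau> t c' + 1)) ^ k - (c + \<tau> t c + 1) ^ k) - ((\<zeta> * (c' + 1)) ^ k - (c + 1) ^ k))
        \<le> norm (y ^ k) * (K * norm t * norm ((\<zeta> * (c' + 1)) ^ k - (c + 1) ^ k))"
        by (intro mult_left_mono estB[OF t roots c'_def]) simp
      then show ?thesis
        unfolding a b right_diff_distrib[symmetric] norm_mult by (simp only: mult_ac)
    qed
  qed (use K pos in auto)
  obtain HA where HA: "continuous_on ((UNIV \<times> UNIV) \<times> ball 0 \<epsilon>) (\<lambda>p. HA (snd p) (fst (fst p)) (snd (fst p)))"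
    "\<And>t x y. t \<in> ball 0 \<epsilon> \<Longrightarrow> HA t (aA t (x, y)) (x ^ k, y ^ m) = bA t (x, y)"
    "\<And>t v v' w. norm ((HA t v w - v) - (HA t v' w - v')) \<le> 2 * K * norm t * norm (v - v')"
    "\<And>v w. HA 0 v w = v"
  proof (rule fibrewise_lipschitz_extension[of k m \<epsilon> K aA bA])
    have "continuous_on D (\<lambda>p. (\<lambda>p. g (snd p) (fst p)) ((fst (fst p) - snd (fst p), snd (fst p)), snd p))"
      by (rule continuous_on_compose2[OF gc]) (auto simp: D_def intro!: continuous_intros)
    then show "continuous_on (UNIV \<times> ball 0 \<epsilon>) (\<lambda>p. aA (snd p) (fst p))"
      unfolding aA_def D_def by (intro continuous_intros) simp
    show "continuous_on (UNIV \<times> ball 0 \<epsilon>) (\<lambda>p. bA (snd p) (fst p))"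
      unfolding bA_def by (intro continuous_intros)
    show "bA 0 = aA 0" by (simp add: aA_def bA_def g_def \<tau>_zero)
    fix t s y \<eta> \<zeta> :: complex assume t: "t \<in> ball 0 \<epsilon>" and roots: "\<eta> ^ k = 1" "\<zeta> ^ m = 1"
    show "norm ((bA t (\<eta> * s, \<zeta> * y) - bA t (s, y)) - (aA t (\<eta> * s, \<zeta> * y) - aA t (s, y)))
        \<le> K * norm t * norm (aA t (\<eta> * s, \<zeta> * y) - aA t (s, y))"
    proof (cases "y = 0")
      case True
      then show ?thesis using K(1) pos by (simp add: aA_def bA_def g_def zero_power)
    next
      case False
      have "\<zeta> \<noteq> 0" using roots pos by (auto simp: zero_power)
      define c where "c = unshift t ((s - y) / y)"
      define c' where "c' = unshift t ((\<eta> * s - \<zeta> * y) / (\<zeta> * y))"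
      have c: "c + \<tau> t c = (s - y) / y" and c': "c' + \<tau> t c' = (\<eta> * s - \<zeta> * y) / (\<zeta> * y)"
        unfolding c_def c'_def by (intro unshift_eq sub t)+
      have s: "s - y = y * (c + \<tau> t c)" and s': "\<eta> * s - \<zeta> * y = y * (\<zeta> * (c' + \<tau> t c'))"
        unfolding c c' using False \<open>\<zeta> \<noteq> 0\<close> by simp_all
      have eq: "\<zeta> * (c' + \<tau> t c' + 1) = \<eta> * (c + \<tau> t c + 1)"
        unfolding c c' using False \<open>\<zeta> \<noteq> 0\<close> by (simp add: field_simps)
      have g: "g t (s - y, y) = y * \<tau> t c" "g t (\<eta> * s - \<zeta> * y, \<zeta> * y) = \<zeta> * y * \<tau> t c'"
        by (simp_all add: g_def c_def c'_def)
      have a: "aA t (s, y) = y ^ n * c ^ n" "aA t (\<eta> * s, \<zeta> * y) = y ^ n * (\<zeta> * c') ^ n"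
        unfolding aA_def fst_conv snd_conv g unfolding s s' power_mult_distrib[symmetric]
        by (simp_all add: algebra_simps)
      have b: "bA t (s, y) = y ^ n * ((c + \<tau> t c) ^ n + t)"
        "bA t (\<eta> * s, \<zeta> * y) = y ^ n * ((\<zeta> * (c' + \<tau> t c')) ^ n + t * \<zeta> ^ n)"
        unfolding bA_def fst_conv snd_conv s s' power_mult_distrib by (simp_all only: distrib_left mult_ac)
      have "norm (y ^ n) * norm ((((\<zeta> * (c' + \<tau> t c')) ^ n + t * \<zeta> ^ n) - ((c + \<tau> t c) ^ n + t)) - ((\<zeta> * c') ^ n - c ^ n))
        \<le> norm (y ^ n) * (K * norm t * norm ((\<zeta> * c') ^ n - c ^ n))"
        by (intro mult_left_mono estA[OF t roots(2,1) eq]) simp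
      then show ?thesis
        unfolding a b right_diff_distrib[symmetric] norm_mult by (simp only: mult_ac)
    qed
  qed (use K pos in auto)
  \<comment> \<open>A displacement with Lipschitz constant below 1 cannot identify two
    points.\<close>
  have inj_fibre: "v = v'" if H: "\<And>v v' w. norm ((H t v w - v) - (H t v' w - v')) \<le> 2 * K * norm t * norm (v - v')"
    and t: "t \<in> ball 0 \<epsilon>" and eq: "H t v w = H t v' w" for H :: "complex \<Rightarrow> complex \<Rightarrow> C2 \<Rightarrow> complex" and t v v' w
  proof (rule ccontr)
    assume "v \<noteq> v'"
    have "norm (v - v') \<le> 2 * K * norm t * norm (v - v')"
      using H[of v w v'] eq by (simp add: norm_minus_commute)
    then have "1 \<le> 2 * K * norm t" using \<open>v \<noteq> v'\<close> by (simp add: mult_le_cancel_right1)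
    also have "\<dots> \<le> 2 * K * \<epsilon>" using t K(1) by (intro mult_left_mono) auto
    finally show False using K(4) by simp
  qed
  define \<psi> where "\<psi> = (\<lambda>t (w :: C3).
    (HA t (fst w) (HB t (snd (snd w)) (fst w, fst (snd w)), fst (snd w)), fst (snd w), HB t (snd (snd w)) (fst w, fst (snd w))))"
  define f where "f = (\<lambda>t (z :: C2). (fst z ^ n + t * snd z ^ n, snd z ^ m, (fst z + snd z) ^ k))"
  have conj: "f t (\<phi> t z) = \<psi> t (f 0 z)" if t: "t \<in> ball 0 \<epsilon>" for t z
  proof -
    obtain x y where z: "z = (x, y)" by (cases z)
    have 1: "HB t ((x + y) ^ k) (x ^ n, y ^ m) = (x + h t z + y) ^ k"
      using HB(2)[OF t, of x y] by (simp add: aB_def bB_def z)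
    have "g t (x + h t z, y) = h t z"
    proof (cases "y = 0")
      case False
      have "unshift t ((x + h t z) / y) = x / y"
        using False by (intro unshift_unique sub t) (simp add: h_def z add_divide_distrib)
      then show ?thesis by (simp add: g_def h_def z)
    qed (simp add: g_def h_def z)
    then have 2: "HA t (x ^ n) ((x + h t z + y) ^ k, y ^ m) = (x + h t z) ^ n + t * y ^ n"
      using HA(2)[OF t, of "x + h t z + y" y] by (simp add: aA_def bA_def)
    show ?thesis using 1 2 by (simp add: f_def \<psi>_def \<phi>_def z)
  qed
  have "\<exists>\<phi>'. homeo_unfolding \<phi> \<phi>' \<and> (\<forall>t\<in>ball 0 \<epsilon>. \<forall>z. \<phi>' t (\<phi> t z) = z)"
  proof (rule homeo_unfolding_of_injective[OF K(2)])
    show "continuous_on (UNIV \<times> ball 0 \<epsilon>) (\<lambda>p. \<phi> (snd p) (fst p))"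
      unfolding \<phi>_def using hc[unfolded D_def] by (intro continuous_intros)
    show "\<phi> 0 z = z" for z by (simp add: \<phi>_def h_def \<tau>_zero)
    show "\<phi> t 0 = 0" for t by (simp add: \<phi>_def h_def zero_prod_def)
    show "inj (\<phi> t)" if t: "t \<in> ball 0 \<epsilon>" for t
    proof (rule injI)
      fix z z' assume "\<phi> t z = \<phi> t z'"
      then have y: "snd z = snd z'" and x: "fst z + h t z = fst z' + h t z'" by (simp_all add: \<phi>_def)
      have "fst z = fst z'"
      proof (cases "snd z = 0")
        case False
        have "fst z / snd z + \<tau> t (fst z / snd z) = (fst z + h t z) / snd z"
          using False by (simp add: h_def add_divide_distrib)
        also have "\<dots> = fst z' / snd z + \<tau> t (fst z' / snd z)"
          using False unfolding x by (simp add: h_def y add_divide_distrib)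
        finally have "fst z / snd z = fst z' / snd z" by (rule shift_inj[OF sub[OF t]])
        then show ?thesis using False by simp
      qed (use x y in \<open>simp add: h_def\<close>)
      then show "z = z'" using y by (simp add: prod_eq_iff)
    qed
  qed
  then obtain \<phi>' where \<phi>': "homeo_unfolding \<phi> \<phi>'" by blast
  have "\<exists>\<psi>'. homeo_unfolding \<psi> \<psi>' \<and> (\<forall>t\<in>ball 0 \<epsilon>. \<forall>z. \<psi>' t (\<psi> t z) = z)"
  proof (rule homeo_unfolding_of_injective[OF K(2)])
    have cB: "continuous_on (UNIV \<times> ball 0 \<epsilon>) (\<lambda>p :: C3 \<times> complex. HB (snd p) (snd (snd (fst p))) (fst (fst p), fst (snd (fst p))))"
    proof -
      have "continuous_on (UNIV \<times> ball 0 \<epsilon>) (\<lambda>p :: C3 \<times> complex. ((snd (snd (fst p)), (fst (fst p), fst (snd (fst p)))), snd p))"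
        by (intro continuous_intros)
      then show ?thesis using continuous_on_compose2[OF HB(1)] by fastforce
    qed
    have "continuous_on (UNIV \<times> ball 0 \<epsilon>) (\<lambda>p :: C3 \<times> complex.
        ((fst (fst p), (HB (snd p) (snd (snd (fst p))) (fst (fst p), fst (snd (fst p))), fst (snd (fst p)))), snd p))"
      by (intro continuous_intros cB)
    then have cA: "continuous_on (UNIV \<times> ball 0 \<epsilon>) (\<lambda>p :: C3 \<times> complex.
        HA (snd p) (fst (fst p)) (HB (snd p) (snd (snd (fst p))) (fst (fst p), fst (snd (fst p))), fst (snd (fst p))))"
      using continuous_on_compose2[OF HA(1)] by fastforce
    show "continuous_on (UNIV \<times> ball 0 \<epsilon>) (\<lambda>p. \<psi> (snd p) (fst p))"
      unfolding \<psi>_def by (intro continuous_intros cA cB)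
    show "\<psi> 0 w = w" for w by (simp add: \<psi>_def HA(4) HB(4))
    \<comment> \<open>The origin is the image of the origin under \<open>f 0\<close>, so
      \<open>conj\<close> applies.\<close>
    show "\<psi> t 0 = 0" if t: "t \<in> ball 0 \<epsilon>" for t
      using conj[OF t, of 0] pos by (simp add: f_def \<phi>_def h_def zero_prod_def zero_power)
    show "inj (\<psi> t)" if t: "t \<in> ball 0 \<epsilon>" for t
    proof (rule injI)
      fix w w' assume eq: "\<psi> t w = \<psi> t w'"
      have A: "HA t (fst w) (HB t (snd (snd w)) (fst w, fst (snd w)), fst (snd w))
          = HA t (fst w') (HB t (snd (snd w')) (fst w', fst (snd w')), fst (snd w'))"
        and u: "fst (snd w) = fst (snd w')"
        and v: "HB t (snd (snd w)) (fst w, fst (snd w)) = HB t (snd (snd w')) (fst w', fst (snd w'))"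
        using eq unfolding \<psi>_def prod.inject by blast+
      have "HA t (fst w) (HB t (snd (snd w)) (fst w, fst (snd w)), fst (snd w))
          = HA t (fst w') (HB t (snd (snd w)) (fst w, fst (snd w)), fst (snd w))"
        unfolding A unfolding v unfolding u by (rule refl)
      then have X: "fst w = fst w'" using inj_fibre[of HA, OF HA(3) t] by blast
      then have "snd (snd w) = snd (snd w')" using v u inj_fibre[of HB, OF HB(3) t] by metis
      then show "w = w'" using u X by (simp add: prod_eq_iff)
    qed
  qed
  then obtain \<psi>' where \<psi>': "homeo_unfolding \<psi> \<psi>'" "\<And>t w. t \<in> ball 0 \<epsilon> \<Longrightarrow> \<psi>' t (\<psi> t w) = w" by blast
  have "\<forall>\<^sub>F p in nhds (0 :: C2 \<times> complex). p \<in> D"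
    using K(2) by (intro eventually_nhds_in_open) (auto simp: D_def open_Times zero_prod_def)
  then have "\<forall>\<^sub>F p in nhds 0. (unfolding_of \<psi>' \<circ> unfolding_of f \<circ> unfolding_of \<phi>) p = map_prod (f 0) id p"
  proof (rule eventually_mono)
    fix p assume "p \<in> D"
    then have t: "snd p \<in> ball 0 \<epsilon>" by (auto simp: D_def)
    show "(unfolding_of \<psi>' \<circ> unfolding_of f \<circ> unfolding_of \<phi>) p = map_prod (f 0) id p"
      using conj[OF t, of "fst p"] \<psi>'(2)[OF t] by (cases p) (simp add: unfolding_of_def)
  qed
  then have "topologically_trivial f" using \<phi>' \<psi>'(1) unfolding topologically_trivial_def by blast
  moreover have "f = (\<lambda>t (x, y). (x ^ n + t * y ^ n, y ^ m, (x + y) ^ k))"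
    by (simp add: f_def fun_eq_iff)
  ultimately show ?thesis by simp
qed

end

section \<open>Choice of the constants\<close>

lemma twisted_difference_bounded_below:
  fixes a b x :: complex
  assumes "a ^ N = 1" "a \<noteq> b" "x \<noteq> 0" "0 < N"
  obtains r c where "0 < r" "0 < c" "\<And>w. norm w < r \<Longrightarrow> c * norm w \<le> norm ((a * x + b * w) ^ N - (x + w) ^ N)"
proof -
  have "(\<lambda>w. (a * x + b * w) ^ N - (x + w) ^ N) holomorphic_on UNIV" by (intro holomorphic_intros)
  from locally_bounded_below[OF this deriv_twisted_difference_nonzero[OF assms]]
  obtain r c where rc: "0 < r" "0 < c" "\<And>w w'. w \<in> ball 0 r \<Longrightarrow> w' \<in> ball 0 r \<Longrightarrow>
      c * norm (w - w') \<le> norm ((a * x + b * w) ^ N - (x + w) ^ N - ((a * x + b * w') ^ N - (x + w') ^ N))"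
    by blast
  show ?thesis
  proof (rule that[OF rc(1,2)])
    fix w :: complex assume "norm w < r"
    then show "c * norm w \<le> norm ((a * x + b * w) ^ N - (x + w) ^ N)"
      using rc(3)[of w 0] rc(1) assms(1) by (simp add: power_mult_distrib)
  qed
qed

lemma topologically_trivial_homogeneous_unfolding:
  fixes n m k :: nat
  assumes pos: "0 < n" "0 < m" "0 < k" and cop: "coprime n m" "coprime n k" "coprime m k"
  shows "topologically_trivial (\<lambda>t (x, y). (x ^ n + t * y ^ n, y ^ m, (x + y) ^ k))"
proof -
  define T where "T = root_triples n m k"
  have fT: "finite T" using finite_root_triples[OF pos] by (simp add: T_def)
  obtain \<rho>0 K and \<delta> :: "complex \<Rightarrow> complex \<Rightarrow> complex" where \<delta>: "0 < \<rho>0" "0 < K"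
    "\<And>c. continuous_on (ball 0 \<rho>0) (\<delta> c)"
    "\<And>c t. t \<in> ball 0 \<rho>0 \<Longrightarrow> norm (\<delta> c t) \<le> K * norm t"
    "\<And>\<omega> \<zeta> \<eta> c t. (\<omega>, \<zeta>, \<eta>) \<in> root_triples n m k \<Longrightarrow> c = slope (\<omega>, \<zeta>, \<eta>) \<Longrightarrow> t \<in> ball 0 \<rho>0 \<Longrightarrow>
      (\<omega> * c + \<eta> * \<delta> c t) ^ n - (c + \<delta> c t) ^ n = t * (1 - \<zeta> ^ n)"
    "\<And>\<omega> \<zeta> \<eta> c t. (\<omega>, \<zeta>, \<eta>) \<in> root_triples n m k \<Longrightarrow> c = slope (\<omega>, \<zeta>, \<eta>) \<Longrightarrow> t \<in> ball 0 \<rho>0 \<Longrightarrow>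
      \<delta> (\<omega> / \<zeta> * c) t = \<eta> / \<zeta> * \<delta> c t"
    "\<And>c t. c \<notin> slope ` root_triples n m k \<Longrightarrow> \<delta> c t = 0"
    using displacement_paths[OF pos cop(1)] by blast
  define Pn where "Pn = (\<lambda>(\<omega>, \<zeta>, \<eta>) r lb. \<forall>w. norm w < r \<longrightarrow>
    lb * norm w \<le> norm ((\<omega> * slope (\<omega>, \<zeta>, \<eta>) + \<eta> * w) ^ n - (slope (\<omega>, \<zeta>, \<eta>) + w) ^ n))"
  define Pk where "Pk = (\<lambda>(\<omega>, \<zeta>, \<eta>) r lb. \<forall>w. norm w < r \<longrightarrow>
    lb * norm w \<le> norm ((\<eta> * (slope (\<omega>, \<zeta>, \<eta>) + 1) + \<omega> * w) ^ k - (slope (\<omega>, \<zeta>, \<eta>) + 1 + w) ^ k))"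
  have ex: "(\<exists>r lb. 0 < r \<and> 0 < lb \<and> Pn i r lb) \<and> (\<exists>r lb. 0 < r \<and> 0 < lb \<and> Pk i r lb)" if i: "i \<in> T" for i
  proof -
    obtain \<omega> \<zeta> \<eta> where ii: "i = (\<omega>, \<zeta>, \<eta>)" by (cases i)
    have T: "(\<omega>, \<zeta>, \<eta>) \<in> root_triples n m k" using i by (simp add: T_def ii)
    have a: "\<omega> ^ n = 1" "\<eta> ^ k = 1" "\<omega> \<noteq> \<eta>" "\<eta> \<noteq> \<omega>" using T by (auto simp: root_triples_def)
    have s: "slope (\<omega>, \<zeta>, \<eta>) \<noteq> 0" "slope (\<omega>, \<zeta>, \<eta>) + 1 \<noteq> 0"
      using slope_eq(2,3)[OF T] by (auto simp: eq_neg_iff_add_eq_0)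
    show ?thesis
    proof
      show "\<exists>r lb. 0 < r \<and> 0 < lb \<and> Pn i r lb"
        unfolding Pn_def ii prod.case
        by (rule twisted_difference_bounded_below[OF a(1,3) s(1) pos(1)]) blast
      show "\<exists>r lb. 0 < r \<and> 0 < lb \<and> Pk i r lb"
        unfolding Pk_def ii prod.case
        by (rule twisted_difference_bounded_below[OF a(2,4) s(2) pos(3)]) blast
    qed
  qed
  obtain r1 l1 where 1: "\<And>i. i \<in> T \<Longrightarrow> 0 < r1 i \<and> 0 < l1 i \<and> Pn i (r1 i) (l1 i)" using ex by metis
  obtain r2 l2 where 2: "\<And>i. i \<in> T \<Longrightarrow> 0 < r2 i \<and> 0 < l2 i \<and> Pk i (r2 i) (l2 i)" using ex by metis
  obtain e1 where e1: "0 < e1" "\<And>i. i \<in> T \<Longrightarrow> e1 \<le> r1 i"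
    using finite_uniform_lower_bound[OF fT, of r1] 1 by blast
  obtain e2 where e2: "0 < e2" "\<And>i. i \<in> T \<Longrightarrow> e2 \<le> r2 i"
    using finite_uniform_lower_bound[OF fT, of r2] 2 by blast
  obtain lb1 where lb1: "0 < lb1" "\<And>i. i \<in> T \<Longrightarrow> lb1 \<le> l1 i"
    using finite_uniform_lower_bound[OF fT, of l1] 1 by blast
  obtain lb2 where lb2: "0 < lb2" "\<And>i. i \<in> T \<Longrightarrow> lb2 \<le> l2 i"
    using finite_uniform_lower_bound[OF fT, of l2] 2 by blast
  \<comment> \<open>At 0 and -1 the displacement \<open>\<delta>\<close> vanishes; including them
    makes the interpolated shift vanish around these slopes.\<close>
  define A where "A = slope ` T \<union> {0, - 1}"
  have fA: "finite A" using fT by (simp add: A_def)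
  have fAA: "finite {p \<in> A \<times> A. fst p \<noteq> snd p}" using fA by simp
  obtain e3 where e3: "0 < e3" "\<And>p. p \<in> {p \<in> A \<times> A. fst p \<noteq> snd p} \<Longrightarrow> e3 \<le> norm (fst p - snd p)"
    using finite_uniform_lower_bound[OF fAA, of "\<lambda>p. norm (fst p - snd p)"] by auto
  \<comment> \<open>\<open>e3 / 3\<close> provides the separation by \<open>3 * e\<close>, and
    \<open>e \<le> 1\<close> keeps the distance \<open>w\<close> in the range of the second
    difference bounds.\<close>
  define e where "e = min (min e1 e2) (min (e3 / 3) 1)"
  have e: "0 < e" "e \<le> e1" "e \<le> e2" "3 * e \<le> e3" "e \<le> 1" using e1 e2 e3 by (auto simp: e_def)
  define lb where "lb = min lb1 lb2"
  have lb: "0 < lb" "lb \<le> lb1" "lb \<le> lb2" using lb1 lb2 by (auto simp: lb_def)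
  have sep: "3 * e \<le> norm (a - b)" if "a \<in> A" "b \<in> A" "a \<noteq> b" for a b
    using e3(2)[of "(a, b)"] that e(4) by simp
  obtain \<tau> :: "complex \<Rightarrow> complex \<Rightarrow> complex" and L1 R where \<tau>: "0 \<le> L1"
    "continuous_on (UNIV \<times> ball 0 \<rho>0) (\<lambda>p. \<tau> (snd p) (fst p))"
    "\<And>t c. t \<in> ball 0 \<rho>0 \<Longrightarrow> norm (\<tau> t c) \<le> L1 * norm t"
    "\<And>t c c'. t \<in> ball 0 \<rho>0 \<Longrightarrow> norm (\<tau> t c - \<tau> t c') \<le> L1 * norm t * norm (c - c')"
    "\<And>t a c. a \<in> A \<Longrightarrow> c \<in> ball a e \<Longrightarrow> \<tau> t c = \<delta> a t"
    "\<And>t c. R \<le> norm c \<Longrightarrow> \<tau> t c = 0"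
    by (rule bump_interpolation[where \<delta> = \<delta> and \<rho> = \<rho>0, OF fA e(1) less_imp_le[OF \<delta>(2)] \<delta>(3) \<delta>(4) sep]) blast+
  define L where "L = max L1 K"
  have L: "0 < L" "L1 \<le> L" "K \<le> L" using \<delta>(2) by (auto simp: L_def)
  define \<rho> where "\<rho> = min \<rho>0 (e / (2 * L))"
  have \<rho>: "0 < \<rho>" "\<rho> \<le> \<rho>0" using \<delta>(1) e L by (auto simp: \<rho>_def)
  have "\<rho> \<le> e / (2 * L)" by (simp add: \<rho>_def)
  then have L\<rho>: "L * \<rho> \<le> e / 2" using L by (simp add: field_simps)
  have in\<rho>: "t \<in> ball 0 \<rho>0" if "t \<in> ball 0 \<rho>" for t :: complex using that \<rho> by simp
  have special: "0 \<notin> slope ` root_triples n m k" "- 1 \<notin> slope ` root_triples n m k"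
    unfolding image_iff using slope_eq(2,3)[of _ _ _ n m k] by (metis prod_cases3)+
  interpret slope_displacement n m k \<delta> \<tau> \<rho> L R e lb
  proof
    show "0 < n" "0 < m" "0 < k" "coprime n m" "coprime n k" "coprime m k" by fact+
    show "0 < \<rho>" "0 \<le> L" "0 < e" "0 < lb" "L * \<rho> \<le> e / 2" "e \<le> 1" using \<rho> L e lb L\<rho> by auto
    show "L * \<rho> \<le> 1 / 2" using L\<rho> e(5) by simp
    show "continuous_on (UNIV \<times> ball 0 \<rho>) (\<lambda>p. \<tau> (snd p) (fst p))"
      by (rule continuous_on_subset[OF \<tau>(2)]) (use \<rho> in auto)
    show "norm (\<tau> t c) \<le> L * norm t" if "t \<in> ball 0 \<rho>" for t c
      using \<tau>(3)[OF in\<rho>[OF that], of c] mult_right_mono[OF L(2), of "norm t"] by simp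
    show "norm (\<delta> c t) \<le> L * norm t" if "t \<in> ball 0 \<rho>" for t c
      using \<delta>(4)[OF in\<rho>[OF that], of c] mult_right_mono[OF L(3), of "norm t"] by simp
    show "norm (\<tau> t c - \<tau> t c') \<le> L * norm t * norm (c - c')" if "t \<in> ball 0 \<rho>" for t c c'
      using \<tau>(4)[OF in\<rho>[OF that], of c c'] mult_right_mono[OF mult_right_mono[OF L(2), of "norm t"], of "norm (c - c')"]
      by simp
    show "\<tau> t c = \<delta> (slope i) t" if "i \<in> root_triples n m k" "c \<in> ball (slope i) e" for t i c
      by (rule \<tau>(5)) (use that in \<open>auto simp: A_def T_def\<close>)
    show "\<tau> t c = 0" if "c \<in> ball 0 e" for t c
      using \<tau>(5)[of 0 c t] that \<delta>(7)[OF special(1)] by (simp add: A_def)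
    show "\<tau> t c = 0" if "c \<in> ball (- 1) e" for t c
      using \<tau>(5)[of "- 1" c t] that \<delta>(7)[OF special(2)] by (simp add: A_def)
    show "\<tau> t c = 0" if "R \<le> norm c" for t c using \<tau>(6)[OF that] .
    fix \<omega> \<zeta> \<eta> c assume i: "(\<omega>, \<zeta>, \<eta>) \<in> root_triples n m k" and c: "c = slope (\<omega>, \<zeta>, \<eta>)"
    show "(\<omega> * c + \<eta> * \<delta> c t) ^ n - (c + \<delta> c t) ^ n = t * (1 - \<zeta> ^ n)"
      "\<delta> (\<omega> / \<zeta> * c) t = \<eta> / \<zeta> * \<delta> c t" if "t \<in> ball 0 \<rho>" for t
      using \<delta>(5,6)[OF i c in\<rho>[OF that]] .
    have iT: "(\<omega>, \<zeta>, \<eta>) \<in> T" using i by (simp add: T_def)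
    fix w :: complex assume w: "norm w < e"
    have "lb * norm w \<le> l1 (\<omega>, \<zeta>, \<eta>) * norm w"
      using lb1(2)[OF iT] lb by (intro mult_right_mono) auto
    also have "\<dots> \<le> norm ((\<omega> * c + \<eta> * w) ^ n - (c + w) ^ n)"
      using 1[OF iT] w e(2) e1(2)[OF iT] by (simp add: Pn_def c)
    finally show "lb * norm w \<le> norm ((\<omega> * c + \<eta> * w) ^ n - (c + w) ^ n)" .
    have "lb * norm w \<le> l2 (\<omega>, \<zeta>, \<eta>) * norm w"
      using lb2(2)[OF iT] lb by (intro mult_right_mono) auto
    also have "\<dots> \<le> norm ((\<eta> * (c + 1) + \<omega> * w) ^ k - (c + 1 + w) ^ k)"
      using 2[OF iT] w e(3) e2(2)[OF iT] by (simp add: Pk_def c)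
    finally show "lb * norm w \<le> norm ((\<eta> * (c + 1) + \<omega> * w) ^ k - (c + 1 + w) ^ k)" .
  qed
  show ?thesis by (rule topologically_trivial_unfolding)
qed


section \<open>Failure of Whitney's condition (b)\<close>

lemma closest_point_eqI:
  fixes S :: "'a::euclidean_space set"
  assumes "convex S" "closed S" "p \<in> S" "\<And>y. y \<in> S \<Longrightarrow> dist a p \<le> dist a y"
  shows "closest_point S a = p"
  by (rule sym, rule closest_point_unique) (use assms in auto)

lemma injective_derivative_lower_bound:
  fixes F :: "'a::euclidean_space \<Rightarrow> 'b::euclidean_space"
  assumes "(F has_derivative F') (at z)" "inj F'"
  obtains c d where "0 < c" "0 < d" "\<And>z'. dist z' z < d \<Longrightarrow> c * norm (z' - z) \<le> norm (F z' - F z)"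
proof -
  have lin: "linear F'" using assms(1) by (rule has_derivative_linear)
  obtain B where B: "0 < B" "\<And>x. B * norm x \<le> norm (F' x)"
    using linear_inj_bounded_below_pos[OF lin assms(2)] by (metis mult.commute)
  obtain d where d: "0 < d" "\<And>z'. norm (z' - z) < d \<Longrightarrow> norm (F z' - F z - F' (z' - z)) \<le> B / 2 * norm (z' - z)"
    using assms(1) B(1) unfolding has_derivative_at_alt by (meson half_gt_zero)
  show ?thesis
  proof (rule that[of "B / 2" d])
    show "0 < B / 2" using B by simp
    fix z' assume "dist z' z < d"
    then have "norm (F z' - F z - F' (z' - z)) \<le> B / 2 * norm (z' - z)" using d(2) by (simp add: dist_norm)
    moreover have "B * norm (z' - z) \<le> norm (F' (z' - z))" by (rule B)
    moreover have "norm (F' (z' - z)) \<le> norm (F z' - F z) + norm (F z' - F z - F' (z' - z))"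
      using norm_triangle_ineq4[of "F z' - F z" "F z' - F z - F' (z' - z)"] by simp
    ultimately show "B / 2 * norm (z' - z) \<le> norm (F z' - F z)" by (simp add: field_simps)
  qed (rule d)
qed

text \<open>Curves in \<open>tangent_space\<close> are only differentiable at one point and need not
  lift to differentiable curves, so merely a sequence of points is lifted. By \<open>lift\<close>
  the preimages converge, and injectivity of \<open>F'\<close> bounds their distance to
  \<open>z\<close> by that of the images. Hence the difference quotients approach
  \<open>range F'\<close>, which is closed.\<close>

lemma tangent_space_image:
  fixes F :: "'a::euclidean_space \<Rightarrow> 'b::euclidean_space"
  assumes der: "(F has_derivative F') (at z)" and inj: "inj F'"
    and sub: "X \<subseteq> range F"
    and lift: "\<And>w. (\<lambda>i. F (w i)) \<longlonglongrightarrow> F z \<Longrightarrow> (w::nat \<Rightarrow> 'a) \<longlonglongrightarrow> z"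
    and near: "\<forall>\<^sub>F w in nhds z. F w \<in> X"
  shows "tangent_space X (F z) = range F'"
proof
  have lin: "linear F'" using der by (rule has_derivative_linear)
  show "range F' \<subseteq> tangent_space X (F z)"
  proof clarify
    fix v
    define g :: "real \<Rightarrow> 'a" where "g = (\<lambda>s. z + s *\<^sub>R v)"
    have g: "(g has_derivative (\<lambda>s. s *\<^sub>R v)) (at 0)"
      unfolding g_def by (auto intro!: derivative_eq_intros)
    have "((\<lambda>s. F (g s)) has_derivative (\<lambda>s. F' (s *\<^sub>R v))) (at 0)"
      by (rule has_derivative_compose[OF g]) (simp add: g_def der)
    then have "((\<lambda>s. F (g s)) has_vector_derivative F' v) (at 0)"
      by (simp add: has_vector_derivative_def linear_scale[OF lin])
    moreover have "\<forall>\<^sub>F s in nhds 0. F (g s) \<in> X"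
    proof -
      have "isCont g 0" unfolding g_def by (intro continuous_intros)
      then have "filterlim g (nhds (g 0)) (nhds 0)"
        by (simp add: continuous_at tendsto_at_iff_tendsto_nhds)
      then show ?thesis using eventually_compose_filterlim[OF near] by (simp add: g_def)
    qed
    ultimately show "F' v \<in> tangent_space X (F z)"
      unfolding tangent_space_def by (auto intro!: exI[of _ "\<lambda>s. F (g s)"] simp: g_def)
  qed
  show "tangent_space X (F z) \<subseteq> range F'"
  proof
    fix v assume "v \<in> tangent_space X (F z)"
    then obtain \<gamma> :: "real \<Rightarrow> 'b" where \<gamma>: "\<gamma> 0 = F z" "\<forall>\<^sub>F s in nhds 0. \<gamma> s \<in> X" "(\<gamma> has_vector_derivative v) (at 0)"
      by (auto simp: tangent_space_def)
    define s where "s = (\<lambda>i. inverse (real (Suc i)))"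
    have s: "s \<longlonglongrightarrow> 0" "\<And>i. 0 < s i"
      unfolding s_def by (rule LIMSEQ_inverse_real_of_nat, simp)
    have "\<forall>\<^sub>F i in sequentially. \<gamma> (s i) \<in> X" using \<gamma>(2) s(1) eventually_compose_filterlim by blast
    then have "\<forall>\<^sub>F i in sequentially. \<exists>w. F w = \<gamma> (s i)"
    proof (rule eventually_mono)
      fix i assume "\<gamma> (s i) \<in> X"
      then have "\<gamma> (s i) \<in> range F" using sub by blast
      then show "\<exists>w. F w = \<gamma> (s i)" by (metis imageE)
    qed
    then obtain N where N: "\<And>i. N \<le> i \<Longrightarrow> \<exists>w. F w = \<gamma> (s i)"
      unfolding eventually_sequentially by blast
    define w where "w = (\<lambda>i. SOME w. F w = \<gamma> (s (i + N)))"
    define r where "r = (\<lambda>i. s (i + N))"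
    have Fw: "F (w i) = \<gamma> (r i)" for i
      unfolding w_def r_def using someI_ex[OF N[of "i + N"]] by simp
    have r: "r \<longlonglongrightarrow> 0" "\<And>i. 0 < r i" using s LIMSEQ_ignore_initial_segment by (auto simp: r_def)
    define Q where "Q = (\<lambda>i. (F (w i) - F z) /\<^sub>R r i)"
    have quot: "Q \<longlonglongrightarrow> v"
    proof -
      have "((\<lambda>h. norm (\<gamma> (0 + h) - \<gamma> 0 - h *\<^sub>R v) / norm h) \<longlongrightarrow> 0) (at 0)"
        using \<gamma>(3) unfolding has_vector_derivative_def has_derivative_at by blast
      moreover have "filterlim r (at 0) sequentially"
        using r(1) r(2) by (intro filterlim_atI always_eventually allI) (auto simp: less_imp_neq[symmetric])
      ultimately have "(\<lambda>i. norm (\<gamma> (0 + r i) - \<gamma> 0 - r i *\<^sub>R v) / norm (r i)) \<longlonglongrightarrow> 0"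
        by (rule filterlim_compose)
      moreover have "norm (\<gamma> (0 + r i) - \<gamma> 0 - r i *\<^sub>R v) / norm (r i) = norm (Q i - v)" for i
      proof -
        have "\<gamma> (0 + r i) - \<gamma> 0 - r i *\<^sub>R v = r i *\<^sub>R (Q i - v)"
          using r(2)[of i] by (simp add: Q_def Fw \<gamma>(1) scaleR_diff_right)
        then show ?thesis using r(2)[of i] by simp
      qed
      ultimately show ?thesis by (simp add: tendsto_norm_zero_iff LIM_zero_iff)
    qed
    have "(\<lambda>i. r i *\<^sub>R Q i) \<longlonglongrightarrow> 0 *\<^sub>R v" by (intro tendsto_scaleR r quot)
    moreover have "r i *\<^sub>R Q i = F (w i) - F z" for i using r(2)[of i] by (simp add: Q_def)
    ultimately have "(\<lambda>i. F (w i)) \<longlonglongrightarrow> F z" by (simp add: LIM_zero_iff)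
    then have wz: "w \<longlonglongrightarrow> z" by (rule lift)
    obtain c d where cd: "0 < c" "0 < d" "\<And>z'. dist z' z < d \<Longrightarrow> c * norm (z' - z) \<le> norm (F z' - F z)"
      using injective_derivative_lower_bound[OF der inj] by blast
    \<comment> \<open>The part of the quotient \<open>Q\<close> that \<open>F'\<close> does not
      account for.\<close>
    define E where "E = (\<lambda>i. (F (w i) - F z - F' (w i - z)) /\<^sub>R r i)"
    have "E \<longlonglongrightarrow> 0"
    proof (rule tendstoI)
      fix \<epsilon> :: real assume "0 < \<epsilon>"
      \<comment> \<open>The factors undo the loss \<open>1 / c\<close> of the lower bound and the
        bound \<open>norm v + 1\<close> for \<open>norm (Q i)\<close>.\<close>
      define \<epsilon>' where "\<epsilon>' = \<epsilon> * c / (norm v + 1)"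
      have "0 < norm v + 1" by (simp add: add_nonneg_pos)
      then have "0 < \<epsilon>'" using \<open>0 < \<epsilon>\<close> cd(1) by (simp add: \<epsilon>'_def)
      then obtain d' where d': "0 < d'"
        "\<And>z'. norm (z' - z) < d' \<Longrightarrow> norm (F z' - F z - F' (z' - z)) \<le> \<epsilon>' * norm (z' - z)"
        using der unfolding has_derivative_at_alt by meson
      have "\<forall>\<^sub>F i in sequentially. dist (w i) z < min d d'"
        using wz cd(2) d'(1) by (intro tendstoD) auto
      moreover have "\<forall>\<^sub>F i in sequentially. norm (Q i) < norm v + 1"
        using tendsto_norm[OF quot] by (rule order_tendstoD) simp
      ultimately show "\<forall>\<^sub>F i in sequentially. dist (E i) 0 < \<epsilon>"
      proof eventually_elim
        case (elim i)
        have "norm (F (w i) - F z - F' (w i - z)) \<le> \<epsilon>' * norm (w i - z)"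
          using d'(2)[of "w i"] elim(1) by (simp add: dist_norm)
        also have "\<dots> \<le> \<epsilon>' * (norm (F (w i) - F z) / c)"
          using cd(3)[of "w i"] elim(1) cd(1) \<open>0 < \<epsilon>'\<close> by (intro mult_left_mono) (auto simp: field_simps)
        also have "norm (F (w i) - F z) = r i * norm (Q i)"
          using r(2)[of i] by (simp add: Q_def)
        finally have "norm (F (w i) - F z - F' (w i - z)) \<le> \<epsilon>' / c * norm (Q i) * r i" by (simp add: mult_ac)
        moreover have "norm (E i) * r i = norm (F (w i) - F z - F' (w i - z))"
          using r(2)[of i] by (simp add: E_def)
        ultimately have "norm (E i) * r i \<le> \<epsilon>' / c * norm (Q i) * r i" by simp
        then have "norm (E i) \<le> \<epsilon>' / c * norm (Q i)" using r(2)[of i] by (rule mult_right_le_imp_le)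
        also have "\<dots> < \<epsilon>' / c * (norm v + 1)"
          using elim(2) \<open>0 < \<epsilon>'\<close> cd(1) by (intro mult_strict_left_mono) auto
        also have "\<dots> = \<epsilon>" using \<open>0 < norm v + 1\<close> cd(1) by (simp add: \<epsilon>'_def)
        finally show ?case by simp
      qed
    qed
    then have lim: "(\<lambda>i. Q i - E i) \<longlonglongrightarrow> v - 0" by (intro tendsto_diff quot)
    have mem: "Q i - E i \<in> range F'" for i
    proof -
      have "Q i - E i = F' ((w i - z) /\<^sub>R r i)"
        by (simp add: Q_def E_def linear_scale[OF lin] scaleR_diff_right[symmetric])
      then show ?thesis by simp
    qed
    have "closed (range F')"
      using linear_subspace_image[OF lin subspace_UNIV] by (rule closed_subspace)
    then show "v \<in> range F'" using closed_sequentially[OF _ mem lim] by simp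
  qed
qed

section \<open>Complex hyperplanes with real coefficients and their orthogonal projections\<close>

definition hyperplane4 :: "real \<Rightarrow> real \<Rightarrow> (C3 \<times> complex) set"
  where "hyperplane4 \<alpha> \<beta> = {v. fst (fst v) = \<alpha> *\<^sub>R fst (snd (fst v)) + \<beta> *\<^sub>R snd v}"

text \<open>The correction is made along the normal \<open>(1, - \<alpha>, 0, - \<beta>)\<close>,
  whose squared length is the denominator of \<open>\<mu>\<close>.\<close>

definition hyperplane4_projection :: "real \<Rightarrow> real \<Rightarrow> C3 \<times> complex \<Rightarrow> C3 \<times> complex"
  where "hyperplane4_projection \<alpha> \<beta> v =
    (let \<mu> = (fst (fst v) - \<alpha> *\<^sub>R fst (snd (fst v)) - \<beta> *\<^sub>R snd v) /\<^sub>R (1 + \<alpha>\<^sup>2 + \<beta>\<^sup>2) in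
      ((fst (fst v) - \<mu>, fst (snd (fst v)) + \<alpha> *\<^sub>R \<mu>, snd (snd (fst v))), snd v + \<beta> *\<^sub>R \<mu>))"

lemma subspace_hyperplane4: "subspace (hyperplane4 \<alpha> \<beta>)"
  by (auto simp: subspace_def hyperplane4_def scaleR_add_right algebra_simps)

lemma closest_point_hyperplane4:
  "closest_point (hyperplane4 \<alpha> \<beta>) v = hyperplane4_projection \<alpha> \<beta> v"
proof (rule closest_point_eqI)
  let ?H = "hyperplane4 \<alpha> \<beta>" and ?p = "hyperplane4_projection \<alpha> \<beta> v"
  show "convex ?H" "closed ?H"
    using subspace_hyperplane4 by (auto intro: subspace_imp_convex closed_subspace)
  define l where "l = fst (fst v) - \<alpha> *\<^sub>R fst (snd (fst v)) - \<beta> *\<^sub>R snd v"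
  define N where "N = 1 + \<alpha>\<^sup>2 + \<beta>\<^sup>2"
  define \<mu> where "\<mu> = l /\<^sub>R N"
  have "0 < N" unfolding N_def by (simp add: add_pos_nonneg)
  have p: "?p = ((fst (fst v) - \<mu>, fst (snd (fst v)) + \<alpha> *\<^sub>R \<mu>, snd (snd (fst v))), snd v + \<beta> *\<^sub>R \<mu>)"
    by (simp add: hyperplane4_projection_def \<mu>_def l_def N_def Let_def)
  have "l = N *\<^sub>R \<mu>" using \<open>0 < N\<close> by (simp add: \<mu>_def)
  also have "\<dots> = \<mu> + \<alpha> *\<^sub>R \<alpha> *\<^sub>R \<mu> + \<beta> *\<^sub>R \<beta> *\<^sub>R \<mu>"
    by (simp add: N_def scaleR_add_left power2_eq_square)
  finally show pH: "?p \<in> ?H" unfolding p hyperplane4_def l_def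
    by (simp add: scaleR_add_right algebra_simps)
  fix y assume y: "y \<in> ?H"
  define w where "w = ?p - y"
  have "w \<in> ?H" unfolding w_def by (rule subspace_diff[OF subspace_hyperplane4 pH y])
  then have "inner (v - ?p) w = 0"
    by (simp add: p hyperplane4_def inner_prod_def inner_add_right algebra_simps)
  then have "(norm (v - ?p + w))\<^sup>2 = (norm (v - ?p))\<^sup>2 + (norm w)\<^sup>2"
    by (simp add: power2_norm_eq_inner inner_add_left inner_add_right inner_commute)
  then have "(norm (v - ?p))\<^sup>2 \<le> (norm (v - y))\<^sup>2" by (simp add: w_def)
  then show "dist v ?p \<le> dist v y" by (simp add: dist_norm power2_le_iff_abs_le)
qed

text \<open>The explicit projection is rational in \<open>\<beta>\<close> with a denominator that is
  never 0, so the limit is found by substitution.\<close>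

lemma subspace_tendsto_hyperplane4:
  assumes "\<beta> \<longlonglongrightarrow> 0"
  shows "subspace_tendsto (\<lambda>i. hyperplane4 \<alpha> (\<beta> i)) (hyperplane4 \<alpha> 0)"
proof -
  have "(\<lambda>i. hyperplane4_projection \<alpha> (\<beta> i) v) \<longlonglongrightarrow> hyperplane4_projection \<alpha> 0 v" for v
  proof -
    have "1 + \<alpha>\<^sup>2 + 0\<^sup>2 \<noteq> 0" by (metis add.right_neutral power_zero_numeral sum_power2_eq_zero_iff one_neq_zero power_one)
    then show ?thesis unfolding hyperplane4_projection_def Let_def by (intro tendsto_intros assms)
  qed
  then show ?thesis
    unfolding subspace_tendsto_def closest_point_hyperplane4 using subspace_hyperplane4 by blast
qed

text \<open>A limit point of \<open>w\<close> has image \<open>F z\<close> and is therefore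
  \<open>z\<close>; boundedness supplies the compactness.\<close>

lemma tendsto_of_proper_injective_at:
  fixes F :: "'a::heine_borel \<Rightarrow> 'b::t2_space"
  assumes cont: "continuous_on UNIV F" and inj: "\<And>z'. F z' = F z \<Longrightarrow> z' = z"
    and lim: "(\<lambda>i. F (w i)) \<longlonglongrightarrow> F z" and bdd: "bounded (range w)"
  shows "w \<longlonglongrightarrow> z"
proof (rule topological_tendstoI)
  fix O' assume O': "open O'" "z \<in> O'"
  let ?C = "closure (range w) - O'"
  have "compact ?C" using bdd O'(1) by (intro compact_diff) (simp_all add: compact_closure)
  then have "compact (F ` ?C)" by (intro compact_continuous_image continuous_on_subset[OF cont]) auto
  then have "open (- (F ` ?C))" by (simp add: compact_imp_closed open_Compl)
  moreover have "F z \<in> - (F ` ?C)"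
  proof
    assume "F z \<in> F ` ?C"
    then obtain z' where "F z = F z'" "z' \<in> ?C" by (rule imageE)
    then show False using inj[of z'] O'(2) by simp
  qed
  ultimately have "\<forall>\<^sub>F i in sequentially. F (w i) \<in> - (F ` ?C)" by (rule topological_tendstoD[OF lim])
  then show "\<forall>\<^sub>F i in sequentially. w i \<in> O'"
  proof (rule eventually_mono)
    fix i assume "F (w i) \<in> - (F ` ?C)"
    moreover have "w i \<in> closure (range w)" by (rule subsetD[OF closure_subset rangeI])
    ultimately show "w i \<in> O'" by blast
  qed
qed

lemma bounded_of_bounded_power:
  fixes y :: "nat \<Rightarrow> complex"
  assumes "bounded (range (\<lambda>i. y i ^ m))" "0 < m"
  shows "bounded (range y)"
proof -
  obtain B where B: "\<And>i. norm (y i ^ m) \<le> B" using assms(1) unfolding bounded_iff by auto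
  have "norm (y i) \<le> 1 + B" for i
  proof (cases "norm (y i) \<le> 1")
    case True
    moreover have "0 \<le> B" using B[of i] norm_ge_zero order_trans by blast
    ultimately show ?thesis by simp
  next
    case False
    then have "norm (y i) \<le> norm (y i) ^ m" using assms(2) by (intro self_le_power) auto
    then show ?thesis using B[of i] by (simp add: norm_power)
  qed
  then show ?thesis unfolding bounded_iff by blast
qed

section \<open>Simple points and the sequence that violates condition (b)\<close>

locale homogeneous_unfolding =
  fixes n m k :: nat
  assumes nmk: "2 \<le> n" "n < m" "m < k" and cop: "coprime n m" "coprime n k" "coprime m k"
begin

definition F :: "C2 \<times> complex \<Rightarrow> C3 \<times> complex"
  where "F p = ((fst (fst p) ^ n + snd p * snd (fst p) ^ n, snd (fst p) ^ m, (fst (fst p) + snd (fst p)) ^ k), snd p)"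

definition dF :: "C2 \<times> complex \<Rightarrow> C2 \<times> complex \<Rightarrow> C3 \<times> complex"
  where "dF p v =
    ((of_nat n * fst (fst p) ^ (n - 1) * fst (fst v) + (snd p * (of_nat n * snd (fst p) ^ (n - 1) * snd (fst v)) + snd v * snd (fst p) ^ n),
      of_nat m * snd (fst p) ^ (m - 1) * snd (fst v),
      of_nat k * (fst (fst p) + snd (fst p)) ^ (k - 1) * (fst (fst v) + snd (fst v))), snd v)"

lemma has_derivative_F: "(F has_derivative dF p) (at p)"
  unfolding F_def [abs_def] dF_def [abs_def]
  by (auto intro!: derivative_eq_intros simp: fun_eq_iff mult_ac)

lemma inj_dF:
  assumes "snd (fst p) \<noteq> 0" "fst (fst p) + snd (fst p) \<noteq> 0"
  shows "inj (dF p)"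
proof (rule injI)
  fix v v' assume eq: "dF p v = dF p v'"
  have t: "snd v = snd v'" using eq by (simp add: dF_def)
  have b: "snd (fst v) = snd (fst v')" using eq assms nmk by (simp add: dF_def)
  have "fst (fst v) + snd (fst v) = fst (fst v') + snd (fst v')" using eq assms nmk by (auto simp: dF_def)
  then have "fst (fst v) = fst (fst v')" unfolding b by simp
  then show "v = v'" using b t by (simp add: prod_eq_iff)
qed

text \<open>The fibres of \<open>(y ^ m, (x + y) ^ k)\<close> are the orbits of \<open>\<mu>\<^sub>m \<times> \<mu>\<^sub>k\<close> acting on \<open>y\<close> and \<open>x + y\<close>, so
  points satisfying these finitely many open conditions are not double points.\<close>

definition simple_points :: "(C2 \<times> complex) set"
  where "simple_points = {p. snd (fst p) \<noteq> 0 \<and> fst (fst p) + snd (fst p) \<noteq> 0 \<and>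
    (\<forall>\<zeta> \<eta>. \<zeta> ^ m = 1 \<longrightarrow> \<eta> ^ k = 1 \<longrightarrow> (\<zeta>, \<eta>) \<noteq> (1, 1) \<longrightarrow>
      (\<eta> * (fst (fst p) + snd (fst p)) - \<zeta> * snd (fst p)) ^ n + snd p * (\<zeta> * snd (fst p)) ^ n
        \<noteq> fst (fst p) ^ n + snd p * snd (fst p) ^ n)}"

lemma simple_points_unique:
  assumes p: "p \<in> simple_points" and eq: "F p' = F p"
  shows "p' = p"
proof -
  have e: "snd p' = snd p" "snd (fst p) ^ m = snd (fst p') ^ m"
    "(fst (fst p) + snd (fst p)) ^ k = (fst (fst p') + snd (fst p')) ^ k"
    "fst (fst p') ^ n + snd p * snd (fst p') ^ n = fst (fst p) ^ n + snd p * snd (fst p) ^ n"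
    using eq by (auto simp: F_def)
  obtain \<zeta> where z: "\<zeta> ^ m = 1" "snd (fst p') = \<zeta> * snd (fst p)"
    using eq_power_imp_root_of_unity[OF e(2)] nmk by auto
  obtain \<eta> where h: "\<eta> ^ k = 1" "fst (fst p') + snd (fst p') = \<eta> * (fst (fst p) + snd (fst p))"
    using eq_power_imp_root_of_unity[OF e(3)] nmk by auto
  have x: "fst (fst p') = \<eta> * (fst (fst p) + snd (fst p)) - \<zeta> * snd (fst p)"
    using h(2) z(2) by (simp add: algebra_simps)
  have "(\<zeta>, \<eta>) = (1, 1)" using p z(1) h(1) e(4) unfolding simple_points_def x z(2) by blast
  then show ?thesis using e(1) z(2) x by (simp add: prod_eq_iff)
qed

lemma open_simple_points: "open simple_points"
proof -
  define B where "B = {\<zeta>::complex. \<zeta> ^ m = 1} \<times> {\<eta>::complex. \<eta> ^ k = 1} - {(1, 1)}"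
  have "finite B"
    unfolding B_def using nmk by (intro finite_Diff finite_cartesian_product finite_roots_unity) auto
  define N where "N = (\<lambda>(\<zeta>, \<eta>). {p :: C2 \<times> complex.
      (\<eta> * (fst (fst p) + snd (fst p)) - \<zeta> * snd (fst p)) ^ n + snd p * (\<zeta> * snd (fst p)) ^ n
        \<noteq> fst (fst p) ^ n + snd p * snd (fst p) ^ n})"
  have "open (N b)" for b
    unfolding N_def by (cases b) (auto intro!: open_Collect_neq continuous_intros)
  then have "open ({p :: C2 \<times> complex. snd (fst p) \<noteq> 0} \<inter> {p. fst (fst p) + snd (fst p) \<noteq> 0} \<inter> (\<Inter>b\<in>B. N b))"
    by (intro open_Int open_INT \<open>finite B\<close> ballI open_Collect_neq continuous_intros)
  moreover have "simple_points = {p :: C2 \<times> complex. snd (fst p) \<noteq> 0} \<inter> {p. fst (fst p) + snd (fst p) \<noteq> 0} \<inter> (\<Inter>b\<in>B. N b)"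
    unfolding simple_points_def B_def N_def by fastforce
  ultimately show ?thesis by simp
qed

lemma simple_points_not_double:
  assumes "p \<in> simple_points"
  shows "p \<notin> double_point_set F U"
proof -
  have "frechet_derivative F (at p) = dF p" using frechet_derivative_at[OF has_derivative_F] by simp
  moreover have "inj (dF p)" using assms by (intro inj_dF) (auto simp: simple_points_def)
  ultimately show ?thesis using simple_points_unique[OF assms] by (auto simp: double_point_set_def)
qed

lemma continuous_F: "continuous_on UNIV F"
  unfolding F_def [abs_def] by (intro continuous_intros)

text \<open>Preimages cannot escape to infinity: the coordinates \<open>t\<close>,
  \<open>y ^ m\<close> and \<open>(x + y) ^ k\<close> of the image control \<open>t\<close>,
  \<open>y\<close> and \<open>x + y\<close>.\<close>

lemma lift_convergence:
  assumes p: "p \<in> simple_points" and lim: "(\<lambda>i. F (w i)) \<longlonglongrightarrow> F p"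
  shows "w \<longlonglongrightarrow> p"
proof (rule tendsto_of_proper_injective_at[OF continuous_F _ lim])
  show "z = p" if "F z = F p" for z using simple_points_unique[OF p that] .
  have bF: "bounded (range (\<lambda>i. F (w i)))" using lim convergent_imp_bounded by blast
  have "bounded (range (\<lambda>i. snd (F (w i))))" "bounded (range (\<lambda>i. fst (snd (fst (F (w i))))))"
    "bounded (range (\<lambda>i. snd (snd (fst (F (w i))))))"
    using bounded_snd[OF bF] bounded_fst[OF bounded_snd[OF bounded_fst[OF bF]]] bounded_snd[OF bounded_snd[OF bounded_fst[OF bF]]]
    by (simp_all add: image_image)
  then have t: "bounded (range (\<lambda>i. snd (w i)))" and "bounded (range (\<lambda>i. snd (fst (w i)) ^ m))"
    "bounded (range (\<lambda>i. (fst (fst (w i)) + snd (fst (w i))) ^ k))"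
    by (simp_all add: F_def)
  then have y: "bounded (range (\<lambda>i. snd (fst (w i))))" and s: "bounded (range (\<lambda>i. fst (fst (w i)) + snd (fst (w i))))"
    using bounded_of_bounded_power nmk by auto
  have x: "bounded (range (\<lambda>i. fst (fst (w i)) + snd (fst (w i)) - snd (fst (w i))))"
    by (rule bounded_minus_comp[OF s y])
  obtain X Y Z where "\<And>i. norm (fst (fst (w i))) \<le> X" "\<And>i. norm (snd (fst (w i))) \<le> Y" "\<And>i. norm (snd (w i)) \<le> Z"
    using x y t unfolding bounded_iff by auto
  then have "norm (w i) \<le> X + Y + Z" for i
    using norm_Pair_le[of "fst (w i)" "snd (w i)"] norm_Pair_le[of "fst (fst (w i))" "snd (fst (w i))"]
    by simp (smt (verit))
  then show "bounded (range w)" unfolding bounded_iff by blast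
qed

lemma tangent_space_F:
  assumes p: "p \<in> simple_points" "p \<in> U" and "open U"
  shows "tangent_space (F ` U - F ` double_point_set F U) (F p) = range (dF p)"
proof (rule tangent_space_image[OF has_derivative_F])
  show "inj (dF p)" using p by (intro inj_dF) (auto simp: simple_points_def)
  show "F ` U - F ` double_point_set F U \<subseteq> range F" by blast
  show "w \<longlonglongrightarrow> p" if "(\<lambda>i. F (w i)) \<longlonglongrightarrow> F p" for w using lift_convergence[OF p(1) that] .
  have "open (simple_points \<inter> U)" using open_simple_points \<open>open U\<close> by blast
  then have "\<forall>\<^sub>F w in nhds p. w \<in> simple_points \<inter> U" using p by (intro eventually_nhds_in_open) auto
  then show "\<forall>\<^sub>F w in nhds p. F w \<in> F ` U - F ` double_point_set F U"
  proof (rule eventually_mono)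
    fix w assume w: "w \<in> simple_points \<inter> U"
    have "F w \<notin> F ` double_point_set F U"
    proof
      assume "F w \<in> F ` double_point_set F U"
      then obtain d where d: "F w = F d" "d \<in> double_point_set F U" by (rule imageE)
      then have "d = w" using simple_points_unique[of w d] w by simp
      then show False using d w simple_points_not_double by blast
    qed
    then show "F w \<in> F ` U - F ` double_point_set F U" using w by blast
  qed
qed

definition axis_point :: "real \<Rightarrow> C2 \<times> complex"
  where "axis_point e = ((0, of_real e), of_real (e ^ (m - n)))"

text \<open>On \<open>x = 0\<close>, \<open>y = e\<close>, division by \<open>e ^ n\<close> turns
  the condition into \<open>(\<eta> - \<zeta>) ^ n \<noteq> t * (1 - \<zeta> ^ n)\<close>. By
  coprimality \<open>\<eta> \<noteq> \<zeta>\<close>, so it holds for all small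
  \<open>t\<close>.\<close>

lemma axis_point_simple:
  obtains e0 where "0 < e0" "\<And>e. 0 < e \<Longrightarrow> e < e0 \<Longrightarrow> axis_point e \<in> simple_points"
proof -
  define B where "B = {\<zeta>::complex. \<zeta> ^ m = 1} \<times> {\<eta>::complex. \<eta> ^ k = 1} - {(1, 1)}"
  have fB: "finite B"
    unfolding B_def using nmk by (intro finite_Diff finite_cartesian_product finite_roots_unity) auto
  have pos: "0 < norm (snd b - fst b) ^ n" if "b \<in> B" for b
  proof -
    have "snd b \<noteq> fst b"
    proof
      assume eq: "snd b = fst b"
      then have "fst b = 1" using that nmk coprime_roots_of_unity[OF cop(3), of "fst b"] by (auto simp: B_def)
      then show False using eq that by (auto simp: B_def prod_eq_iff)
    qed
    then show ?thesis by simp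
  qed
  obtain r where r: "0 < r" "\<And>b. b \<in> B \<Longrightarrow> r \<le> norm (snd b - fst b) ^ n"
    using finite_uniform_lower_bound[OF fB, of "\<lambda>b. norm (snd b - fst b) ^ n"] pos by blast
  show ?thesis
  \<comment> \<open>\<open>e < 1\<close> gives \<open>e ^ (m - n) \<le> e\<close>, and
    \<open>r / 2\<close> compensates \<open>norm (1 - \<zeta> ^ n) \<le> 2\<close>.\<close>
  proof (rule that[of "min 1 (r / 2)"])
    show "0 < min 1 (r / 2)" using r by simp
    fix e :: real assume e: "0 < e" "e < min 1 (r / 2)"
    define t where "t = (of_real (e ^ (m - n)) :: complex)"
    have "e ^ (m - n) \<le> e" using e nmk power_decreasing[of 1 "m - n" e] by simp
    then have t: "norm t < r / 2" using e by (simp add: t_def norm_power del: of_real_power)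
    have "(\<eta> * of_real e - \<zeta> * of_real e) ^ n + t * (\<zeta> * of_real e) ^ n \<noteq> t * of_real e ^ n"
      if "\<zeta> ^ m = 1" "\<eta> ^ k = 1" "(\<zeta>, \<eta>) \<noteq> (1, 1)" for \<zeta> \<eta> :: complex
    proof
      assume eq: "(\<eta> * of_real e - \<zeta> * of_real e) ^ n + t * (\<zeta> * of_real e) ^ n = t * of_real e ^ n"
      have n1: "norm \<zeta> = 1" using norm_root_of_unity[OF that(1)] nmk by simp
      have "(\<eta> * of_real e - \<zeta> * of_real e) ^ n = (\<eta> - \<zeta>) ^ n * of_real e ^ n"
        by (simp add: power_mult_distrib[symmetric] left_diff_distrib)
      then have "((\<eta> - \<zeta>) ^ n) * of_real e ^ n = (t * (1 - \<zeta> ^ n)) * of_real e ^ n"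
        using eq by (simp add: power_mult_distrib algebra_simps)
      then have "(\<eta> - \<zeta>) ^ n = t * (1 - \<zeta> ^ n)" using e by simp
      then have "norm (\<eta> - \<zeta>) ^ n = norm t * norm (1 - \<zeta> ^ n)" by (metis norm_mult norm_power)
      also have "\<dots> \<le> norm t * 2"
        using norm_triangle_ineq4[of 1 "\<zeta> ^ n"] n1 by (intro mult_left_mono) (auto simp: norm_power)
      also have "\<dots> < r" using t by simp
      also have "r \<le> norm (\<eta> - \<zeta>) ^ n" using r(2)[of "(\<zeta>, \<eta>)"] that by (simp add: B_def)
      finally show False by simp
    qed
    then show "axis_point e \<in> simple_points"
      unfolding simple_points_def axis_point_def mem_Collect_eq fst_conv snd_conv t_def[symmetric]
      using e nmk by (simp add: zero_power)
  qed
qed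

text \<open>By \<open>e ^ (m - n) * e ^ (n - 1) = e ^ (m - 1)\<close> the
  \<open>y\<close>-derivatives of the first two coordinates have the ratio \<open>n / m\<close> for
  every \<open>e\<close>. As \<open>2 \<le> n\<close>, the first coordinate has no
  \<open>x\<close>-derivative at \<open>x = 0\<close>; the direction \<open>x\<close> only makes the
  third coordinate free.\<close>

lemma range_dF_axis_point:
  assumes "0 < e"
  shows "range (dF (axis_point e)) = hyperplane4 (real n / real m) (e ^ n)"
proof
  have pw: "e ^ (m - n) * e ^ (n - 1) = e ^ (m - 1)" using nmk by (simp add: power_add[symmetric])
  have pwc: "complex_of_real (e ^ (m - n)) * (of_nat n * of_real e ^ (n - 1) * b) = of_nat n * of_real (e ^ (m - 1)) * b" for b
    unfolding pw[symmetric] by simp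
  have d: "dF (axis_point e) v = ((of_nat n * of_real (e ^ (m - 1)) * snd (fst v) + snd v * of_real e ^ n,
      of_nat m * of_real e ^ (m - 1) * snd (fst v), of_nat k * of_real e ^ (k - 1) * (fst (fst v) + snd (fst v))), snd v)" for v
    using nmk pwc[of "snd (fst v)"] by (simp add: dF_def axis_point_def zero_power)
  have m0: "real m \<noteq> 0" "real k \<noteq> 0" using nmk by auto
  show "range (dF (axis_point e)) \<subseteq> hyperplane4 (real n / real m) (e ^ n)"
    using m0 by (auto simp: d hyperplane4_def scaleR_conv_of_real)
  show "hyperplane4 (real n / real m) (e ^ n) \<subseteq> range (dF (axis_point e))"
  proof
    fix v assume v: "v \<in> hyperplane4 (real n / real m) (e ^ n)"
    define b where "b = fst (snd (fst v)) / (of_nat m * of_real e ^ (m - 1))"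
    define a where "a = snd (snd (fst v)) / (of_nat k * of_real e ^ (k - 1)) - b"
    have "v = dF (axis_point e) ((a, b), snd v)"
      using v m0 assms by (simp add: d hyperplane4_def prod_eq_iff scaleR_conv_of_real a_def b_def)
    then show "v \<in> range (dF (axis_point e))" by blast
  qed
qed

lemma not_whitney_equisingular_F: "\<not> whitney_equisingular F"
proof
  assume "whitney_equisingular F"
  then obtain U V where good: "good_representative F U V"
    and wh: "whitney_b (F ` U - F ` double_point_set F U) (V \<inter> parameter_axis)"
    by (auto simp: whitney_equisingular_def whitney_along_def Let_def)
  have U: "open U" "0 \<in> U" and V: "open V" "0 \<in> V" using good by (auto simp: good_representative_def)
  obtain e0 where e0: "0 < e0" "\<And>e. 0 < e \<Longrightarrow> e < e0 \<Longrightarrow> axis_point e \<in> simple_points"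
    using axis_point_simple by blast
  define s where "s = (\<lambda>i. inverse (real (Suc i)))"
  have s: "s \<longlonglongrightarrow> 0" "\<And>i. 0 < s i" unfolding s_def by (rule LIMSEQ_inverse_real_of_nat, simp)
  have ap: "(\<lambda>i. axis_point (s i)) \<longlonglongrightarrow> 0"
    unfolding axis_point_def zero_prod_def using s(1) nmk
    by (auto intro!: tendsto_eq_intros simp: zero_power)
  have tp: "(\<lambda>i. (0 :: C3, complex_of_real (s i ^ (m - n)))) \<longlonglongrightarrow> 0"
    unfolding zero_prod_def[of] using s(1) nmk by (auto intro!: tendsto_eq_intros simp: zero_power)
  have "\<forall>\<^sub>F i in sequentially. axis_point (s i) \<in> U \<and> (0 :: C3, complex_of_real (s i ^ (m - n))) \<in> V \<and> s i < e0"
    using topological_tendstoD[OF ap U] topological_tendstoD[OF tp V] order_tendstoD(2)[OF s(1) e0(1)]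
    by eventually_elim simp
  then obtain N where N: "\<And>i. N \<le> i \<Longrightarrow> axis_point (s i) \<in> U \<and> (0 :: C3, complex_of_real (s i ^ (m - n))) \<in> V \<and> s i < e0"
    unfolding eventually_sequentially by blast
  \<comment> \<open>The sequences must lie in the given \<open>U\<close> and \<open>V\<close> for
    every index, so an initial segment is dropped.\<close>
  define e where "e = (\<lambda>i. s (i + N))"
  have e: "e \<longlonglongrightarrow> 0" "\<And>i. 0 < e i" "\<And>i. e i < e0"
    using s N by (auto simp: e_def LIMSEQ_ignore_initial_segment)
  define X where "X = F ` U - F ` double_point_set F U"
  define x where "x = (\<lambda>i. F (axis_point (e i)))"
  define y where "y = (\<lambda>i. (0 :: C3, complex_of_real (e i ^ (m - n))))"
  define \<alpha> where "\<alpha> = real n / real m"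
  have simple: "axis_point (e i) \<in> simple_points" "axis_point (e i) \<in> U" for i
    using e0(2)[OF e(2,3)] N[of "i + N"] by (auto simp: e_def)
  have xX: "x i \<in> X" for i
  proof -
    have "x i \<notin> F ` double_point_set F U"
    proof
      assume "x i \<in> F ` double_point_set F U"
      then obtain d where d: "x i = F d" "d \<in> double_point_set F U" by (rule imageE)
      then have "d = axis_point (e i)" using simple_points_unique[OF simple(1)] by (simp add: x_def)
      then show False using d simple_points_not_double[OF simple(1)] by simp
    qed
    then show ?thesis using simple(2) by (auto simp: X_def x_def)
  qed
  have yV: "y i \<in> V \<inter> parameter_axis" for i
    using N[of "i + N"] by (auto simp: y_def e_def parameter_axis_def)
  have xlim: "x \<longlonglongrightarrow> 0"
  proof -
    have "(\<lambda>i. axis_point (e i)) \<longlonglongrightarrow> 0" unfolding e_def by (rule LIMSEQ_ignore_initial_segment[OF ap])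
    moreover have "isCont F 0" using continuous_F by (simp only: continuous_on_eq_continuous_at[OF open_UNIV] ball_UNIV)
    ultimately have "x \<longlonglongrightarrow> F 0" unfolding x_def by (rule isCont_tendsto_compose[rotated])
    moreover have "F 0 = 0" using nmk by (simp add: F_def zero_prod_def zero_power)
    ultimately show ?thesis by simp
  qed
  have ylim: "y \<longlonglongrightarrow> 0" unfolding y_def e_def using LIMSEQ_ignore_initial_segment[OF tp, of N] .
  have tan: "subspace_tendsto (\<lambda>i. tangent_space X (x i)) (hyperplane4 \<alpha> 0)"
  proof -
    have "tangent_space X (x i) = hyperplane4 \<alpha> (e i ^ n)" for i
      unfolding X_def x_def \<alpha>_def using tangent_space_F[OF simple U(1)] range_dF_axis_point[OF e(2)] by simp
    moreover have "(\<lambda>i. e i ^ n) \<longlonglongrightarrow> 0" using e(1) nmk by (auto intro!: tendsto_eq_intros simp: zero_power)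
    ultimately show ?thesis using subspace_tendsto_hyperplane4 by simp
  qed
  \<comment> \<open>The secant divided by \<open>e i ^ m\<close>. Its first two entries agree
    because \<open>t * y ^ n = y ^ m\<close> at \<open>axis_point (e i)\<close>.\<close>
  define u :: "nat \<Rightarrow> C3 \<times> complex" where "u = (\<lambda>i. ((1, 1, complex_of_real (e i ^ (k - m))), 0 :: complex))"
  have xy: "x i - y i = (e i ^ m) *\<^sub>R u i" for i
  proof -
    have "e i ^ (m - n) * e i ^ n = e i ^ m" "e i ^ m * e i ^ (k - m) = e i ^ k"
      using nmk by (simp_all add: power_add[symmetric])
    then show ?thesis
      using nmk by (simp add: x_def y_def u_def F_def axis_point_def zero_power scaleR_conv_of_real
          of_real_power[symmetric] of_real_mult[symmetric] del: of_real_power of_real_mult)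
  qed
  have sgn_xy: "sgn (x i - y i) = sgn (u i)" for i
    unfolding xy sgn_scaleR using e(2)[of i] by simp
  have "u \<longlonglongrightarrow> ((1, 1, 0), 0)"
    unfolding u_def using e(1) nmk by (auto intro!: tendsto_eq_intros simp: zero_power)
  then have "(\<lambda>i. sgn (x i - y i)) \<longlonglongrightarrow> sgn ((1, 1, 0), 0) "
    unfolding sgn_xy by (rule tendsto_sgn) (simp add: zero_prod_def)
  then have "sgn ((1, 1, 0), 0) \<in> hyperplane4 \<alpha> 0"
    using wh[unfolded whitney_b_def X_def[symmetric], rule_format, of x y 0 "hyperplane4 \<alpha> 0" "sgn ((1, 1, 0), 0)"]
      xX yV xlim ylim tan V(2) by (auto simp: parameter_axis_def zero_prod_def)
  \<comment> \<open>A multiple of \<open>(1, 1, 0, 0)\<close> satisfies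
    \<open>X = \<alpha> Y\<close> only for \<open>\<alpha> = 1\<close>, contrary to
    \<open>n < m\<close>.\<close>
  then have "\<alpha> = 1"
    by (simp add: hyperplane4_def sgn_div_norm norm_prod_def)
  then show False using nmk by (simp add: \<alpha>_def)
qed

end


section \<open>Germs of holomorphic functions of two variables\<close>

definition complex_differentiable_at :: "(C2 \<Rightarrow> complex) \<Rightarrow> C2 \<Rightarrow> bool"
  where "complex_differentiable_at g z \<longleftrightarrow> (\<exists>a b. (g has_derivative (\<lambda>(u, v). a * u + b * v)) (at z))"

lemma holomorphic_germ_iff: "holomorphic_germ g \<longleftrightarrow> (\<forall>\<^sub>F z in nhds 0. complex_differentiable_at g z)"
  by (simp add: holomorphic_germ_def complex_differentiable_at_def)

lemma complex_differentiable_atI: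
  assumes "(g has_derivative g') (at z)" "g' = (\<lambda>(u, v). a * u + b * v)"
  shows "complex_differentiable_at g z"
  using assms unfolding complex_differentiable_at_def by blast

lemma complex_differentiable_at_const: "complex_differentiable_at (\<lambda>z. c) z"
  by (rule complex_differentiable_atI[of _ "\<lambda>_. 0" _ 0 0]) (auto simp: fun_eq_iff)

lemma complex_differentiable_at_fst: "complex_differentiable_at fst z"
  by (rule complex_differentiable_atI[of _ fst _ 1 0]) (auto intro!: derivative_eq_intros simp: fun_eq_iff)

lemma complex_differentiable_at_snd: "complex_differentiable_at snd z"
  by (rule complex_differentiable_atI[of _ snd _ 0 1]) (auto intro!: derivative_eq_intros simp: fun_eq_iff)

lemma complex_differentiable_at_add:
  assumes "complex_differentiable_at g z" "complex_differentiable_at h z"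
  shows "complex_differentiable_at (\<lambda>z. g z + h z) z"
proof -
  obtain a b c d where "(g has_derivative (\<lambda>(u, v). a * u + b * v)) (at z)" "(h has_derivative (\<lambda>(u, v). c * u + d * v)) (at z)"
    using assms unfolding complex_differentiable_at_def by blast
  then show ?thesis
    by (intro complex_differentiable_atI[OF has_derivative_add, of g _ z h _ "a + c" "b + d"])
       (auto simp: fun_eq_iff algebra_simps)
qed

lemma complex_differentiable_at_mult:
  assumes "complex_differentiable_at g z" "complex_differentiable_at h z"
  shows "complex_differentiable_at (\<lambda>z. g z * h z) z"
proof -
  obtain a b c d where "(g has_derivative (\<lambda>(u, v). a * u + b * v)) (at z)" "(h has_derivative (\<lambda>(u, v). c * u + d * v)) (at z)"
    using assms unfolding complex_differentiable_at_def by blast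
  then show ?thesis
    by (intro complex_differentiable_atI[OF has_derivative_mult, of g _ z h _ "g z * c + a * h z" "g z * d + b * h z"])
       (auto simp: fun_eq_iff algebra_simps)
qed

lemma complex_differentiable_at_compose:
  assumes "complex_differentiable_at g z" "(f has_field_derivative f') (at (g z))"
  shows "complex_differentiable_at (\<lambda>z. f (g z)) z"
proof -
  obtain a b where "(g has_derivative (\<lambda>(u, v). a * u + b * v)) (at z)"
    using assms(1) unfolding complex_differentiable_at_def by blast
  from has_derivative_compose[OF this assms(2)[unfolded has_field_derivative_def]]
  show ?thesis
    by (rule complex_differentiable_atI[where a = "f' * a" and b = "f' * b"]) (auto simp: fun_eq_iff algebra_simps)
qed

lemma holomorphic_germ_const: "holomorphic_germ (\<lambda>z. c)"
  by (simp add: holomorphic_germ_iff complex_differentiable_at_const)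

lemma holomorphic_germ_fst: "holomorphic_germ fst"
  by (simp add: holomorphic_germ_iff complex_differentiable_at_fst)

lemma holomorphic_germ_snd: "holomorphic_germ snd"
  by (simp add: holomorphic_germ_iff complex_differentiable_at_snd)

lemma holomorphic_germ_add:
  assumes "holomorphic_germ g" "holomorphic_germ h"
  shows "holomorphic_germ (\<lambda>z. g z + h z)"
  using assms unfolding holomorphic_germ_iff
  by eventually_elim (rule complex_differentiable_at_add)

lemma holomorphic_germ_mult:
  assumes "holomorphic_germ g" "holomorphic_germ h"
  shows "holomorphic_germ (\<lambda>z. g z * h z)"
  using assms unfolding holomorphic_germ_iff
  by eventually_elim (rule complex_differentiable_at_mult)

lemma holomorphic_germ_minus:
  assumes "holomorphic_germ g"
  shows "holomorphic_germ (\<lambda>z. - g z)"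
  using holomorphic_germ_mult[OF holomorphic_germ_const[of "-1"] assms] by simp

lemma holomorphic_germ_diff:
  assumes "holomorphic_germ g" "holomorphic_germ h"
  shows "holomorphic_germ (\<lambda>z. g z - h z)"
  using holomorphic_germ_add[OF assms(1) holomorphic_germ_minus[OF assms(2)]] by simp

lemma holomorphic_germ_power:
  assumes "holomorphic_germ g"
  shows "holomorphic_germ (\<lambda>z. g z ^ i)"
  by (induction i) (simp_all add: holomorphic_germ_const holomorphic_germ_mult assms)

lemma holomorphic_germ_sum:
  assumes "\<And>i. i \<in> S \<Longrightarrow> holomorphic_germ (g i)"
  shows "holomorphic_germ (\<lambda>z. \<Sum>i\<in>S. g i z)"
  using assms by (induction S rule: infinite_finite_induct) (simp_all add: holomorphic_germ_const holomorphic_germ_add)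

lemma holomorphic_germ_cong:
  assumes "\<forall>\<^sub>F z in nhds 0. g z = h z"
  shows "holomorphic_germ g \<longleftrightarrow> holomorphic_germ h"
proof -
  have *: "holomorphic_germ h" if "holomorphic_germ g" and ev: "\<forall>\<^sub>F z in nhds 0. g z = h z" for g h
  proof -
    have "\<forall>\<^sub>F z in nhds 0. \<forall>\<^sub>F w in nhds z. g w = h w" using ev by (simp add: eventually_eventually)
    with that(1)[unfolded holomorphic_germ_iff] show ?thesis
      unfolding holomorphic_germ_iff
    proof eventually_elim
      case (elim z)
      then obtain a b where "(g has_derivative (\<lambda>(u, v). a * u + b * v)) (at z)"
        unfolding complex_differentiable_at_def by blast
      moreover have "\<forall>\<^sub>F w in at z. g w = h w" using elim(2) by (simp add: eventually_nhds_conv_at)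
      moreover have "g z = h z" using elim(2) by (rule eventually_nhds_x_imp_x)
      ultimately have "(h has_derivative (\<lambda>(u, v). a * u + b * v)) (at z)"
        by (intro has_derivative_transform_eventually[of g _ z UNIV h]) auto
      then show ?case unfolding complex_differentiable_at_def by blast
    qed
  qed
  show ?thesis using *[of g h] *[of h g] assms by (auto simp: eq_commute)
qed

lemma holomorphic_germ_isCont:
  assumes "holomorphic_germ g"
  shows "isCont g 0"
proof -
  have "complex_differentiable_at g 0"
    using assms unfolding holomorphic_germ_iff by (rule eventually_nhds_x_imp_x)
  then show ?thesis unfolding complex_differentiable_at_def using has_derivative_continuous by blast
qed

lemma holomorphic_germ_eventually_nonzero:
  assumes g: "holomorphic_germ g" and "g 0 \<noteq> 0"
  shows "\<forall>\<^sub>F z in nhds 0. g z \<noteq> 0"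
  using holomorphic_germ_isCont[OF g] assms(2)
  by (intro tendsto_imp_eventually_ne[of g "g 0"]) (simp_all add: continuous_at tendsto_at_iff_tendsto_nhds)

lemma holomorphic_germ_inverse:
  assumes g: "holomorphic_germ g" and "g 0 \<noteq> 0"
  shows "holomorphic_germ (\<lambda>z. inverse (g z))"
proof -
  have "\<forall>\<^sub>F z in nhds 0. g z \<noteq> 0" by (rule holomorphic_germ_eventually_nonzero[OF assms])
  with g[unfolded holomorphic_germ_iff] show ?thesis
    unfolding holomorphic_germ_iff
    by eventually_elim (rule complex_differentiable_at_compose[OF _ DERIV_inverse])
qed

section \<open>Cauchy integrals over a circle\<close>

definition circle_point :: "real \<Rightarrow> real \<Rightarrow> complex"
  where "circle_point r s = of_real r * exp (2 * of_real pi * \<i> * of_real s)"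

lemma norm_circle_point: "0 \<le> r \<Longrightarrow> norm (circle_point r s) = r"
  by (simp add: circle_point_def norm_mult)

lemma continuous_on_circle_point [continuous_intros]:
  "continuous_on A f \<Longrightarrow> continuous_on A (\<lambda>x. circle_point r (f x))"
  unfolding circle_point_def by (intro continuous_intros)

text \<open>With \<open>d\<xi>\<close> written as \<open>2 * pi * \<i> * \<xi> ds\<close>, contour
  integrals become integrals over \<open>cbox 0 1\<close>, to which the theorems on integrals with
  parameters apply.\<close>

lemma has_contour_integral_circle_point:
  assumes "(g has_contour_integral I) (circlepath 0 r)"
  shows "((\<lambda>s. g (circle_point r s) * (2 * of_real pi * \<i> * circle_point r s)) has_integral I) (cbox 0 1)"
proof -
  have "((\<lambda>s. g (circlepath 0 r s) * vector_derivative (circlepath 0 r) (at s within {0..1})) has_integral I) {0..1}"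
    using assms by (simp add: has_contour_integral_def)
  moreover have "circlepath 0 r s = circle_point r s" for s
    by (simp add: circlepath circle_point_def)
  ultimately have "((\<lambda>s. g (circle_point r s) * vector_derivative (circlepath 0 r) (at s within {0..1})) has_integral I) {0..1}"
    by simp
  then have "((\<lambda>s. g (circle_point r s) * (2 * of_real pi * \<i> * circle_point r s)) has_integral I) {0..1}"
    by (rule has_integral_eq[rotated]) (simp add: vector_derivative_circlepath01 circle_point_def)
  then show ?thesis by simp
qed

lemma cauchy_integral_circle_point:
  assumes "f holomorphic_on cball 0 r" "norm w < r"
  shows "((\<lambda>s. f (circle_point r s) / (circle_point r s - w) * circle_point r s) has_integral f w) (cbox 0 1)"
proof -
  have "((\<lambda>u. f u / (u - w)) has_contour_integral (2 * of_real pi * \<i> * f w)) (circlepath 0 r)"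
    using Cauchy_integral_circlepath_simple[OF assms(1), of w] assms(2) by simp
  from has_integral_divide[OF has_contour_integral_circle_point[OF this], of "2 * of_real pi * \<i>"]
  show ?thesis by simp
qed

lemma cauchy_derivative_circle_point:
  assumes "f holomorphic_on cball 0 r" "norm w < r"
  shows "deriv f w = integral (cbox 0 1) (\<lambda>s. f (circle_point r s) / (circle_point r s - w)\<^sup>2 * circle_point r s)"
proof -
  have f: "continuous_on (cball 0 r) f" "f holomorphic_on ball 0 r" "w \<in> ball 0 r"
    using assms holomorphic_on_imp_continuous_on holomorphic_on_subset[OF assms(1) ball_subset_cball] by auto
  let ?I = "contour_integral (circlepath 0 r) (\<lambda>u. f u / (u - w)\<^sup>2)"
  have "((\<lambda>u. f u / (u - w)\<^sup>2) has_contour_integral ?I) (circlepath 0 r)"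
    using Cauchy_derivative_integral_circlepath(1)[OF f] by (rule has_contour_integral_integral)
  from has_integral_divide[OF has_contour_integral_circle_point[OF this], of "2 * of_real pi * \<i>"]
  have "((\<lambda>s. f (circle_point r s) / (circle_point r s - w)\<^sup>2 * circle_point r s) has_integral ?I / (2 * of_real pi * \<i>)) (cbox 0 1)"
    by simp
  moreover have "deriv f w = 1 / (2 * of_real pi * \<i>) * ?I"
    using Cauchy_derivative_integral_circlepath(2)[OF f] by (rule DERIV_imp_deriv)
  ultimately show ?thesis by (simp add: integral_unique)
qed

lemma complex_differentiable_at_partial:
  assumes "complex_differentiable_at g (x, y)"
  shows "(\<lambda>u. g (u, y)) field_differentiable (at x)" "(\<lambda>v. g (x, v)) field_differentiable (at y)"
proof -
  obtain a b where g: "(g has_derivative (\<lambda>(u, v). a * u + b * v)) (at (x, y))"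
    using assms unfolding complex_differentiable_at_def by blast
  have "((\<lambda>u. g (u, y)) has_derivative (\<lambda>u. case (u, 0) of (u, v) \<Rightarrow> a * u + b * v)) (at x)"
    by (rule has_derivative_compose[of "\<lambda>u. (u, y)"]) (auto intro!: derivative_eq_intros g)
  then show "(\<lambda>u. g (u, y)) field_differentiable (at x)"
    unfolding field_differentiable_def has_field_derivative_def by (intro exI[of _ a]) simp
  have "((\<lambda>v. g (x, v)) has_derivative (\<lambda>v. case (0, v) of (u, v) \<Rightarrow> a * u + b * v)) (at y)"
    by (rule has_derivative_compose[of "\<lambda>v. (x, v)"]) (auto intro!: derivative_eq_intros g)
  then show "(\<lambda>v. g (x, v)) field_differentiable (at y)"
    unfolding field_differentiable_def has_field_derivative_def by (intro exI[of _ b]) simp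
qed

text \<open>The quotient \<open>(h (x, y) - h (0, y)) / x\<close> is the Cauchy-type integral
  \<open>\<integral> h (\<xi>, y) / (\<xi> - x)\<close> over the circle, which shows that it is holomorphic at \<open>x = 0\<close> too.\<close>

lemma holomorphic_germ_division_fst:
  assumes h: "holomorphic_germ h"
  obtains a where "holomorphic_germ a" "\<forall>\<^sub>F z in nhds 0. h z = h (0, snd z) + fst z * a z"
proof -
  obtain S where S: "open S" "0 \<in> S" "\<And>z. z \<in> S \<Longrightarrow> complex_differentiable_at h z"
    using h unfolding holomorphic_germ_iff eventually_nhds by blast
  obtain A B where AB: "open A" "open B" "(0, 0) \<in> A \<times> B" "A \<times> B \<subseteq> S"
    using open_prod_elim[OF S(1), of "(0, 0)"] S(2) by (metis zero_prod_def)
  obtain ra rb where rab: "0 < ra" "ball 0 ra \<subseteq> A" "0 < rb" "ball 0 rb \<subseteq> B"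
    using AB(1-3) unfolding open_contains_ball by (metis mem_Sigma_iff)
  define r where "r = min ra rb / 2"
  have r: "0 < r" using rab by (simp add: r_def)
  have diff: "complex_differentiable_at h (x, y)" if "norm x \<le> r" "norm y \<le> r" for x y
  proof (rule S(3))
    have "x \<in> A" "y \<in> B" using that rab by (auto simp: r_def subset_iff)
    then show "(x, y) \<in> S" using AB(4) by blast
  qed
  have cont: "continuous_on (cball 0 r \<times> cball 0 r) h"
  proof -
    have "isCont h z" if "z \<in> cball 0 r \<times> cball 0 r" for z
    proof -
      have "complex_differentiable_at h z" using that diff[of "fst z" "snd z"] by auto
      then show ?thesis unfolding complex_differentiable_at_def using has_derivative_continuous by blast
    qed
    then show ?thesis by (simp add: continuous_at_imp_continuous_on)
  qed
  have hol1: "(\<lambda>u. h (u, y)) holomorphic_on cball 0 r" if "norm y \<le> r" for y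
    unfolding holomorphic_on_def
    using complex_differentiable_at_partial(1)[OF diff] that by (auto intro: field_differentiable_at_within)
  have hol2: "(\<lambda>v. h (x, v)) holomorphic_on cball 0 r" if "norm x \<le> r" for x
    unfolding holomorphic_on_def
    using complex_differentiable_at_partial(2)[OF diff] that by (auto intro: field_differentiable_at_within)
  \<comment> \<open>Differentiation under the integral needs \<open>hy\<close> to be continuous in
    both variables jointly, which its representation as a Cauchy integral provides.\<close>
  define hy where "hy = (\<lambda>z. deriv (\<lambda>v. h (fst z, v)) (snd z))"
  have cr: "norm (circle_point r s) = r" for s using r by (simp add: norm_circle_point)
  have ne: "circle_point r s - w \<noteq> 0" if "norm w < r" for s w using cr[of s] that by auto
  have hy_eq: "hy z = integral (cbox 0 1) (\<lambda>s. h (fst z, circle_point r s) / (circle_point r s - snd z)\<^sup>2 * circle_point r s)"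
    if "z \<in> cball 0 r \<times> ball 0 r" for z
    unfolding hy_def using that by (intro cauchy_derivative_circle_point hol2) auto
  have conthy: "continuous_on (cball 0 r \<times> ball 0 r) hy"
  proof -
    have "continuous_on ((cball 0 r \<times> ball 0 r) \<times> cbox 0 1) (\<lambda>p. h (fst (fst p), circle_point r (snd p)))"
      by (rule continuous_on_compose2[OF cont]) (auto intro!: continuous_intros simp: cr)
    then have "continuous_on ((cball 0 r \<times> ball 0 r) \<times> cbox 0 1)
      (\<lambda>(z, s). h (fst z, circle_point r s) / (circle_point r s - snd z)\<^sup>2 * circle_point r s)"
      unfolding split_beta by (intro continuous_intros) (use ne in auto)
    then have "continuous_on (cball 0 r \<times> ball 0 r)
      (\<lambda>z. integral (cbox 0 1) (\<lambda>s. h (fst z, circle_point r s) / (circle_point r s - snd z)\<^sup>2 * circle_point r s))"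
      by (rule integral_continuous_on_param)
    then show ?thesis by (rule continuous_on_eq) (use hy_eq in auto)
  qed
  define U where "U = (ball 0 r \<times> ball 0 r :: C2 set)"
  have U: "open U" "convex U" "0 \<in> U" using r by (auto simp: U_def open_Times convex_Times zero_prod_def)
  \<comment> \<open>As \<open>ds\<close> is \<open>d\<xi> / (2 * pi * \<i> * \<xi>)\<close>, the
    integral of \<open>f z\<close> is the contour integral of
    \<open>h (\<xi>, y) / (\<xi> * (\<xi> - x))\<close> divided by
    \<open>2 * pi * \<i>\<close>.\<close>
  define f where "f = (\<lambda>z s. h (circle_point r s, snd z) / (circle_point r s - fst z))"
  define a where "a = (\<lambda>z. integral (cbox 0 1) (f z))"
  define p where "p = (\<lambda>z s. h (circle_point r s, snd z) / (circle_point r s - fst z)\<^sup>2)"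
  define q where "q = (\<lambda>z s. hy (circle_point r s, snd z) / (circle_point r s - fst z))"
  define Df where "Df = (\<lambda>z s. (blinfun_mult_right (p z s) o\<^sub>L Blinfun fst) + (blinfun_mult_right (q z s) o\<^sub>L Blinfun snd))"
  have Df: "blinfun_apply (Df z s) = (\<lambda>(u, v). p z s * u + q z s * v)" for z s
    by (auto simp: Df_def fun_eq_iff blinfun.add_left bounded_linear_Blinfun_apply bounded_linear_fst bounded_linear_snd)
  have conth: "continuous_on (U \<times> cbox 0 1) (\<lambda>w. h (circle_point r (snd w), snd (fst w)))"
    by (rule continuous_on_compose2[OF cont]) (auto intro!: continuous_intros simp: cr U_def)
  have conthy': "continuous_on (U \<times> cbox 0 1) (\<lambda>w. hy (circle_point r (snd w), snd (fst w)))"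
    by (rule continuous_on_compose2[OF conthy]) (auto intro!: continuous_intros simp: cr U_def)
  have contf: "continuous_on (U \<times> cbox 0 1) (\<lambda>w. f (fst w) (snd w))"
    unfolding f_def by (intro continuous_intros conth) (use ne in \<open>auto simp: U_def\<close>)
  have contp: "continuous_on (U \<times> cbox 0 1) (\<lambda>w. p (fst w) (snd w))"
    unfolding p_def by (intro continuous_intros conth) (use ne in \<open>auto simp: U_def\<close>)
  have contq: "continuous_on (U \<times> cbox 0 1) (\<lambda>w. q (fst w) (snd w))"
    unfolding q_def by (intro continuous_intros conthy') (use ne in \<open>auto simp: U_def\<close>)
  have slice: "continuous_on (cbox 0 1) (g z)" if "continuous_on (U \<times> cbox 0 1) (\<lambda>w. g (fst w) (snd w))" "z \<in> U"
    for g :: "C2 \<Rightarrow> real \<Rightarrow> complex" and z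
  proof -
    have "continuous_on (cbox 0 1) (\<lambda>s. (\<lambda>w. g (fst w) (snd w)) (z, s))"
      by (rule continuous_on_compose2[OF that(1)]) (use that(2) in \<open>auto intro!: continuous_intros\<close>)
    then show ?thesis by simp
  qed
  have "complex_differentiable_at a z" if z: "z \<in> U" for z
  proof -
    have "(a has_derivative integral (cbox 0 1) (Df z)) (at z within U)"
      unfolding a_def
    proof (rule leibniz_rule[OF _ _ _ z U(2)])
      show "f w integrable_on cbox 0 1" if "w \<in> U" for w
        by (rule integrable_continuous[OF slice[OF contf that]])
      show "continuous_on (U \<times> cbox 0 1) (\<lambda>(w, s). Df w s)"
        unfolding Df_def split_beta
        by (intro continuous_intros bounded_linear.continuous_on[OF bounded_linear_blinfun_mult_right] contp contq)
      fix w s assume w: "w \<in> U"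
      have "(\<lambda>v. h (circle_point r s, v)) field_differentiable at (snd w)"
        using w by (intro complex_differentiable_at_partial(2) diff) (auto simp: cr U_def)
      then have "((\<lambda>v. h (circle_point r s, v)) has_field_derivative hy (circle_point r s, snd w)) (at (snd w))"
        by (simp add: hy_def DERIV_deriv_iff_field_differentiable)
      then have "((\<lambda>v. h (circle_point r s, v)) has_derivative (\<lambda>v. hy (circle_point r s, snd w) * v)) (at (snd w))"
        by (simp add: has_field_derivative_def)
      from has_derivative_compose[OF has_derivative_snd[OF has_derivative_ident] this]
      have hd: "((\<lambda>w. h (circle_point r s, snd w)) has_derivative (\<lambda>v. hy (circle_point r s, snd w) * snd v)) (at w)"
        by simp
      have nw: "circle_point r s - fst w \<noteq> 0" using ne w by (auto simp: U_def)
      have gd: "((\<lambda>w. circle_point r s - fst w) has_derivative (\<lambda>v. - fst v)) (at w)"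
        by (auto intro!: derivative_eq_intros)
      define c where "c = circle_point r s - fst w"
      have eq: "(x * v * c - y * - u) / (c * c) = y / c\<^sup>2 * u + x / c * v" for x y u v
        using nw by (simp add: c_def[symmetric] power2_eq_square field_simps)
      have "((\<lambda>w. f w s) has_derivative blinfun_apply (Df w s)) (at w)"
        unfolding f_def Df
        by (rule has_derivative_eq_rhs[OF has_derivative_divide'[OF hd gd nw]])
           (simp add: fun_eq_iff p_def q_def c_def[symmetric] eq[simplified])
      then show "((\<lambda>w. f w s) has_derivative blinfun_apply (Df w s)) (at w within U)"
        by (rule has_derivative_at_withinI)
    qed
    then have "(a has_derivative integral (cbox 0 1) (Df z)) (at z)" using at_within_open[OF z U(1)] by simp
    moreover have "blinfun_apply (integral (cbox 0 1) (Df z)) = (\<lambda>(u, v). integral (cbox 0 1) (p z) * u + integral (cbox 0 1) (q z) * v)"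
    proof
      fix w
      have int: "p z integrable_on cbox 0 1" "q z integrable_on cbox 0 1"
        by (intro integrable_continuous slice[OF contp z] slice[OF contq z])+
      have "Df z integrable_on cbox 0 1"
      proof (rule integrable_continuous)
        show "continuous_on (cbox 0 1) (Df z)"
          unfolding Df_def
          by (intro continuous_intros bounded_linear.continuous_on[OF bounded_linear_blinfun_mult_right] slice[OF contp z] slice[OF contq z])
      qed
      then have "blinfun_apply (integral (cbox 0 1) (Df z)) w = integral (cbox 0 1) (\<lambda>s. blinfun_apply (Df z s) w)"
        by (rule blinfun_apply_integral)
      also have "\<dots> = integral (cbox 0 1) (\<lambda>s. p z s * fst w + q z s * snd w)"
        by (simp add: Df split_beta)
      also have "\<dots> = integral (cbox 0 1) (p z) * fst w + integral (cbox 0 1) (q z) * snd w"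
        using int by (simp add: integral_add integrable_on_mult_left)
      finally show "blinfun_apply (integral (cbox 0 1) (Df z)) w
          = (case w of (u, v) \<Rightarrow> integral (cbox 0 1) (p z) * u + integral (cbox 0 1) (q z) * v)"
        by (simp add: split_beta)
    qed
    ultimately show ?thesis by (intro complex_differentiable_atI) auto
  qed
  moreover have evU: "\<forall>\<^sub>F z in nhds 0. z \<in> U" using U by (intro eventually_nhds_in_open)
  ultimately have "holomorphic_germ a" unfolding holomorphic_germ_iff by (auto elim: eventually_mono)
  moreover have "h z = h (0, snd z) + fst z * a z" if z: "z \<in> U" for z
  proof -
    have xy: "norm (fst z) < r" "norm (snd z) \<le> r" using z by (auto simp: U_def)
    \<comment> \<open>Cauchy's formula at \<open>x\<close> minus that at 0, with
      \<open>\<xi> / (\<xi> - x) - 1 = x / (\<xi> - x)\<close>.\<close>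
    note I = cauchy_integral_circle_point[OF hol1[OF xy(2)]]
    have "((\<lambda>s. h (circle_point r s, snd z) / (circle_point r s - fst z) * circle_point r s
        - h (circle_point r s, snd z) / (circle_point r s - 0) * circle_point r s) has_integral h z - h (0, snd z)) (cbox 0 1)"
      using has_integral_diff[OF I[OF xy(1)] I[of 0]] r by simp
    moreover have "h (circle_point r s, snd z) / (circle_point r s - fst z) * circle_point r s
        - h (circle_point r s, snd z) / (circle_point r s - 0) * circle_point r s = fst z * f z s" for s
      using ne[of 0 s] ne[OF xy(1), of s] r by (simp add: f_def field_simps)
    ultimately have "((\<lambda>s. fst z * f z s) has_integral h z - h (0, snd z)) (cbox 0 1)" by simp
    moreover have "((\<lambda>s. fst z * f z s) has_integral fst z * a z) (cbox 0 1)"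
      unfolding a_def using integrable_continuous[OF slice[OF contf z]]
      by (intro has_integral_mult_right integrable_integral)
    ultimately have "h z - h (0, snd z) = fst z * a z" by (rule has_integral_unique)
    then show ?thesis by (simp add: algebra_simps)
  qed
  then have "\<forall>\<^sub>F z in nhds 0. h z = h (0, snd z) + fst z * a z" using evU by (auto elim: eventually_mono)
  ultimately show ?thesis using that by blast
qed

lemma filterlim_swap_nhds: "filterlim (\<lambda>z :: C2. (snd z, fst z)) (nhds 0) (nhds 0)"
proof -
  have "isCont (\<lambda>z :: C2. (snd z, fst z)) 0" by (intro continuous_intros)
  then show ?thesis
    using tendsto_at_iff_tendsto_nhds[of "\<lambda>z :: C2. (snd z, fst z)" 0]
    by (simp add: isCont_def zero_prod_def[symmetric])
qed

lemma holomorphic_germ_swap: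
  assumes "holomorphic_germ h"
  shows "holomorphic_germ (\<lambda>z. h (snd z, fst z))"
proof -
  have "\<forall>\<^sub>F z :: C2 in nhds 0. complex_differentiable_at h (snd z, fst z)"
    by (rule eventually_compose_filterlim[OF assms[unfolded holomorphic_germ_iff] filterlim_swap_nhds])
  then show ?thesis
    unfolding holomorphic_germ_iff
  proof eventually_elim
    case (elim z)
    then obtain a b where "(h has_derivative (\<lambda>(u, v). a * u + b * v)) (at (snd z, fst z))"
      unfolding complex_differentiable_at_def by blast
    then have "((\<lambda>z. h (snd z, fst z)) has_derivative (\<lambda>w. case (snd w, fst w) of (u, v) \<Rightarrow> a * u + b * v)) (at z)"
      by (rule has_derivative_compose[rotated]) (auto intro!: derivative_eq_intros)
    then show ?case by (rule complex_differentiable_atI[where a = b and b = a]) (auto simp: fun_eq_iff)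
  qed
qed

text \<open>Division by \<open>x\<close> leaves \<open>h (0, y)\<close>, which is a germ again;
  exchanging the variables allows the same division by \<open>y\<close>.\<close>

lemma hadamard_decomposition:
  assumes h: "holomorphic_germ h"
  obtains a b where "holomorphic_germ a" "holomorphic_germ b"
    "\<forall>\<^sub>F z in nhds 0. h z = h 0 + fst z * a z + snd z * b z"
proof -
  obtain a where a: "holomorphic_germ a" "\<forall>\<^sub>F z in nhds 0. h z = h (0, snd z) + fst z * a z"
    using holomorphic_germ_division_fst[OF h] by blast
  have "holomorphic_germ (\<lambda>z. h z - fst z * a z)"
    by (intro holomorphic_germ_diff h holomorphic_germ_mult holomorphic_germ_fst a)
  moreover have "\<forall>\<^sub>F z in nhds 0. h z - fst z * a z = h (0, snd z)" using a(2) by eventually_elim simp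
  ultimately have "holomorphic_germ (\<lambda>z. h (0, snd z))"
    by (rule holomorphic_germ_cong[THEN iffD1, rotated])
  from holomorphic_germ_swap[OF this] have "holomorphic_germ (\<lambda>z. h (0, fst z))" by simp
  then obtain b where b: "holomorphic_germ b" "\<forall>\<^sub>F z in nhds 0. h (0, fst z) = h (0, 0) + fst z * b z"
    by (rule holomorphic_germ_division_fst) (rule that, simp_all)
  have "\<forall>\<^sub>F z :: C2 in nhds 0. h (0, snd z) = h (0, 0) + snd z * b (snd z, fst z)"
    using eventually_compose_filterlim[OF b(2) filterlim_swap_nhds] by simp
  with a(2) have "\<forall>\<^sub>F z in nhds 0. h z = h 0 + fst z * a z + snd z * b (snd z, fst z)"
    by eventually_elim (simp add: zero_prod_def)
  then show ?thesis by (rule that[OF a(1) holomorphic_germ_swap[OF b(1)]])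
qed

section \<open>Ideals of germs and powers of the maximal ideal\<close>

definition germ_ideal :: "(C2 \<Rightarrow> complex) \<Rightarrow> (C2 \<Rightarrow> complex) \<Rightarrow> (C2 \<Rightarrow> complex) set"
  where "germ_ideal P Q = {h. \<exists>p q. holomorphic_germ p \<and> holomorphic_germ q \<and>
    (\<forall>\<^sub>F z in nhds 0. h z = p z * P z + q z * Q z)}"

lemma jacobian_ideal_eq: "jacobian_ideal g = germ_ideal (partial_x g) (partial_y g)"
  by (simp add: jacobian_ideal_def germ_ideal_def)

lemma germ_ideal_cong:
  assumes "h \<in> germ_ideal P Q" "\<forall>\<^sub>F z in nhds 0. h' z = h z"
  shows "h' \<in> germ_ideal P Q"
proof -
  obtain p q where "holomorphic_germ p" "holomorphic_germ q" "\<forall>\<^sub>F z in nhds 0. h z = p z * P z + q z * Q z"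
    using assms(1) by (auto simp: germ_ideal_def)
  moreover from this(3) assms(2) have "\<forall>\<^sub>F z in nhds 0. h' z = p z * P z + q z * Q z" by eventually_elim simp
  ultimately show ?thesis by (auto simp: germ_ideal_def)
qed

lemma germ_ideal_add:
  assumes "h \<in> germ_ideal P Q" "h' \<in> germ_ideal P Q"
  shows "(\<lambda>z. h z + h' z) \<in> germ_ideal P Q"
proof -
  obtain p q where 1: "holomorphic_germ p" "holomorphic_germ q" "\<forall>\<^sub>F z in nhds 0. h z = p z * P z + q z * Q z"
    using assms(1) by (auto simp: germ_ideal_def)
  obtain p' q' where 2: "holomorphic_germ p'" "holomorphic_germ q'" "\<forall>\<^sub>F z in nhds 0. h' z = p' z * P z + q' z * Q z"
    using assms(2) by (auto simp: germ_ideal_def)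
  have "\<forall>\<^sub>F z in nhds 0. h z + h' z = (p z + p' z) * P z + (q z + q' z) * Q z"
    using 1(3) 2(3) by eventually_elim (simp add: algebra_simps)
  then show ?thesis using holomorphic_germ_add 1 2 unfolding germ_ideal_def by blast
qed

lemma germ_ideal_mult:
  assumes "h \<in> germ_ideal P Q" "holomorphic_germ a"
  shows "(\<lambda>z. a z * h z) \<in> germ_ideal P Q"
proof -
  obtain p q where 1: "holomorphic_germ p" "holomorphic_germ q" "\<forall>\<^sub>F z in nhds 0. h z = p z * P z + q z * Q z"
    using assms(1) by (auto simp: germ_ideal_def)
  have "\<forall>\<^sub>F z in nhds 0. a z * h z = (a z * p z) * P z + (a z * q z) * Q z"
    using 1(3) by eventually_elim (simp add: algebra_simps)
  then show ?thesis using holomorphic_germ_mult[OF assms(2)] 1 unfolding germ_ideal_def by blast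
qed

lemma germ_ideal_cmult: "h \<in> germ_ideal P Q \<Longrightarrow> (\<lambda>z. c * h z) \<in> germ_ideal P Q"
  by (rule germ_ideal_mult[OF _ holomorphic_germ_const])

lemma germ_ideal_zero: "(\<lambda>z. 0) \<in> germ_ideal P Q"
  unfolding germ_ideal_def using holomorphic_germ_const[of 0]
  by (intro CollectI exI[of _ "\<lambda>z. 0"]) simp

lemma germ_ideal_sum:
  assumes "\<And>i. i \<in> S \<Longrightarrow> h i \<in> germ_ideal P Q"
  shows "(\<lambda>z. \<Sum>i\<in>S. h i z) \<in> germ_ideal P Q"
  using assms by (induction S rule: infinite_finite_induct) (simp_all add: germ_ideal_zero germ_ideal_add)

lemma germ_ideal_gens: "P \<in> germ_ideal P Q" "Q \<in> germ_ideal P Q"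
proof -
  have "\<forall>\<^sub>F z in nhds 0. P z = (\<lambda>z. 1) z * P z + (\<lambda>z. 0) z * Q z"
    "\<forall>\<^sub>F z in nhds 0. Q z = (\<lambda>z. 0) z * P z + (\<lambda>z. 1) z * Q z" by simp_all
  then show "P \<in> germ_ideal P Q" "Q \<in> germ_ideal P Q"
    unfolding germ_ideal_def using holomorphic_germ_const by blast+
qed

text \<open>The \<open>d\<close>-th power of the maximal ideal of the ring of germs.\<close>

definition max_power :: "nat \<Rightarrow> (C2 \<Rightarrow> complex) set"
  where "max_power d = {h. \<exists>a. (\<forall>i\<le>d. holomorphic_germ (a i)) \<and>
    (\<forall>\<^sub>F z in nhds 0. h z = (\<Sum>i\<le>d. fst z ^ i * snd z ^ (d - i) * a i z))}"

lemma max_power_cong: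
  assumes "h \<in> max_power d" "\<forall>\<^sub>F z in nhds 0. h' z = h z"
  shows "h' \<in> max_power d"
proof -
  obtain a where "\<forall>i\<le>d. holomorphic_germ (a i)" "\<forall>\<^sub>F z in nhds 0. h z = (\<Sum>i\<le>d. fst z ^ i * snd z ^ (d - i) * a i z)"
    using assms(1) by (auto simp: max_power_def)
  moreover from this(2) assms(2)
  have "\<forall>\<^sub>F z in nhds 0. h' z = (\<Sum>i\<le>d. fst z ^ i * snd z ^ (d - i) * a i z)" by eventually_elim simp
  ultimately show ?thesis by (auto simp: max_power_def)
qed

lemma max_power_add:
  assumes "h \<in> max_power d" "h' \<in> max_power d"
  shows "(\<lambda>z. h z + h' z) \<in> max_power d"
proof -
  obtain a where 1: "\<forall>i\<le>d. holomorphic_germ (a i)" "\<forall>\<^sub>F z in nhds 0. h z = (\<Sum>i\<le>d. fst z ^ i * snd z ^ (d - i) * a i z)"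
    using assms(1) by (auto simp: max_power_def)
  obtain b where 2: "\<forall>i\<le>d. holomorphic_germ (b i)" "\<forall>\<^sub>F z in nhds 0. h' z = (\<Sum>i\<le>d. fst z ^ i * snd z ^ (d - i) * b i z)"
    using assms(2) by (auto simp: max_power_def)
  have "\<forall>\<^sub>F z in nhds 0. h z + h' z = (\<Sum>i\<le>d. fst z ^ i * snd z ^ (d - i) * (a i z + b i z))"
    using 1(2) 2(2) by eventually_elim (simp add: distrib_left sum.distrib)
  then show ?thesis using 1 2 unfolding max_power_def
    by (intro CollectI exI[of _ "\<lambda>i z. a i z + b i z"]) (simp add: holomorphic_germ_add)
qed

lemma max_power_mult_germ:
  assumes "h \<in> max_power d" "holomorphic_germ g"
  shows "(\<lambda>z. g z * h z) \<in> max_power d"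
proof -
  obtain a where 1: "\<forall>i\<le>d. holomorphic_germ (a i)" "\<forall>\<^sub>F z in nhds 0. h z = (\<Sum>i\<le>d. fst z ^ i * snd z ^ (d - i) * a i z)"
    using assms(1) by (auto simp: max_power_def)
  have "\<forall>\<^sub>F z in nhds 0. g z * h z = (\<Sum>i\<le>d. fst z ^ i * snd z ^ (d - i) * (g z * a i z))"
    using 1(2) by eventually_elim (simp add: sum_distrib_left mult_ac)
  then show ?thesis using 1 assms(2) unfolding max_power_def
    by (intro CollectI exI[of _ "\<lambda>i z. g z * a i z"]) (simp add: holomorphic_germ_mult)
qed

lemma max_power_zero: "(\<lambda>z. 0) \<in> max_power d"
  unfolding max_power_def by (intro CollectI exI[of _ "\<lambda>i z. 0"]) (simp add: holomorphic_germ_const)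

lemma max_power_sum:
  assumes "\<And>i. i \<in> S \<Longrightarrow> h i \<in> max_power d"
  shows "(\<lambda>z. \<Sum>i\<in>S. h i z) \<in> max_power d"
  using assms by (induction S rule: infinite_finite_induct) (simp_all add: max_power_zero max_power_add)

lemma max_power_minus: "h \<in> max_power d \<Longrightarrow> (\<lambda>z. - h z) \<in> max_power d"
  using max_power_mult_germ[OF _ holomorphic_germ_const[of "-1"]] by fastforce

lemma max_power_diff:
  assumes "h \<in> max_power d" "h' \<in> max_power d"
  shows "(\<lambda>z. h z - h' z) \<in> max_power d"
  using max_power_add[OF assms(1) max_power_minus[OF assms(2)]] by simp

lemma holomorphic_germ_max_power:
  assumes "h \<in> max_power d"
  shows "holomorphic_germ h"
proof -
  obtain a where 1: "\<forall>i\<le>d. holomorphic_germ (a i)" "\<forall>\<^sub>F z in nhds 0. h z = (\<Sum>i\<le>d. fst z ^ i * snd z ^ (d - i) * a i z)"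
    using assms by (auto simp: max_power_def)
  have "holomorphic_germ (\<lambda>z. \<Sum>i\<le>d. fst z ^ i * snd z ^ (d - i) * a i z)"
    using 1(1) by (intro holomorphic_germ_sum holomorphic_germ_mult holomorphic_germ_power holomorphic_germ_fst holomorphic_germ_snd) simp
  then show ?thesis using holomorphic_germ_cong[OF 1(2)] by simp
qed

lemma max_power_monomial:
  assumes "holomorphic_germ g" "i + j = d"
  shows "(\<lambda>z. fst z ^ i * snd z ^ j * g z) \<in> max_power d"
proof -
  define a where "a = (\<lambda>l. if l = i then g else (\<lambda>z. 0))"
  have a: "fst z ^ i * snd z ^ j * g z = (\<Sum>l\<le>d. fst z ^ l * snd z ^ (d - l) * a l z)" for z :: C2
  proof -
    have "(\<Sum>l\<le>d. fst z ^ l * snd z ^ (d - l) * a l z) = (\<Sum>l\<in>{i}. fst z ^ l * snd z ^ (d - l) * a l z)"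
      using assms(2) by (intro sum.mono_neutral_right) (auto simp: a_def)
    then show ?thesis using assms(2) by (auto simp: a_def)
  qed
  have "holomorphic_germ (a l)" for l
    using assms(1) by (simp add: a_def holomorphic_germ_const)
  then show ?thesis unfolding max_power_def a by (intro CollectI exI[of _ a]) simp
qed

lemma max_power_0: "holomorphic_germ h \<Longrightarrow> h \<in> max_power 0"
  using max_power_monomial[of h 0 0 0] by simp

lemma max_power_mult:
  assumes "h \<in> max_power d" "h' \<in> max_power e"
  shows "(\<lambda>z. h z * h' z) \<in> max_power (d + e)"
proof -
  obtain a where 1: "\<forall>i\<le>d. holomorphic_germ (a i)" "\<forall>\<^sub>F z in nhds 0. h z = (\<Sum>i\<le>d. fst z ^ i * snd z ^ (d - i) * a i z)"
    using assms(1) by (auto simp: max_power_def)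
  obtain b where 2: "\<forall>i\<le>e. holomorphic_germ (b i)" "\<forall>\<^sub>F z in nhds 0. h' z = (\<Sum>i\<le>e. fst z ^ i * snd z ^ (e - i) * b i z)"
    using assms(2) by (auto simp: max_power_def)
  have "(\<lambda>z. \<Sum>i\<le>d. \<Sum>j\<le>e. fst z ^ (i + j) * snd z ^ ((d - i) + (e - j)) * (a i z * b j z)) \<in> max_power (d + e)"
    using 1(1) 2(1) by (intro max_power_sum max_power_monomial holomorphic_germ_mult) auto
  moreover have "\<forall>\<^sub>F z in nhds 0. h z * h' z
      = (\<Sum>i\<le>d. \<Sum>j\<le>e. fst z ^ (i + j) * snd z ^ ((d - i) + (e - j)) * (a i z * b j z))"
    using 1(2) 2(2) by eventually_elim (simp only: sum_product power_add mult_ac)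
  ultimately show ?thesis by (rule max_power_cong)
qed

lemma max_power_fst: "fst \<in> max_power 1"
  using max_power_monomial[OF holomorphic_germ_const[of 1], of 1 0 1] by simp

lemma max_power_snd: "snd \<in> max_power 1"
  using max_power_monomial[OF holomorphic_germ_const[of 1], of 0 1 1] by simp

lemma max_power_power:
  assumes "h \<in> max_power 1"
  shows "(\<lambda>z. h z ^ l) \<in> max_power l"
proof (induction l)
  case 0
  show ?case using max_power_0[OF holomorphic_germ_const[of 1]] by simp
next
  case (Suc l)
  show ?case using max_power_mult[OF assms Suc] by simp
qed

lemma max_power_Suc_subset: "h \<in> max_power (Suc d) \<Longrightarrow> h \<in> max_power d"
proof -
  assume "h \<in> max_power (Suc d)"
  then obtain a where 1: "\<forall>i\<le>Suc d. holomorphic_germ (a i)"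
    "\<forall>\<^sub>F z in nhds 0. h z = (\<Sum>i\<le>Suc d. fst z ^ i * snd z ^ (Suc d - i) * a i z)"
    by (auto simp: max_power_def)
  have "(\<lambda>z. fst z ^ i * snd z ^ (Suc d - i) * a i z) \<in> max_power d" if i: "i \<le> Suc d" for i
  proof (cases i)
    case 0
    have "(\<lambda>z. fst z ^ 0 * snd z ^ d * (snd z * a 0 z)) \<in> max_power d"
      using 1(1) by (intro max_power_monomial holomorphic_germ_mult holomorphic_germ_snd) auto
    then show ?thesis using 0 by (simp add: mult_ac)
  next
    case (Suc l)
    have "(\<lambda>z. fst z ^ l * snd z ^ (d - l) * (fst z * a i z)) \<in> max_power d"
      using 1(1) i Suc by (intro max_power_monomial holomorphic_germ_mult holomorphic_germ_fst) auto
    then show ?thesis using Suc by (simp add: mult_ac)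
  qed
  then have "(\<lambda>z. \<Sum>i\<le>Suc d. fst z ^ i * snd z ^ (Suc d - i) * a i z) \<in> max_power d"
    by (intro max_power_sum) simp
  then show ?thesis using 1(2) by (rule max_power_cong)
qed

lemma max_power_antimono:
  assumes "d \<le> e" "h \<in> max_power e"
  shows "h \<in> max_power d"
  using assms by (induction e rule: dec_induct) (auto dest: max_power_Suc_subset)

lemma diff_value_in_max_power_1:
  assumes "holomorphic_germ h"
  shows "(\<lambda>z. h z - h 0) \<in> max_power 1"
proof -
  obtain a b where ab: "holomorphic_germ a" "holomorphic_germ b" "\<forall>\<^sub>F z in nhds 0. h z = h 0 + fst z * a z + snd z * b z"
    using hadamard_decomposition[OF assms] by blast
  have "(\<lambda>z. a z * fst z + b z * snd z) \<in> max_power 1"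
    by (intro max_power_add max_power_mult_germ max_power_fst max_power_snd ab)
  moreover have "\<forall>\<^sub>F z in nhds 0. h z - h 0 = a z * fst z + b z * snd z"
    using ab(3) by eventually_elim (simp add: mult_ac)
  ultimately show ?thesis by (rule max_power_cong)
qed

text \<open>Freezing the coefficients at 0 costs an error in the next power, by Hadamard's
  decomposition.\<close>

lemma max_power_leading_form:
  assumes "h \<in> max_power d"
  obtains c r where "r \<in> max_power (Suc d)"
    "\<forall>\<^sub>F z in nhds 0. h z = (\<Sum>i\<le>d. c i * (fst z ^ i * snd z ^ (d - i))) + r z"
proof -
  obtain a where 1: "\<forall>i\<le>d. holomorphic_germ (a i)" "\<forall>\<^sub>F z in nhds 0. h z = (\<Sum>i\<le>d. fst z ^ i * snd z ^ (d - i) * a i z)"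
    using assms by (auto simp: max_power_def)
  define r where "r = (\<lambda>z. \<Sum>i\<le>d. (fst z ^ i * snd z ^ (d - i) * 1) * (a i z - a i 0))"
  have "r \<in> max_power (d + 1)"
    unfolding r_def using 1(1)
    by (intro max_power_sum max_power_mult max_power_monomial holomorphic_germ_const diff_value_in_max_power_1) auto
  moreover have "\<forall>\<^sub>F z in nhds 0. h z = (\<Sum>i\<le>d. a i 0 * (fst z ^ i * snd z ^ (d - i))) + r z"
    using 1(2) by eventually_elim (simp add: r_def sum.distrib[symmetric] algebra_simps)
  ultimately show ?thesis using that by simp
qed

text \<open>Along the lines \<open>s \<mapsto> (s * x, s)\<close> both sides are divisible by
  \<open>s ^ d\<close>. Dividing and letting \<open>s\<close> tend to 0 leaves a polynomial in
  \<open>x\<close> that vanishes everywhere.\<close>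

lemma homogeneous_in_higher_power_zero:
  assumes "(\<lambda>z. \<Sum>i\<le>d. c i * (fst z ^ i * snd z ^ (d - i))) \<in> max_power (Suc d)" "i \<le> d"
  shows "c i = 0"
proof -
  obtain a where a: "\<forall>i\<le>Suc d. holomorphic_germ (a i)"
    "\<forall>\<^sub>F z in nhds 0. (\<Sum>i\<le>d. c i * (fst z ^ i * snd z ^ (d - i))) = (\<Sum>i\<le>Suc d. fst z ^ i * snd z ^ (Suc d - i) * a i z)"
    using assms(1) by (auto simp: max_power_def)
  have "(\<Sum>i\<le>d. c i * x ^ i) = 0" for x
  proof -
    define \<gamma> where "\<gamma> = (\<lambda>s :: complex. (s * x, s))"
    have \<gamma>: "isCont \<gamma> 0" unfolding \<gamma>_def by (intro continuous_intros)
    have "(\<gamma> \<longlongrightarrow> 0) (at 0)" using \<gamma> by (simp add: isCont_def \<gamma>_def zero_prod_def)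
    then have "\<forall>\<^sub>F s in at 0. (\<Sum>i\<le>d. c i * (fst (\<gamma> s) ^ i * snd (\<gamma> s) ^ (d - i)))
        = (\<Sum>i\<le>Suc d. fst (\<gamma> s) ^ i * snd (\<gamma> s) ^ (Suc d - i) * a i (\<gamma> s))"
      by (rule eventually_compose_filterlim[OF a(2)])
    moreover have "\<forall>\<^sub>F s in at (0::complex). s \<noteq> 0" by (simp add: eventually_at_filter)
    ultimately have ev: "\<forall>\<^sub>F s in at 0. (\<Sum>i\<le>d. c i * x ^ i) = s * (\<Sum>i\<le>Suc d. x ^ i * a i (\<gamma> s))"
    proof eventually_elim
      case (elim s)
      have "(\<Sum>i\<le>d. c i * (fst (\<gamma> s) ^ i * snd (\<gamma> s) ^ (d - i))) = s ^ d * (\<Sum>i\<le>d. c i * x ^ i)"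
        unfolding sum_distrib_left \<gamma>_def
      proof (rule sum.cong[OF refl])
        fix i assume "i \<in> {..d}"
        then have "s ^ d = s ^ i * s ^ (d - i)" by (simp add: power_add[symmetric])
        then show "c i * (fst (s * x, s) ^ i * snd (s * x, s) ^ (d - i)) = s ^ d * (c i * x ^ i)"
          by (simp add: power_mult_distrib)
      qed
      moreover have "(\<Sum>i\<le>Suc d. fst (\<gamma> s) ^ i * snd (\<gamma> s) ^ (Suc d - i) * a i (\<gamma> s)) = s ^ d * (s * (\<Sum>i\<le>Suc d. x ^ i * a i (\<gamma> s)))"
        unfolding sum_distrib_left
      proof (rule sum.cong[OF refl])
        fix i assume "i \<in> {..Suc d}"
        then have "s ^ Suc d = s ^ i * s ^ (Suc d - i)" by (simp add: power_add[symmetric])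
        moreover have "fst (\<gamma> s) = s * x" "snd (\<gamma> s) = s" by (simp_all add: \<gamma>_def)
        moreover have "s ^ d * (s * (x ^ i * a i (\<gamma> s))) = s ^ Suc d * (x ^ i * a i (\<gamma> s))" by simp
        ultimately show "fst (\<gamma> s) ^ i * snd (\<gamma> s) ^ (Suc d - i) * a i (\<gamma> s) = s ^ d * (s * (x ^ i * a i (\<gamma> s)))"
          by (simp only: power_mult_distrib mult_ac)
      qed
      ultimately show ?case using elim by simp
    qed
    have "((\<lambda>s. s * (\<Sum>i\<le>Suc d. x ^ i * a i (\<gamma> s))) \<longlongrightarrow> 0 * (\<Sum>i\<le>Suc d. x ^ i * a i (\<gamma> 0))) (at 0)"
    proof (intro tendsto_intros)
      fix i assume "i \<in> {..Suc d}"
      then have "isCont (a i) (\<gamma> 0)" using a(1) holomorphic_germ_isCont by (simp add: \<gamma>_def zero_prod_def[symmetric])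
      then have "isCont (\<lambda>s. a i (\<gamma> s)) 0" by (rule isCont_o2[OF \<gamma>])
      then show "((\<lambda>s. a i (\<gamma> s)) \<longlongrightarrow> a i (\<gamma> 0)) (at 0)" by (simp add: isCont_def)
    qed
    then have "((\<lambda>s. \<Sum>i\<le>d. c i * x ^ i) \<longlongrightarrow> 0) (at (0::complex))"
      using tendsto_cong[OF ev] by simp
    then show ?thesis by (simp add: tendsto_const_iff)
  qed
  then show ?thesis using polyfun_eq_0[of c d] assms(2) by blast
qed

text \<open>Nakayama's lemma by Gaussian elimination: the pivots \<open>1 - m s s\<close> are units.\<close>

lemma nakayama_germs:
  assumes "finite S"
    and "\<And>l. l \<in> S \<Longrightarrow> (\<lambda>z. e l z - (\<Sum>k\<in>S. m l k z * e k z)) \<in> germ_ideal P Q"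
    and "\<And>l k. l \<in> S \<Longrightarrow> k \<in> S \<Longrightarrow> holomorphic_germ (m l k) \<and> m l k 0 = 0"
  shows "\<forall>l\<in>S. e l \<in> germ_ideal P Q"
  using assms
proof (induction S arbitrary: m rule: finite_induct)
  case empty
  then show ?case by simp
next
  case (insert s S)
  define u where "u = (\<lambda>z. inverse (1 - m s s z))"
  have hm: "holomorphic_germ (m l k)" "m l k 0 = 0" if "l \<in> insert s S" "k \<in> insert s S" for l k
    using insert.prems(2) that by auto
  have g1: "holomorphic_germ (\<lambda>z. 1 - m s s z)" by (intro holomorphic_germ_diff holomorphic_germ_const hm) auto
  have u: "holomorphic_germ u" unfolding u_def by (rule holomorphic_germ_inverse[OF g1]) (simp add: hm)
  have ev: "\<forall>\<^sub>F z in nhds 0. u z * (1 - m s s z) = 1"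
  proof -
    have "\<forall>\<^sub>F z in nhds 0. 1 - m s s z \<noteq> 0"
      by (rule holomorphic_germ_eventually_nonzero[OF g1]) (simp add: hm)
    then show ?thesis by eventually_elim (simp add: u_def)
  qed
  have rs: "(\<lambda>z. e s z - (\<Sum>k\<in>S. u z * m s k z * e k z)) \<in> germ_ideal P Q"
  proof (rule germ_ideal_cong)
    show "(\<lambda>z. u z * (e s z - (\<Sum>k\<in>insert s S. m s k z * e k z))) \<in> germ_ideal P Q"
      by (intro germ_ideal_mult u insert.prems(1)) simp
    show "\<forall>\<^sub>F z in nhds 0. e s z - (\<Sum>k\<in>S. u z * m s k z * e k z) = u z * (e s z - (\<Sum>k\<in>insert s S. m s k z * e k z))"
      using ev
    proof eventually_elim
      case (elim z)
      have "u z * (e s z - (\<Sum>k\<in>insert s S. m s k z * e k z)) = u z * (1 - m s s z) * e s z - u z * (\<Sum>k\<in>S. m s k z * e k z)"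
        using insert.hyps by (simp add: algebra_simps)
      then show ?case unfolding elim by (simp add: sum_distrib_left mult_ac)
    qed
  qed
  \<comment> \<open>The coefficients after elimination of \<open>e s\<close>. The correction
    contains the factor \<open>m l s\<close>, so they still vanish at 0.\<close>
  define m' where "m' = (\<lambda>l k z. m l k z + m l s z * (u z * m s k z))"
  have eS: "\<forall>l\<in>S. e l \<in> germ_ideal P Q"
  proof (rule insert.IH)
    fix l assume l: "l \<in> S"
    have "(\<lambda>z. (e l z - (\<Sum>k\<in>insert s S. m l k z * e k z)) + m l s z * (e s z - (\<Sum>k\<in>S. u z * m s k z * e k z))) \<in> germ_ideal P Q"
      using l by (intro germ_ideal_add germ_ideal_mult insert.prems(1) rs hm(1)) auto
    moreover have "(e l z - (\<Sum>k\<in>insert s S. m l k z * e k z)) + m l s z * (e s z - (\<Sum>k\<in>S. u z * m s k z * e k z))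
        = e l z - (\<Sum>k\<in>S. m' l k z * e k z)" for z
      using insert.hyps by (simp add: m'_def algebra_simps sum.distrib sum_distrib_left)
    ultimately show "(\<lambda>z. e l z - (\<Sum>k\<in>S. m' l k z * e k z)) \<in> germ_ideal P Q" by simp
    fix k assume "k \<in> S"
    then show "holomorphic_germ (m' l k) \<and> m' l k 0 = 0"
      unfolding m'_def using l hm u by (auto intro!: holomorphic_germ_add holomorphic_germ_mult)
  qed
  have "(\<lambda>z. (e s z - (\<Sum>k\<in>S. u z * m s k z * e k z)) + (\<Sum>k\<in>S. u z * m s k z * e k z)) \<in> germ_ideal P Q"
    using eS hm u by (intro germ_ideal_add rs germ_ideal_sum germ_ideal_mult holomorphic_germ_mult) auto
  then have "e s \<in> germ_ideal P Q" by simp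
  then show ?case using eS by simp
qed

text \<open>Gaussian elimination: a \<open>b0\<close> with \<open>v b0 k \<noteq> 0\<close> clears
  the coordinate \<open>k\<close> and is then dropped, so both cardinalities fall by one.\<close>

lemma exists_linear_relation:
  fixes v :: "'b \<Rightarrow> 'i \<Rightarrow> complex"
  assumes "finite K" "finite B" "card K < card B"
  shows "\<exists>d. (\<exists>b\<in>B. d b \<noteq> 0) \<and> (\<forall>k\<in>K. (\<Sum>b\<in>B. d b * v b k) = 0)"
  using assms
proof (induction K arbitrary: B v rule: finite_induct)
  case empty
  then obtain b where "b \<in> B" by fastforce
  then show ?case by (intro exI[of _ "\<lambda>_. 1"]) auto
next
  case (insert k K)
  show ?case
  proof (cases "\<forall>b\<in>B. v b k = 0")
    case True
    have "card K < card B" using insert.prems insert.hyps by simp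
    then obtain d where "\<exists>b\<in>B. d b \<noteq> 0" "\<forall>k\<in>K. (\<Sum>b\<in>B. d b * v b k) = 0"
      using insert.IH[OF insert.prems(1)] by blast
    then show ?thesis using True by (intro exI[of _ d]) simp
  next
    case False
    then obtain b0 where b0: "b0 \<in> B" "v b0 k \<noteq> 0" by blast
    define v' where "v' = (\<lambda>b j. v b j - v b k / v b0 k * v b0 j)"
    have "card K < card (B - {b0})" using insert.prems insert.hyps b0 by simp
    then obtain d where d: "\<exists>b\<in>B - {b0}. d b \<noteq> 0" "\<forall>j\<in>K. (\<Sum>b\<in>B - {b0}. d b * v' b j) = 0"
      using insert.IH[of "B - {b0}" v'] insert.prems(1) by auto
    define d0 where "d0 = - (\<Sum>b\<in>B - {b0}. d b * (v b k / v b0 k))"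
    have *: "(\<Sum>b\<in>B. (d(b0 := d0)) b * v b j) = (\<Sum>b\<in>B - {b0}. d b * v' b j)" for j
    proof -
      have "(\<Sum>b\<in>B. (d(b0 := d0)) b * v b j) = d0 * v b0 j + (\<Sum>b\<in>B - {b0}. d b * v b j)"
        by (subst sum.remove[OF insert.prems(1) b0(1)]) simp
      also have "\<dots> = (\<Sum>b\<in>B - {b0}. d b * v b j - d b * (v b k / v b0 k) * v b0 j)"
        by (simp add: d0_def sum_subtractf sum_distrib_right)
      also have "\<dots> = (\<Sum>b\<in>B - {b0}. d b * v' b j)" by (simp add: v'_def right_diff_distrib mult.assoc)
      finally show ?thesis .
    qed
    show ?thesis
    proof (intro exI[of _ "d(b0 := d0)"] conjI ballI)
      show "\<exists>b\<in>B. (d(b0 := d0)) b \<noteq> 0" using d(1) by auto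
      fix j assume j: "j \<in> insert k K"
      show "(\<Sum>b\<in>B. (d(b0 := d0)) b * v b j) = 0"
      proof (cases "j = k")
        case True
        then show ?thesis unfolding * using b0 by (simp add: v'_def)
      next
        case False
        then show ?thesis unfolding * using j d(2) by simp
      qed
    qed
  qed
qed


section \<open>Milnor numbers\<close>

text \<open>A monomial of degree \<open>d + 1\<close> is one of degree \<open>d\<close> times a
  variable, and this variable makes the coefficient vanish at 0, as Nakayama's lemma requires. Only
  \<open>snd z ^ Suc d\<close> has no factor \<open>fst z\<close>; it is assigned to
  \<open>k = 0\<close>.\<close>

lemma max_power_Suc_coefficients:
  assumes "r \<in> max_power (Suc d)"
  obtains m where "\<And>k. k \<le> d \<Longrightarrow> holomorphic_germ (m k) \<and> m k 0 = 0"
    "\<forall>\<^sub>F z in nhds 0. r z = (\<Sum>k\<le>d. m k z * (fst z ^ k * snd z ^ (d - k)))"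
proof -
  obtain a where a: "\<forall>i\<le>Suc d. holomorphic_germ (a i)"
    "\<forall>\<^sub>F z in nhds 0. r z = (\<Sum>i\<le>Suc d. fst z ^ i * snd z ^ (Suc d - i) * a i z)"
    using assms by (auto simp: max_power_def)
  define m where "m = (\<lambda>k z. fst z * a (Suc k) z + (if k = 0 then snd z * a 0 z else 0))"
  have "holomorphic_germ (m k) \<and> m k 0 = 0" if "k \<le> d" for k
    using a(1) that unfolding m_def
    by (cases "k = 0") (auto intro!: holomorphic_germ_add holomorphic_germ_mult holomorphic_germ_fst holomorphic_germ_snd)
  moreover have "\<forall>\<^sub>F z in nhds 0. r z = (\<Sum>k\<le>d. m k z * (fst z ^ k * snd z ^ (d - k)))"
    using a(2)
  proof eventually_elim
    case (elim z)
    have "(\<Sum>k\<le>d. m k z * (fst z ^ k * snd z ^ (d - k)))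
        = (\<Sum>k\<le>d. fst z ^ Suc k * snd z ^ (d - k) * a (Suc k) z + (if k = 0 then snd z ^ Suc d * a 0 z else 0))"
      by (intro sum.cong) (auto simp: m_def algebra_simps)
    also have "\<dots> = (\<Sum>k\<le>d. fst z ^ Suc k * snd z ^ (d - k) * a (Suc k) z) + snd z ^ Suc d * a 0 z"
      by (simp add: sum.distrib)
    also have "\<dots> = (\<Sum>i\<le>Suc d. fst z ^ i * snd z ^ (Suc d - i) * a i z)"
      by (subst sum.atMost_Suc_shift) (simp add: mult_ac)
    finally show ?case using elim by simp
  qed
  ultimately show ?thesis using that by blast
qed

text \<open>Subtraction is truncated: for \<open>e < u + v\<close> the hypothesis only says that
  \<open>A\<close> is a germ, and the product has no part of degree \<open>e\<close>. The last
  clause lets an induction on \<open>e\<close> raise the known order of \<open>A\<close> once the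
  part of degree \<open>e\<close> is zero.\<close>

lemma monomial_mult_leading_form:
  assumes A: "A \<in> max_power (e - (u + v))"
  obtains C R where "R \<in> max_power (Suc e)"
    "\<forall>\<^sub>F z in nhds 0. fst z ^ u * snd z ^ v * A z = (\<Sum>i\<le>e. C i * (fst z ^ i * snd z ^ (e - i))) + R z"
    "\<forall>i. C i \<noteq> 0 \<longrightarrow> u \<le> i \<and> i + v \<le> e"
    "(\<forall>i\<le>e. C i = 0) \<longrightarrow> A \<in> max_power (Suc e - (u + v))"
proof (cases "u + v \<le> e")
  case False
  have "(\<lambda>z. fst z ^ u * snd z ^ v * A z) \<in> max_power (u + v)"
    by (rule max_power_monomial[OF holomorphic_germ_max_power[OF A]]) simp
  then have "(\<lambda>z. fst z ^ u * snd z ^ v * A z) \<in> max_power (Suc e)"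
    by (rule max_power_antimono[rotated]) (use False in simp)
  then show ?thesis using that[of "\<lambda>z. fst z ^ u * snd z ^ v * A z" "\<lambda>_. 0"] A False by simp
next
  case True
  define d where "d = e - (u + v)"
  have e: "e = d + u + v" using True by (simp add: d_def)
  obtain a r where ar: "r \<in> max_power (Suc d)"
    "\<forall>\<^sub>F z in nhds 0. A z = (\<Sum>i\<le>d. a i * (fst z ^ i * snd z ^ (d - i))) + r z"
    by (rule max_power_leading_form[OF A[folded d_def]])
  define C where "C = (\<lambda>i. if u \<le> i \<and> i + v \<le> e then a (i - u) else 0)"
  have R: "(\<lambda>z. fst z ^ u * snd z ^ v * 1 * r z) \<in> max_power (Suc e)"
    using max_power_mult[OF max_power_monomial[OF holomorphic_germ_const[of 1], of u v "u + v"] ar(1)] by (simp add: e add_ac)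
  have sum: "fst z ^ u * snd z ^ v * (\<Sum>i\<le>d. a i * (fst z ^ i * snd z ^ (d - i))) = (\<Sum>i\<le>e. C i * (fst z ^ i * snd z ^ (e - i)))" for z :: C2
  proof -
    have "(\<Sum>i\<le>e. C i * (fst z ^ i * snd z ^ (e - i))) = (\<Sum>i\<in>{u..d + u}. C i * (fst z ^ i * snd z ^ (e - i)))"
      by (rule sum.mono_neutral_right) (auto simp: C_def e)
    also have "\<dots> = (\<Sum>i\<in>{0..d}. C (i + u) * (fst z ^ (i + u) * snd z ^ (e - (i + u))))"
      using sum.shift_bounds_cl_nat_ivl[of _ 0 u d] by simp
    also have "\<dots> = (\<Sum>i\<in>{0..d}. fst z ^ u * snd z ^ v * (a i * (fst z ^ i * snd z ^ (d - i))))"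
    proof (rule sum.cong[OF refl])
      fix i assume "i \<in> {0..d}"
      then have "e - (i + u) = (d - i) + v" "C (i + u) = a i" by (auto simp: C_def e)
      then show "C (i + u) * (fst z ^ (i + u) * snd z ^ (e - (i + u))) = fst z ^ u * snd z ^ v * (a i * (fst z ^ i * snd z ^ (d - i)))"
        by (simp only: power_add mult_ac)
    qed
    finally show ?thesis by (simp add: sum_distrib_left atLeast0AtMost)
  qed
  show ?thesis
  proof (rule that[OF R, of C])
    show "\<forall>\<^sub>F z in nhds 0. fst z ^ u * snd z ^ v * A z = (\<Sum>i\<le>e. C i * (fst z ^ i * snd z ^ (e - i))) + fst z ^ u * snd z ^ v * 1 * r z"
      using ar(2) by eventually_elim (simp add: sum[symmetric] distrib_left)
    show "\<forall>i. C i \<noteq> 0 \<longrightarrow> u \<le> i \<and> i + v \<le> e" by (simp add: C_def)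
    show "(\<forall>i\<le>e. C i = 0) \<longrightarrow> A \<in> max_power (Suc e - (u + v))"
    proof
      assume C0: "\<forall>i\<le>e. C i = 0"
      have a0: "a i = 0" if "i \<le> d" for i using C0[rule_format, of "i + u"] that by (simp add: C_def e)
      have "\<forall>\<^sub>F z in nhds 0. A z = r z" using ar(2) by eventually_elim (simp add: a0)
      then have "A \<in> max_power (Suc d)" by (rule max_power_cong[OF ar(1)])
      then show "A \<in> max_power (Suc e - (u + v))" using True by (simp add: d_def Suc_diff_le)
    qed
  qed
qed

locale leading_monomials =
  fixes p q :: nat and \<alpha> \<beta> :: complex and h\<^sub>1 h\<^sub>2 P Q :: "C2 \<Rightarrow> complex"
  assumes pq: "1 \<le> p" "p \<le> q" and nz: "\<alpha> \<noteq> 0" "\<beta> \<noteq> 0"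
    and h: "h\<^sub>1 \<in> max_power (Suc q)" "h\<^sub>2 \<in> max_power (Suc q)"
    and P: "\<And>z. P z = \<alpha> * fst z ^ p + h\<^sub>1 z" and Q: "\<And>z. Q z = \<beta> * snd z ^ q + h\<^sub>2 z"
begin

text \<open>Modulo the ideal, \<open>x ^ p\<close> may be exchanged for
  \<open>- h\<^sub>1 / \<alpha>\<close> and \<open>y ^ q\<close> for
  \<open>- h\<^sub>2 / \<beta>\<close>. The remainders have order above \<open>q \<ge> p\<close>, so
  the degree goes up.\<close>

lemma reduce_monomial:
  assumes "p \<le> i \<or> q \<le> j"
  obtains r where "r \<in> max_power (Suc (i + j))" "(\<lambda>z. fst z ^ i * snd z ^ j - r z) \<in> germ_ideal P Q"
proof (cases "p \<le> i")
  case True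
  have a: "holomorphic_germ (\<lambda>z. 1 / \<alpha> * (fst z ^ (i - p) * snd z ^ j))"
    by (intro holomorphic_germ_mult holomorphic_germ_const holomorphic_germ_power holomorphic_germ_fst holomorphic_germ_snd)
  have "(\<lambda>z. fst z ^ (i - p) * snd z ^ j * (- 1 / \<alpha>) * h\<^sub>1 z) \<in> max_power ((i - p + j) + Suc q)"
    by (intro max_power_mult max_power_monomial holomorphic_germ_const h refl)
  then have "(\<lambda>z. fst z ^ (i - p) * snd z ^ j * (- 1 / \<alpha>) * h\<^sub>1 z) \<in> max_power (Suc (i + j))"
    by (rule max_power_antimono[rotated]) (use True pq in simp)
  moreover have "fst z ^ i * snd z ^ j - fst z ^ (i - p) * snd z ^ j * (- 1 / \<alpha>) * h\<^sub>1 z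
      = 1 / \<alpha> * (fst z ^ (i - p) * snd z ^ j) * P z" for z :: C2
  proof -
    have "fst z ^ i = fst z ^ (i - p) * fst z ^ p" using True by (simp add: power_add[symmetric])
    then show ?thesis using nz unfolding P by (simp add: field_simps)
  qed
  ultimately show ?thesis using that germ_ideal_mult[OF germ_ideal_gens(1) a] by presburger
next
  case False
  then have j: "q \<le> j" using assms by simp
  have a: "holomorphic_germ (\<lambda>z. 1 / \<beta> * (fst z ^ i * snd z ^ (j - q)))"
    by (intro holomorphic_germ_mult holomorphic_germ_const holomorphic_germ_power holomorphic_germ_fst holomorphic_germ_snd)
  have "(\<lambda>z. fst z ^ i * snd z ^ (j - q) * (- 1 / \<beta>) * h\<^sub>2 z) \<in> max_power ((i + (j - q)) + Suc q)"
    by (intro max_power_mult max_power_monomial holomorphic_germ_const h refl)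
  then have "(\<lambda>z. fst z ^ i * snd z ^ (j - q) * (- 1 / \<beta>) * h\<^sub>2 z) \<in> max_power (Suc (i + j))"
    by (rule max_power_antimono[rotated]) (use j in simp)
  moreover have "fst z ^ i * snd z ^ j - fst z ^ i * snd z ^ (j - q) * (- 1 / \<beta>) * h\<^sub>2 z
      = 1 / \<beta> * (fst z ^ i * snd z ^ (j - q)) * Q z" for z :: C2
  proof -
    have "snd z ^ j = snd z ^ (j - q) * snd z ^ q" using j by (simp add: power_add[symmetric])
    then show ?thesis using nz unfolding Q by (simp add: field_simps)
  qed
  ultimately show ?thesis using that germ_ideal_mult[OF germ_ideal_gens(2) a] by presburger
qed

text \<open>In degree \<open>p + q - 1\<close> every monomial has \<open>p \<le> i\<close> or
  \<open>q \<le> j\<close>, so each can be pushed one degree higher, which is the situation of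
  Nakayama's lemma.\<close>

lemma max_power_subset_ideal:
  assumes "h \<in> max_power (p + q - 1)"
  shows "h \<in> germ_ideal P Q"
proof -
  define d where "d = p + q - 1"
  define e where "e = (\<lambda>l z. fst z ^ l * snd z ^ (d - l) :: complex)"
  have "\<exists>m. (\<forall>k\<le>d. holomorphic_germ (m k) \<and> m k 0 = 0) \<and> (\<lambda>z. e l z - (\<Sum>k\<le>d. m k z * e k z)) \<in> germ_ideal P Q"
    if l: "l \<le> d" for l
  proof -
    have "p \<le> l \<or> q \<le> d - l" using l pq by (auto simp: d_def)
    then obtain r where r: "r \<in> max_power (Suc (l + (d - l)))" "(\<lambda>z. fst z ^ l * snd z ^ (d - l) - r z) \<in> germ_ideal P Q"
      by (rule reduce_monomial)
    then have "r \<in> max_power (Suc d)" using l by simp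
    then obtain m where m: "\<And>k. k \<le> d \<Longrightarrow> holomorphic_germ (m k) \<and> m k 0 = 0"
      "\<forall>\<^sub>F z in nhds 0. r z = (\<Sum>k\<le>d. m k z * (fst z ^ k * snd z ^ (d - k)))"
      by (rule max_power_Suc_coefficients) blast
    have "(\<lambda>z. e l z - (\<Sum>k\<le>d. m k z * e k z)) \<in> germ_ideal P Q"
    proof (rule germ_ideal_cong[OF r(2)])
      show "\<forall>\<^sub>F z in nhds 0. e l z - (\<Sum>k\<le>d. m k z * e k z) = fst z ^ l * snd z ^ (d - l) - r z"
        using m(2) by eventually_elim (simp add: e_def)
    qed
    then show ?thesis using m(1) by blast
  qed
  then have "\<exists>m. \<forall>l\<in>{..d}. (\<forall>k\<le>d. holomorphic_germ (m l k) \<and> m l k 0 = 0) \<and>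
      (\<lambda>z. e l z - (\<Sum>k\<le>d. m l k z * e k z)) \<in> germ_ideal P Q"
    by (intro bchoice) simp
  then obtain m where m: "\<forall>l\<in>{..d}. (\<forall>k\<le>d. holomorphic_germ (m l k) \<and> m l k 0 = 0) \<and>
      (\<lambda>z. e l z - (\<Sum>k\<le>d. m l k z * e k z)) \<in> germ_ideal P Q"
    by (rule exE)
  have el: "\<forall>l\<in>{..d}. e l \<in> germ_ideal P Q"
    by (rule nakayama_germs[of _ e m]) (use m in auto)
  obtain a where a: "\<forall>i\<le>d. holomorphic_germ (a i)" "\<forall>\<^sub>F z in nhds 0. h z = (\<Sum>i\<le>d. fst z ^ i * snd z ^ (d - i) * a i z)"
    using assms unfolding max_power_def d_def[symmetric] by blast
  have "(\<lambda>z. \<Sum>i\<le>d. a i z * e i z) \<in> germ_ideal P Q"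
    using a(1) el by (intro germ_ideal_sum germ_ideal_mult) auto
  moreover have "\<forall>\<^sub>F z in nhds 0. h z = (\<Sum>i\<le>d. a i z * e i z)"
    using a(2) by eventually_elim (simp add: e_def mult_ac)
  ultimately show ?thesis by (rule germ_ideal_cong)
qed

text \<open>The degree \<open>d\<close> part of the remainder splits into basis monomials, collected
  in the coefficients, and reducible ones, pushed into degree \<open>d + 1\<close>. Convergence is
  no issue, since the process may stop at \<open>d = p + q - 1\<close>.\<close>

lemma spanning_modulo_max_power:
  assumes "holomorphic_germ h"
  shows "\<exists>c. \<exists>r\<in>max_power d. (\<lambda>z. h z - (\<Sum>i<p. \<Sum>j<q. c i j * (fst z ^ i * snd z ^ j)) - r z) \<in> germ_ideal P Q"
proof (induction d)
  case 0
  show ?case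
    using max_power_0[OF assms] germ_ideal_zero by (intro exI[of _ "\<lambda>_ _. 0"] bexI[of _ h]) simp_all
next
  case (Suc d)
  then obtain c r where cr: "r \<in> max_power d"
    "(\<lambda>z. h z - (\<Sum>i<p. \<Sum>j<q. c i j * (fst z ^ i * snd z ^ j)) - r z) \<in> germ_ideal P Q" by blast
  obtain k r' where k: "r' \<in> max_power (Suc d)"
    "\<forall>\<^sub>F z in nhds 0. r z = (\<Sum>i\<le>d. k i * (fst z ^ i * snd z ^ (d - i))) + r' z"
    using max_power_leading_form[OF cr(1)] by blast
  define I where "I = {i. i \<le> d \<and> i < p \<and> d - i < q}"
  define J where "J = {i. i \<le> d \<and> \<not> (i < p \<and> d - i < q)}"
  have IJ: "{..d} = I \<union> J" "I \<inter> J = {}" "finite I" "finite J" by (auto simp: I_def J_def)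
  have "\<exists>s. s \<in> max_power (Suc d) \<and> (\<lambda>z. fst z ^ i * snd z ^ (d - i) - s z) \<in> germ_ideal P Q" if i: "i \<in> J" for i
  proof -
    have "p \<le> i \<or> q \<le> d - i" using i by (auto simp: J_def)
    then obtain s where "s \<in> max_power (Suc (i + (d - i)))" "(\<lambda>z. fst z ^ i * snd z ^ (d - i) - s z) \<in> germ_ideal P Q"
      by (rule reduce_monomial)
    then show ?thesis using i by (auto simp: J_def)
  qed
  then have "\<exists>s. \<forall>i\<in>J. s i \<in> max_power (Suc d) \<and> (\<lambda>z. fst z ^ i * snd z ^ (d - i) - s i z) \<in> germ_ideal P Q"
    by (intro bchoice ballI)
  then obtain s where "\<forall>i\<in>J. s i \<in> max_power (Suc d) \<and> (\<lambda>z. fst z ^ i * snd z ^ (d - i) - s i z) \<in> germ_ideal P Q"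
    by (rule exE)
  then have s: "\<And>i. i \<in> J \<Longrightarrow> s i \<in> max_power (Suc d)"
    "\<And>i. i \<in> J \<Longrightarrow> (\<lambda>z. fst z ^ i * snd z ^ (d - i) - s i z) \<in> germ_ideal P Q"
    by simp_all
  define r'' where "r'' = (\<lambda>z. r' z + (\<Sum>i\<in>J. k i * s i z))"
  define c' where "c' = (\<lambda>i j. c i j + (if i + j = d then k i else 0))"
  have r'': "r'' \<in> max_power (Suc d)"
    unfolding r''_def by (intro max_power_add k max_power_sum max_power_mult_germ s holomorphic_germ_const)
  have basis: "(\<Sum>i<p. \<Sum>j<q. c' i j * (fst z ^ i * snd z ^ j))
      = (\<Sum>i<p. \<Sum>j<q. c i j * (fst z ^ i * snd z ^ j)) + (\<Sum>i\<in>I. k i * (fst z ^ i * snd z ^ (d - i)))" for z :: C2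
  proof -
    have "(\<Sum>j<q. (if i + j = d then k i else 0) * (fst z ^ i * snd z ^ j))
        = (if i \<in> I then k i * (fst z ^ i * snd z ^ (d - i)) else 0)" if "i < p" for i
    proof -
      have "(\<Sum>j<q. (if i + j = d then k i else 0) * (fst z ^ i * snd z ^ j))
          = (\<Sum>j<q. if j = d - i then (if i \<le> d then k i * (fst z ^ i * snd z ^ (d - i)) else 0) else 0)"
        by (intro sum.cong) auto
      also have "\<dots> = (if i \<in> I then k i * (fst z ^ i * snd z ^ (d - i)) else 0)"
        using that by (auto simp: I_def)
      finally show ?thesis .
    qed
    then have "(\<Sum>i<p. \<Sum>j<q. (if i + j = d then k i else 0) * (fst z ^ i * snd z ^ j))
        = (\<Sum>i<p. if i \<in> I then k i * (fst z ^ i * snd z ^ (d - i)) else 0)"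
      by (intro sum.cong) auto
    also have "\<dots> = (\<Sum>i\<in>{..<p} \<inter> I. k i * (fst z ^ i * snd z ^ (d - i)))"
      by (simp add: sum.inter_restrict)
    also have "{..<p} \<inter> I = I" by (auto simp: I_def)
    finally show ?thesis by (simp add: c'_def distrib_right sum.distrib)
  qed
  have "(\<lambda>z. (h z - (\<Sum>i<p. \<Sum>j<q. c i j * (fst z ^ i * snd z ^ j)) - r z)
      + (\<Sum>i\<in>J. k i * (fst z ^ i * snd z ^ (d - i) - s i z))) \<in> germ_ideal P Q"
    by (intro germ_ideal_add cr germ_ideal_sum germ_ideal_cmult s)
  moreover have "\<forall>\<^sub>F z in nhds 0. h z - (\<Sum>i<p. \<Sum>j<q. c' i j * (fst z ^ i * snd z ^ j)) - r'' z
      = (h z - (\<Sum>i<p. \<Sum>j<q. c i j * (fst z ^ i * snd z ^ j)) - r z)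
        + (\<Sum>i\<in>J. k i * (fst z ^ i * snd z ^ (d - i) - s i z))"
    using k(2)
  proof eventually_elim
    case (elim z)
    have "(\<Sum>i\<le>d. k i * (fst z ^ i * snd z ^ (d - i)))
        = (\<Sum>i\<in>I. k i * (fst z ^ i * snd z ^ (d - i))) + (\<Sum>i\<in>J. k i * (fst z ^ i * snd z ^ (d - i)))"
      unfolding IJ(1) by (rule sum.union_disjoint[OF IJ(3,4,2)])
    then show ?case unfolding basis elim r''_def right_diff_distrib sum_subtractf by simp
  qed
  ultimately have "(\<lambda>z. h z - (\<Sum>i<p. \<Sum>j<q. c' i j * (fst z ^ i * snd z ^ j)) - r'' z) \<in> germ_ideal P Q"
    by (rule germ_ideal_cong)
  then show ?case using r'' by blast
qed

lemma spanning:
  assumes "holomorphic_germ h"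
  obtains c where "(\<lambda>z. h z - (\<Sum>i<p. \<Sum>j<q. c i j * (fst z ^ i * snd z ^ j))) \<in> germ_ideal P Q"
proof -
  obtain c r where cr: "r \<in> max_power (p + q - 1)"
    "(\<lambda>z. h z - (\<Sum>i<p. \<Sum>j<q. c i j * (fst z ^ i * snd z ^ j)) - r z) \<in> germ_ideal P Q"
    using spanning_modulo_max_power[OF assms] by blast
  show ?thesis
    using that germ_ideal_add[OF cr(2) max_power_subset_ideal[OF cr(1)]] by simp
qed

text \<open>Homogeneous parts are compared degree by degree. For \<open>e < p + q\<close> the basis
  monomials of degree \<open>e\<close>, the multiples of \<open>x ^ p\<close> and those of
  \<open>y ^ q\<close> are disjoint sets of monomials, so the three contributions vanish separately.
  This raises the orders of \<open>A\<close> and \<open>B\<close> and lets the induction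
  proceed.\<close>

lemma independence:
  assumes "(\<lambda>z. \<Sum>i<p. \<Sum>j<q. c i j * (fst z ^ i * snd z ^ j)) \<in> germ_ideal P Q" "i < p" "j < q"
  shows "c i j = 0"
proof -
  define H where "H = (\<lambda>z :: C2. \<Sum>i<p. \<Sum>j<q. c i j * (fst z ^ i * snd z ^ j))"
  obtain A B where AB: "holomorphic_germ A" "holomorphic_germ B" "\<forall>\<^sub>F z in nhds 0. H z = A z * P z + B z * Q z"
    using assms(1) unfolding germ_ideal_def H_def by blast
  \<comment> \<open>Degrees below \<open>p + q - 1\<close> are enough, since a basis monomial has
    \<open>i + j \<le> p + q - 2\<close>.\<close>
  have "(\<forall>i<p. \<forall>j<q. i + j < e \<longrightarrow> c i j = 0) \<and> A \<in> max_power (e - p) \<and> B \<in> max_power (e - q)"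
    if "e \<le> p + q - 1" for e
    using that
  proof (induction e)
    case 0
    then show ?case using AB max_power_0 by simp
  next
    case (Suc e)
    then have IH: "\<And>i j. i < p \<Longrightarrow> j < q \<Longrightarrow> i + j < e \<Longrightarrow> c i j = 0"
      and A: "A \<in> max_power (e - (p + 0))" and B: "B \<in> max_power (e - (0 + q))" by auto
    obtain CA RA where CA: "RA \<in> max_power (Suc e)"
      "\<forall>\<^sub>F z in nhds 0. fst z ^ p * snd z ^ 0 * A z = (\<Sum>i\<le>e. CA i * (fst z ^ i * snd z ^ (e - i))) + RA z"
      "\<forall>i. CA i \<noteq> 0 \<longrightarrow> p \<le> i \<and> i + 0 \<le> e"
      "(\<forall>i\<le>e. CA i = 0) \<longrightarrow> A \<in> max_power (Suc e - (p + 0))"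
      by (rule monomial_mult_leading_form[OF A])
    obtain CB RB where CB: "RB \<in> max_power (Suc e)"
      "\<forall>\<^sub>F z in nhds 0. fst z ^ 0 * snd z ^ q * B z = (\<Sum>i\<le>e. CB i * (fst z ^ i * snd z ^ (e - i))) + RB z"
      "\<forall>i. CB i \<noteq> 0 \<longrightarrow> 0 \<le> i \<and> i + q \<le> e"
      "(\<forall>i\<le>e. CB i = 0) \<longrightarrow> B \<in> max_power (Suc e - (0 + q))"
      by (rule monomial_mult_leading_form[OF B])
    have Ah: "(\<lambda>z. A z * h\<^sub>1 z) \<in> max_power (Suc e)"
      by (rule max_power_antimono[OF _ max_power_mult[OF A h(1)]]) (use pq in simp)
    have Bh: "(\<lambda>z. B z * h\<^sub>2 z) \<in> max_power (Suc e)"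
      by (rule max_power_antimono[OF _ max_power_mult[OF B h(2)]]) simp
    define CH where "CH = (\<lambda>i. if i < p \<and> e - i < q then c i (e - i) else 0)"
    define RH where "RH = (\<lambda>z :: C2. \<Sum>i<p. \<Sum>j<q. fst z ^ i * snd z ^ j * (if e < i + j then c i j else 0))"
    have RH: "RH \<in> max_power (Suc e)"
      unfolding RH_def
    proof (intro max_power_sum)
      fix i j
      show "(\<lambda>z. fst z ^ i * snd z ^ j * (if e < i + j then c i j else 0)) \<in> max_power (Suc e)"
        using max_power_antimono[OF _ max_power_monomial[OF holomorphic_germ_const[of "c i j"] refl, of i j], of "Suc e"]
        by (cases "e < i + j") (simp_all add: max_power_zero)
    qed
    have H: "H z = (\<Sum>i\<le>e. CH i * (fst z ^ i * snd z ^ (e - i))) + RH z" for z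
    proof -
      have "(\<Sum>j<q. c i j * (fst z ^ i * snd z ^ j)) = (if i \<le> e then CH i * (fst z ^ i * snd z ^ (e - i)) else 0)
          + (\<Sum>j<q. fst z ^ i * snd z ^ j * (if e < i + j then c i j else 0))" if i: "i < p" for i
      proof -
        have "(\<Sum>j<q. c i j * (fst z ^ i * snd z ^ j))
            = (\<Sum>j<q. (if j = e - i then (if i \<le> e then c i (e - i) * (fst z ^ i * snd z ^ (e - i)) else 0) else 0)
               + fst z ^ i * snd z ^ j * (if e < i + j then c i j else 0))"
          using IH[OF i] by (intro sum.cong refl) (auto simp: linorder_neq_iff)
        also have "\<dots> = (if i \<le> e then CH i * (fst z ^ i * snd z ^ (e - i)) else 0)
          + (\<Sum>j<q. fst z ^ i * snd z ^ j * (if e < i + j then c i j else 0))"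
          using i by (simp add: sum.distrib CH_def)
        finally show ?thesis .
      qed
      then have "H z = (\<Sum>i<p. if i \<le> e then CH i * (fst z ^ i * snd z ^ (e - i)) else 0) + RH z"
        by (simp add: H_def RH_def sum.distrib)
      also have "(\<Sum>i<p. if i \<le> e then CH i * (fst z ^ i * snd z ^ (e - i)) else 0)
          = (\<Sum>i\<in>{..<p} \<inter> {..e}. CH i * (fst z ^ i * snd z ^ (e - i)))"
        by (simp add: sum.inter_restrict)
      also have "\<dots> = (\<Sum>i\<le>e. CH i * (fst z ^ i * snd z ^ (e - i)))"
        by (rule sum.mono_neutral_left) (auto simp: CH_def)
      finally show ?thesis .
    qed
    define C where "C = (\<lambda>i. CH i - \<alpha> * CA i - \<beta> * CB i)"
    have "(\<lambda>z. \<alpha> * RA z + A z * h\<^sub>1 z + (\<beta> * RB z + B z * h\<^sub>2 z) - RH z) \<in> max_power (Suc e)"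
      by (intro max_power_add max_power_diff max_power_mult_germ holomorphic_germ_const CA CB Ah Bh RH)
    moreover have "\<forall>\<^sub>F z in nhds 0. (\<Sum>i\<le>e. C i * (fst z ^ i * snd z ^ (e - i)))
        = \<alpha> * RA z + A z * h\<^sub>1 z + (\<beta> * RB z + B z * h\<^sub>2 z) - RH z"
      using AB(3) CA(2) CB(2)
    proof eventually_elim
      case (elim z)
      define SH where "SH = (\<Sum>i\<le>e. CH i * (fst z ^ i * snd z ^ (e - i)))"
      define SA where "SA = (\<Sum>i\<le>e. CA i * (fst z ^ i * snd z ^ (e - i)))"
      define SB where "SB = (\<Sum>i\<le>e. CB i * (fst z ^ i * snd z ^ (e - i)))"
      have e1: "(\<Sum>i\<le>e. C i * (fst z ^ i * snd z ^ (e - i))) = SH - \<alpha> * SA - \<beta> * SB"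
        by (simp add: C_def SH_def SA_def SB_def left_diff_distrib sum_subtractf sum_distrib_left mult.assoc)
      have e2: "fst z ^ p * A z = SA + RA z" "snd z ^ q * B z = SB + RB z"
        using elim(2,3) by (simp_all add: SA_def SB_def)
      have "SH + RH z = \<alpha> * (fst z ^ p * A z) + A z * h\<^sub>1 z + (\<beta> * (snd z ^ q * B z) + B z * h\<^sub>2 z)"
        unfolding SH_def H[symmetric] elim(1) P Q by (simp add: algebra_simps)
      then have "SH = \<alpha> * (SA + RA z) + A z * h\<^sub>1 z + (\<beta> * (SB + RB z) + B z * h\<^sub>2 z) - RH z"
        unfolding e2 eq_diff_eq .
      then show ?case unfolding e1 by (simp add: algebra_simps)
    qed
    ultimately have "(\<lambda>z. \<Sum>i\<le>e. C i * (fst z ^ i * snd z ^ (e - i))) \<in> max_power (Suc e)" by (rule max_power_cong)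
    then have C0: "C i = 0" if "i \<le> e" for i using homogeneous_in_higher_power_zero that by blast
    have zero: "CH i = 0 \<and> CA i = 0 \<and> CB i = 0" if "i \<le> e" for i
    proof -
      \<comment> \<open>A common monomial would need \<open>p \<le> i\<close> and
        \<open>i + q \<le> e\<close>, hence \<open>p + q \<le> e\<close>.\<close>
      have "CA i = 0 \<or> CB i = 0" using CA(3)[rule_format, of i] CB(3)[rule_format, of i] Suc.prems by linarith
      moreover have "CH i = 0 \<or> CA i = 0" using CA(3)[rule_format, of i] by (auto simp: CH_def)
      moreover have "CH i = 0 \<or> CB i = 0" using CB(3)[rule_format, of i] that by (auto simp: CH_def)
      ultimately show ?thesis using C0[OF that] nz by (auto simp: C_def)
    qed
    have "c i j = 0" if "i < p" "j < q" "i + j < Suc e" for i j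
    proof (cases "i + j = e")
      case True
      then show ?thesis using zero[of i] that by (auto simp: CH_def)
    qed (use IH that in simp)
    moreover have "A \<in> max_power (Suc e - (p + 0))" "B \<in> max_power (Suc e - (0 + q))" using CA(4) CB(4) zero by auto
    ultimately show ?case by simp
  qed
  from this[of "p + q - 1"] show ?thesis using assms(2,3) by simp
qed

lemma dimension_quotient:
  "Sup {enat (card B) | B. finite B \<and> (\<forall>b\<in>B. holomorphic_germ b) \<and>
      (\<forall>c. (\<lambda>z. \<Sum>b\<in>B. c b * b z) \<in> germ_ideal P Q \<longrightarrow> (\<forall>b\<in>B. c b = 0))} = enat (p * q)"
  (is "Sup ?S = _")
proof (rule antisym)
  define K where "K = {..<p} \<times> {..<q}"
  define mono where "mono = (\<lambda>(i, j) (z :: C2). fst z ^ i * snd z ^ j)"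
  have K: "finite K" "card K = p * q" by (auto simp: K_def)
  have double: "(\<Sum>i<p. \<Sum>j<q. c i j * (fst z ^ i * snd z ^ j)) = (\<Sum>k\<in>K. c (fst k) (snd k) * mono k z)"
    for c :: "nat \<Rightarrow> nat \<Rightarrow> complex" and z :: C2
    unfolding K_def mono_def sum.cartesian_product by (simp add: split_beta)
  show "enat (p * q) \<le> Sup ?S"
  proof (rule Sup_upper)
    \<comment> \<open>Cardinalities of sets of functions are counted, so the monomials must differ
      as functions; their values at \<open>(2, 1)\<close> and \<open>(1, 2)\<close> recover the
      exponents.\<close>
    have inj: "inj_on mono K"
    proof (rule inj_onI)
      fix k k' assume "mono k = mono k'"
      then have "mono k (2, 1) = mono k' (2, 1)" "mono k (1, 2) = mono k' (1, 2)" by simp_all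
      then have "(of_nat (2 ^ fst k) :: complex) = of_nat (2 ^ fst k')" "(of_nat (2 ^ snd k) :: complex) = of_nat (2 ^ snd k')"
        by (simp_all add: mono_def split_beta)
      then have "(2::nat) ^ fst k = 2 ^ fst k'" "(2::nat) ^ snd k = 2 ^ snd k'" by (simp_all only: of_nat_eq_iff)
      then show "k = k'" by (simp add: prod_eq_iff)
    qed
    have germ: "holomorphic_germ (mono k)" for k
      unfolding mono_def split_beta
      by (intro holomorphic_germ_mult holomorphic_germ_power holomorphic_germ_fst holomorphic_germ_snd)
    have "c (mono k) = 0" if c: "(\<lambda>z. \<Sum>b\<in>mono ` K. c b * b z) \<in> germ_ideal P Q" and k: "k \<in> K" for c k
    proof -
      have "(\<Sum>b\<in>mono ` K. c b * b z) = (\<Sum>i<p. \<Sum>j<q. c (mono (i, j)) * (fst z ^ i * snd z ^ j))" for z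
        unfolding double sum.reindex[OF inj] by simp
      then have "c (mono (fst k, snd k)) = 0"
        using independence[of "\<lambda>i j. c (mono (i, j))" "fst k" "snd k"] c k by (auto simp: K_def)
      then show ?thesis by simp
    qed
    moreover have "card (mono ` K) = p * q" using card_image[OF inj] K by simp
    ultimately show "enat (p * q) \<in> ?S" using germ K(1) by (intro CollectI exI[of _ "mono ` K"]) auto
  qed
  show "Sup ?S \<le> enat (p * q)"
  proof (rule Sup_least)
    fix x assume "x \<in> ?S"
    then obtain B where B: "x = enat (card B)" "finite B" "\<And>b. b \<in> B \<Longrightarrow> holomorphic_germ b"
      "\<And>c b. (\<lambda>z. \<Sum>b\<in>B. c b * b z) \<in> germ_ideal P Q \<Longrightarrow> b \<in> B \<Longrightarrow> c b = 0" by blast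
    have "card B \<le> card K"
    proof (rule ccontr)
      assume "\<not> card B \<le> card K"
      \<comment> \<open>The coordinates of \<open>b\<close> modulo the ideal. A relation between
        more than \<open>p * q\<close> such vectors puts a nontrivial combination of
        \<open>B\<close> into the ideal.\<close>
      have "\<exists>v. (\<lambda>z. b z - (\<Sum>k\<in>K. v k * mono k z)) \<in> germ_ideal P Q" if b: "b \<in> B" for b
      proof -
        obtain c where "(\<lambda>z. b z - (\<Sum>i<p. \<Sum>j<q. c i j * (fst z ^ i * snd z ^ j))) \<in> germ_ideal P Q"
          by (rule spanning[OF B(3)[OF b]])
        then show ?thesis unfolding double by (intro exI[of _ "\<lambda>k. c (fst k) (snd k)"])
      qed
      then have "\<exists>v. \<forall>b\<in>B. (\<lambda>z. b z - (\<Sum>k\<in>K. v b k * mono k z)) \<in> germ_ideal P Q"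
        by (intro bchoice ballI)
      then obtain v where "\<forall>b\<in>B. (\<lambda>z. b z - (\<Sum>k\<in>K. v b k * mono k z)) \<in> germ_ideal P Q" by (rule exE)
      then have v: "\<And>b. b \<in> B \<Longrightarrow> (\<lambda>z. b z - (\<Sum>k\<in>K. v b k * mono k z)) \<in> germ_ideal P Q" by simp
      obtain d where d: "\<exists>b\<in>B. d b \<noteq> 0" "\<forall>k\<in>K. (\<Sum>b\<in>B. d b * v b k) = 0"
        using exists_linear_relation[OF K(1) B(2), of v] \<open>\<not> card B \<le> card K\<close> by auto
      have "(\<lambda>z. \<Sum>b\<in>B. d b * (b z - (\<Sum>k\<in>K. v b k * mono k z))) \<in> germ_ideal P Q"
        by (intro germ_ideal_sum germ_ideal_cmult v)
      moreover have "(\<Sum>b\<in>B. d b * (b z - (\<Sum>k\<in>K. v b k * mono k z))) = (\<Sum>b\<in>B. d b * b z)" for z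
      proof -
        have "(\<Sum>b\<in>B. d b * (\<Sum>k\<in>K. v b k * mono k z)) = (\<Sum>k\<in>K. (\<Sum>b\<in>B. d b * v b k) * mono k z)"
          unfolding sum_distrib_left sum_distrib_right by (subst sum.swap) (simp add: mult.assoc)
        also have "\<dots> = 0" using d(2) by simp
        finally show ?thesis by (simp add: right_diff_distrib sum_subtractf)
      qed
      ultimately show False using B(4)[of d] d(1) by auto
    qed
    then show "x \<le> enat (p * q)" using B(1) K(2) by simp
  qed
qed

end

section \<open>Plane sections of the unfolding\<close>

definition section_equation :: "nat \<Rightarrow> nat \<Rightarrow> nat \<Rightarrow> complex \<Rightarrow> complex \<Rightarrow> complex \<Rightarrow> complex \<Rightarrow> C2 \<Rightarrow> complex"
  where "section_equation n m k a b c t z =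
    a * (fst z ^ n + t * snd z ^ n) + b * snd z ^ m + c * (fst z + snd z) ^ k"

lemma partial_x_section_equation:
  "partial_x (section_equation n m k a b c t) z =
    a * of_nat n * fst z ^ (n - 1) + c * of_nat k * (fst z + snd z) ^ (k - 1)"
proof -
  have "((\<lambda>u. section_equation n m k a b c t (u, snd z)) has_field_derivative
      a * of_nat n * fst z ^ (n - 1) + c * of_nat k * (fst z + snd z) ^ (k - 1)) (at (fst z))"
    unfolding section_equation_def by (auto intro!: derivative_eq_intros)
  then show ?thesis unfolding partial_x_def split_beta by (rule DERIV_imp_deriv)
qed

lemma partial_y_section_equation:
  "partial_y (section_equation n m k a b c t) z =
    a * t * of_nat n * snd z ^ (n - 1) + b * of_nat m * snd z ^ (m - 1) + c * of_nat k * (fst z + snd z) ^ (k - 1)"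
proof -
  have "((\<lambda>v. section_equation n m k a b c t (fst z, v)) has_field_derivative
      a * t * of_nat n * snd z ^ (n - 1) + b * of_nat m * snd z ^ (m - 1) + c * of_nat k * (fst z + snd z) ^ (k - 1)) (at (snd z))"
    unfolding section_equation_def by (auto intro!: derivative_eq_intros)
  then show ?thesis unfolding partial_y_def split_beta by (rule DERIV_imp_deriv)
qed

lemma max_power_scaled_power:
  assumes "d \<le> l" "h \<in> max_power 1"
  shows "(\<lambda>z. c * h z ^ l) \<in> max_power d"
  by (rule max_power_antimono[OF assms(1)])
     (intro max_power_mult_germ max_power_power assms holomorphic_germ_const)

lemma max_power_fst_add_snd: "(\<lambda>z. fst z + snd z) \<in> max_power 1"
  by (intro max_power_add max_power_fst max_power_snd)

lemma milnor_number_eq: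
  assumes "leading_monomials p q \<alpha> \<beta> h\<^sub>1 h\<^sub>2 (partial_x g) (partial_y g)"
  shows "milnor_number g = enat (p * q)"
  unfolding milnor_number_def jacobian_ideal_eq by (rule leading_monomials.dimension_quotient[OF assms])

text \<open>At \<open>t = 0\<close> the \<open>y\<close>-derivative starts with
  \<open>y ^ (m - 1)\<close>, and \<open>m < k\<close> gives both remainders order at least
  \<open>m\<close>.\<close>

lemma milnor_number_section_0:
  assumes "2 \<le> n" "n < m" "m < k" "a \<noteq> 0" "b \<noteq> 0"
  shows "milnor_number (section_equation n m k a b c 0) = enat ((n - 1) * (m - 1))"
proof (rule milnor_number_eq)
  show "leading_monomials (n - 1) (m - 1) (a * of_nat n) (b * of_nat m)
      (\<lambda>z. c * of_nat k * (fst z + snd z) ^ (k - 1)) (\<lambda>z. c * of_nat k * (fst z + snd z) ^ (k - 1))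
      (partial_x (section_equation n m k a b c 0)) (partial_y (section_equation n m k a b c 0))"
  proof
    show "(\<lambda>z. c * of_nat k * (fst z + snd z) ^ (k - 1)) \<in> max_power (Suc (m - 1))"
      by (rule max_power_scaled_power[OF _ max_power_fst_add_snd]) (use assms in simp)
  qed (use assms in \<open>auto simp: partial_x_section_equation partial_y_section_equation\<close>)
qed

text \<open>For \<open>t \<noteq> 0\<close> the term \<open>t * y ^ n\<close> supplies the leading
  power \<open>y ^ (n - 1)\<close>, and \<open>y ^ (m - 1)\<close> moves into the remainder, whose
  order is at least \<open>n\<close> by \<open>n < m\<close>.\<close>

lemma milnor_number_section:
  assumes "2 \<le> n" "n < m" "m < k" "a \<noteq> 0" "t \<noteq> 0"
  shows "milnor_number (section_equation n m k a b c t) = enat ((n - 1) * (n - 1))"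
proof (rule milnor_number_eq)
  show "leading_monomials (n - 1) (n - 1) (a * of_nat n) (a * t * of_nat n)
      (\<lambda>z. c * of_nat k * (fst z + snd z) ^ (k - 1))
      (\<lambda>z. b * of_nat m * snd z ^ (m - 1) + c * of_nat k * (fst z + snd z) ^ (k - 1))
      (partial_x (section_equation n m k a b c t)) (partial_y (section_equation n m k a b c t))"
  proof
    show h: "(\<lambda>z. c * of_nat k * (fst z + snd z) ^ (k - 1)) \<in> max_power (Suc (n - 1))"
      by (rule max_power_scaled_power[OF _ max_power_fst_add_snd]) (use assms in simp)
    show "(\<lambda>z. b * of_nat m * snd z ^ (m - 1) + c * of_nat k * (fst z + snd z) ^ (k - 1)) \<in> max_power (Suc (n - 1))"
      by (intro max_power_add h max_power_scaled_power max_power_snd) (use assms in simp)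
  qed (use assms in \<open>auto simp: partial_x_section_equation partial_y_section_equation\<close>)
qed

lemma curve_has_milnor_number_section:
  assumes f: "f = (\<lambda>(x, y). (x ^ n + t * y ^ n, y ^ m, (x + y) ^ k))" and pos: "0 < n" "0 < m" "0 < k"
    and \<mu>: "milnor_number (section_equation n m k a b c t) = enat N"
  shows "curve_has_milnor_number (f -` plane a b c) N"
  unfolding curve_has_milnor_number_def
proof (intro exI[of _ "section_equation n m k a b c t"] conjI \<mu>)
  show "holomorphic_germ (section_equation n m k a b c t)"
    unfolding section_equation_def [abs_def]
    by (intro holomorphic_germ_add holomorphic_germ_mult holomorphic_germ_power holomorphic_germ_const
        holomorphic_germ_fst holomorphic_germ_snd)
  show "section_equation n m k a b c t 0 = 0" using pos by (simp add: section_equation_def zero_power)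
  show "\<forall>\<^sub>F z in nhds 0. z \<in> f -` plane a b c \<longleftrightarrow> section_equation n m k a b c t z = 0"
    by (simp add: f plane_def section_equation_def split_beta)
qed

text \<open>The witness takes the value \<open>a * b\<close>: in the iterated encoding the outermost
  variable stands for \<open>a\<close> and the next one for \<open>b\<close>.\<close>

lemma generic_planeI:
  assumes "\<And>a b c. a \<noteq> 0 \<Longrightarrow> b \<noteq> 0 \<Longrightarrow> P (plane a b c)"
  shows "generic_plane P"
  unfolding generic_plane_def
proof (intro exI[of _ "monom (monom 1 1) 1 :: complex poly poly poly"] conjI allI impI)
  show "monom (monom 1 1) 1 \<noteq> (0 :: complex poly poly poly)" by (simp add: monom_eq_0_iff)
  fix a b c :: complex
  assume "(a, b, c) \<noteq> 0 \<and> poly (poly (poly (monom (monom 1 1) 1) [:[:a:]:]) [:b:]) c \<noteq> 0"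
  then show "P (plane a b c)" by (intro assms) (auto simp: poly_monom)
qed

theorem mainTheorem2:
  fixes n m k :: nat
    and f :: "complex \<Rightarrow> C2 \<Rightarrow> C3"
  assumes "2 \<le> n" and "2 \<le> m" and "2 \<le> k"
    and "coprime n m" and "coprime n k" and "coprime m k"
    and "n < m" and "m < k"
    and f_def: "f = (\<lambda>t (x, y). (x ^ n + t * y ^ n, y ^ m, (x + y) ^ k))"
  shows "topologically_trivial f \<and>
    \<not> whitney_equisingular (unfolding_of f) \<and>
    generic_plane (\<lambda>H.
      curve_has_milnor_number (f 0 -` H) ((n - 1) * (m - 1)) \<and>
      (n - 1) * (m - 1) > (n - 1)\<^sup>2 \<and>
      (\<forall>\<^sub>F t in at 0. curve_has_milnor_number (f t -` H) ((n - 1)\<^sup>2)))"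
proof (intro conjI)
  show "topologically_trivial f"
    unfolding f_def by (rule topologically_trivial_homogeneous_unfolding) (use assms in auto)
  interpret homogeneous_unfolding n m k by standard (use assms in auto)
  have "unfolding_of f = F"
    by (simp add: fun_eq_iff unfolding_of_def F_def f_def)
  then show "\<not> whitney_equisingular (unfolding_of f)"
    using not_whitney_equisingular_F by simp
  have pos: "0 < n" "0 < m" "0 < k" using assms by auto
  have f_t: "f t = (\<lambda>(x, y). (x ^ n + t * y ^ n, y ^ m, (x + y) ^ k))" for t
    by (simp add: f_def)
  show "generic_plane (\<lambda>H.
      curve_has_milnor_number (f 0 -` H) ((n - 1) * (m - 1)) \<and>
      (n - 1) * (m - 1) > (n - 1)\<^sup>2 \<and>
      (\<forall>\<^sub>F t in at 0. curve_has_milnor_number (f t -` H) ((n - 1)\<^sup>2)))"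
  proof (rule generic_planeI, intro conjI)
    fix a b c :: complex assume ab: "a \<noteq> 0" "b \<noteq> 0"
    show "curve_has_milnor_number (f 0 -` plane a b c) ((n - 1) * (m - 1))"
      by (rule curve_has_milnor_number_section[OF f_t pos milnor_number_section_0]) (use assms ab in auto)
    show "(n - 1) * (m - 1) > (n - 1)\<^sup>2"
      using assms(1,7) by (simp add: power2_eq_square)
    have "\<forall>\<^sub>F t :: complex in at 0. t \<noteq> 0" by (simp add: eventually_at_filter)
    then show "\<forall>\<^sub>F t in at 0. curve_has_milnor_number (f t -` plane a b c) ((n - 1)\<^sup>2)"
    proof (rule eventually_mono)
      fix t :: complex assume "t \<noteq> 0"
      then show "curve_has_milnor_number (f t -` plane a b c) ((n - 1)\<^sup>2)"
        unfolding power2_eq_square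
        by (intro curve_has_milnor_number_section[OF f_t pos milnor_number_section]) (use assms ab in auto)
    qed
  qed
qed

end
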